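(* Let $K$ be an infinite field of characteristic $p=3$. Consider multidegrees $\Delta=(\delta_1,\ldots,\delta_d)$ with $d\ge1$ and $\delta_1\ge\cdots\ge\delta_d\ge1$. 1. For $r,s,l\ge0$ with $d=r+s+l\ge1$, a basis of $N_{3,d}(3^r2^s1^l)$ is the set $B_{3^r2^s1^l}$ defined in the context. 2. The remaining homogeneous components $N_{3,d}(\Delta)$ of $N_{3,d}$ are equal to zero.
   Context: $N_{3,d}$ is the quotient of the free associative non-unitary $K$-algebra $K\langle x_1,\ldots,x_d\rangle^{\#}$ by the ideal generated by all $a^3$, $a\in K\langle x_1,\ldots,x_d\rangle^{\#}$. It is $\mathbb N^d$-graded by multidegree and $N_{3,d}(\Delta)$ is the component of multidegree $\Delta$. $3^r2^s1^l$ denotes the multidegree $(3,\ldots,3,2,\ldots,2,1,\ldots,1)$ with $r$ threes, $s$ twos, $l$ ones. Words are identified with their images in $N_{3,d}$. The product $x_i\cdots x_j$ means $x_ix_{i+1}\cdots x_j$ if $1\le i\le j$ and the empty word otherwise. For a set of words $S$, $S|_{\ldots}$ denotes the result of the indicated substitution of letters, and $vS=\{vu\mid u\in S\}$. Sets $B_{1^d}$ for $p=3$ (recursive): $B_{1^0}=\{1\}$ ($1$ the empty word), $B_{1}=\{x_1\}$, and for $d\ge2$ $$B_{1^d}=x_1\{B_{1^{d-1}}|_{x_i\to x_{i+1},\,i=1,\ldots,d-1}\}\cup x_2\{B_{1^{d-1}}|_{x_i\to x_{i+1},\,i=2,\ldots,d-1}\}\cup\{\underline e_{d,k}\mid k=3,\ldots,d\},$$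 where $\underline e_{d,k}=x_3\cdots x_k\cdot x_1x_2\cdot x_{k+1}\cdots x_d$ ($d\ge3$, $3\le k\le d$); in the second set $x_1$ is left unchanged. Put $\underline w_{ij}=x_i^2x_j^2x_ix_j$, $\underline u_{2k}=\underline w_{12}\underline w_{34}\cdots\underline w_{2k-1,2k}$ for $k\ge1$, and $\underline u_0$ the empty word. Put - $\underline q_{2r,s,k}=\underline u_{2r-2}\cdot x_{2r-1}^2x_{2r}^2\cdot x_{2r+1}\cdots x_{2r+k}\cdot x_{2r-1}x_{2r}\cdot x_{2r+k+1}\cdots x_{2r+s}$ ($r,s\ge1$, $1\le k\le s$); - $\underline q_{2r+1,s,k}=\underline u_{2r}\cdot x_{2r+1}^2\cdot x_{2r+3}\cdots x_{2r+k}\cdot x_{2r+1}x_{2r+2}\cdot x_{2r+k+1}\cdots x_{2r+s+1}$ ($r\ge0$, $s\ge2$, $3\le k\le s+1$); - $\underline q_{2r+1,s}=\underline u_{2r-2}\cdot x_{2r-1}^2x_{2r}^2x_{2r+1}^2x_{2r-1}x_{2r}x_{2r+1}\cdot x_{2r+2}\cdots x_{2r+s+1}$ ($r\ge1$, $s\ge0$). For $r,s\ge0$ define (words $\underline q$ whose indices are outside the stated ranges are omitted) $$B_{3^{2r}1^s}=\underline u_{2r}\{B_{1^s}|_{x_i\to x_{i+2r},\,i=1,\ldots,s}\}\cup\{\underline q_{2r,s,k}\mid k=1,\ldots,s\},$$ $$B_{3^{2r+1}1^s}=\underline u_{2r}x_{2r+1}^2x_{2r+2}\{B_{1^s}|_{x_1\to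 x_{2r+1},\,x_i\to x_{i+2r+1},\,i=2,\ldots,s}\}\cup\{\underline q_{2r+1,s,k}\mid k=3,\ldots,s+1\}\cup\{\underline q_{2r+1,s}\},$$ where the first set in the second formula is omitted when $s=0$ (so $B_{3^{2r+1}}=\{\underline q_{2r+1,0}\}$ for $r\ge1$ and $B_{3}=\emptyset$). Finally $B_{3^r2^s1^l}=B_{3^r1^{s+l}}|_{x_i\to x_i^2,\,i=r+1,\ldots,r+s}$. *)

theory Defs
  imports "Jordan_Normal_Form.VS_Connect" "HOL-Algebra.QuotRing" "HOL-Library.Poly_Mapping"
begin

section \<open>Free associative algebras without unit\<close>

text \<open>
  A word $x_{i_1} \cdots x_{i_n}$ is the list $[i_1, \ldots, i_n]$ of its letters, numbered from 1.
  With concatenation as addition on words, the library's (monoid) multiplication on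
  finitely supported functions from words to \<open>'k\<close> is that of the free unital algebra.
\<close>

instantiation list :: (type) monoid_add
begin

definition zero_list :: "'a list" where
  "zero_list = []"

definition plus_list :: "'a list \<Rightarrow> 'a list \<Rightarrow> 'a list" where
  "plus_list = (@)"

instance
  by standard (simp_all add: zero_list_def plus_list_def)

end

type_synonym 'k free = "nat list \<Rightarrow>\<^sub>0 'k"

text \<open>
  The record type for modules has a field \<open>one\<close>. In \<open>free_alg\<close> and in the quotient \<open>nil_alg\<close>
  below it is only a dummy: these algebras have no unit, and \<open>1\<close> is not in the carrier of
  \<open>free_alg\<close>.
\<close>

definition free_alg :: "nat \<Rightarrow> ('k::field, 'k free) module" where
  "free_alg d =
    \<lparr>carrier = {a. \<forall>w\<in>Poly_Mapping.keys a. w \<noteq> [] \<and> set w \<subseteq> {1..d}},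
     mult = (*), one = 1, zero = 0, add = (+),
     smult = (\<lambda>c a. Poly_Mapping.single [] c * a)\<rparr>"

definition word_poly :: "nat list \<Rightarrow> 'k::field free" where
  "word_poly w = Poly_Mapping.single w 1"

section \<open>The relatively free nil algebra of index 3\<close>

inductive_set cube_ideal :: "nat \<Rightarrow> 'k::field free set" for d :: nat where
  cube: "a \<in> carrier (free_alg d) \<Longrightarrow> a ^ 3 \<in> cube_ideal d"
| zero: "0 \<in> cube_ideal d"
| add: "a \<in> cube_ideal d \<Longrightarrow> b \<in> cube_ideal d \<Longrightarrow> a + b \<in> cube_ideal d"
| smult: "a \<in> cube_ideal d \<Longrightarrow> c \<odot>\<^bsub>free_alg d\<^esub> a \<in> cube_ideal d"
| mult_left: "a \<in> cube_ideal d \<Longrightarrow> b \<in> carrier (free_alg d) \<Longrightarrow> b * a \<in> cube_ideal d"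
| mult_right: "a \<in> cube_ideal d \<Longrightarrow> b \<in> carrier (free_alg d) \<Longrightarrow> a * b \<in> cube_ideal d"

definition nil_class :: "nat \<Rightarrow> 'k::field free \<Rightarrow> 'k free set" where
  "nil_class d a = cube_ideal d +>\<^bsub>free_alg d\<^esub> a"

definition nil_alg :: "nat \<Rightarrow> ('k::field, 'k free set) module" where
  "nil_alg d =
    \<lparr>carrier = a_rcosets\<^bsub>free_alg d\<^esub> (cube_ideal d),
     mult = rcoset_mult (free_alg d) (cube_ideal d),
     one = nil_class d 1,
     zero = cube_ideal d,
     add = set_add (free_alg d),
     smult = (\<lambda>c A. \<Union>a\<in>A. nil_class d (c \<odot>\<^bsub>free_alg d\<^esub> a))\<rparr>"

definition multideg :: "nat \<Rightarrow> nat list \<Rightarrow> nat list" where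
  "multideg d w = map (count_list w) [1..<d + 1]"

definition nil_component :: "nat \<Rightarrow> nat list \<Rightarrow> ('k::field, 'k free set) module" where
  "nil_component d \<Delta> = (nil_alg d)
    \<lparr>carrier := nil_class d ` {a \<in> carrier (free_alg d). \<forall>w\<in>Poly_Mapping.keys a. multideg d w = \<Delta>}\<rparr>"

definition nil_word :: "nat \<Rightarrow> nat list \<Rightarrow> 'k::field free set" where
  "nil_word d w = nil_class d (word_poly w)"

text \<open>Every component is a vector space over \<open>'k\<close>, as required by the locale that defines bases.\<close>

lemma cube_ideal_uminus: "a \<in> cube_ideal d \<Longrightarrow> - a \<in> cube_ideal d"
proof -
  assume a: "a \<in> cube_ideal d"
  have "Poly_Mapping.single [] (-1) * a = - a"
    by (metis mult_minus1 single_one single_uminus zero_list_def)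
  with cube_ideal.smult[OF a, of "-1"] show ?thesis
    by (simp add: free_alg_def)
qed

lemma nil_class_alt: "nil_class d a = (\<lambda>h. h + a) ` cube_ideal d"
  by (auto simp: nil_class_def a_r_coset_def r_coset_def free_alg_def)

lemma nil_class_absorb:
  assumes "h \<in> cube_ideal d"
  shows "nil_class d (h + a) = nil_class d a"
proof -
  have "x + a \<in> nil_class d (h + a)" if "x \<in> cube_ideal d" for x
    using cube_ideal.add[OF that cube_ideal_uminus[OF assms]]
    unfolding nil_class_alt image_iff by (intro bexI[of _ "x - h"]) simp_all
  moreover have "x + (h + a) \<in> nil_class d a" if "x \<in> cube_ideal d" for x
    using cube_ideal.add[OF that assms]
    unfolding nil_class_alt image_iff by (intro bexI[of _ "x + h"]) (simp_all add: add.assoc)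
  ultimately show ?thesis
    by (auto simp: nil_class_alt)
qed

lemma nil_class_zero: "nil_class d 0 = cube_ideal d"
  by (simp add: nil_class_alt)

lemma nil_alg_add:
  "nil_class d a \<oplus>\<^bsub>nil_alg d\<^esub> nil_class d b = nil_class d (a + b)"
proof
  show "nil_class d a \<oplus>\<^bsub>nil_alg d\<^esub> nil_class d b \<subseteq> nil_class d (a + b)"
  proof
    fix x assume "x \<in> nil_class d a \<oplus>\<^bsub>nil_alg d\<^esub> nil_class d b"
    then obtain g h where gh: "g \<in> cube_ideal d" "h \<in> cube_ideal d" "x = (g + a) + (h + b)"
      by (auto simp: nil_alg_def free_alg_def set_add_def set_mult_def nil_class_alt)
    then have "x = (g + h) + (a + b)"
      by (simp add: algebra_simps)
    with gh show "x \<in> nil_class d (a + b)"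
      by (auto simp: nil_class_alt intro: cube_ideal.add)
  qed
  show "nil_class d (a + b) \<subseteq> nil_class d a \<oplus>\<^bsub>nil_alg d\<^esub> nil_class d b"
  proof
    fix x assume "x \<in> nil_class d (a + b)"
    then obtain h where h: "h \<in> cube_ideal d" "x = (h + a) + b"
      by (auto simp: nil_class_alt add.assoc)
    have "h + a \<in> nil_class d a" "b \<in> nil_class d b"
      using h(1) by (auto simp: nil_class_alt image_iff intro: cube_ideal.zero bexI[of _ 0])
    with h(2) show "x \<in> nil_class d a \<oplus>\<^bsub>nil_alg d\<^esub> nil_class d b"
      by (auto simp: nil_alg_def free_alg_def set_add_def set_mult_def)
  qed
qed

lemma nil_alg_smult:
  "c \<odot>\<^bsub>nil_alg d\<^esub> nil_class d a = nil_class d (Poly_Mapping.single [] c * a)"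
proof -
  have "nil_class d (Poly_Mapping.single [] c * (h + a)) =
      nil_class d (Poly_Mapping.single [] c * a)" if "h \<in> cube_ideal d" for h
    using nil_class_absorb[OF cube_ideal.smult[OF that, of c]]
    by (simp add: free_alg_def distrib_left)
  moreover have "c \<odot>\<^bsub>nil_alg d\<^esub> nil_class d a =
      (\<Union>h\<in>cube_ideal d. nil_class d (Poly_Mapping.single [] c * (h + a)))"
    by (auto simp: nil_alg_def free_alg_def nil_class_alt)
  ultimately show ?thesis
    using cube_ideal.zero[of d] by force
qed

lemma vectorspace_nil_component:
  "vectorspace class_ring (nil_component d \<Delta> :: ('k::field, 'k free set) module)"
proof -
  define C where "C = {a :: 'k free. (\<forall>w\<in>Poly_Mapping.keys a. w \<noteq> [] \<and> set w \<subseteq> {1..d}) \<and>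
    (\<forall>w\<in>Poly_Mapping.keys a. multideg d w = \<Delta>)}"
  let ?V = "nil_component d \<Delta> :: ('k, 'k free set) module"
  let ?s = "Poly_Mapping.single [] :: 'k \<Rightarrow> 'k free"
  have carrier: "carrier ?V = nil_class d ` C"
    by (simp add: nil_component_def C_def free_alg_def)
  have ops: "add ?V = add (nil_alg d)" "\<zero>\<^bsub>?V\<^esub> = nil_class d 0"
    "module.smult ?V = module.smult (nil_alg d)"
    by (simp_all add: nil_component_def nil_alg_def nil_class_zero)
  note ops = this nil_alg_add nil_alg_smult
  have zero: "0 \<in> C"
    by (simp add: C_def)
  have add: "a + b \<in> C" if "a \<in> C" "b \<in> C" for a b
    using that keys_add[of a b] unfolding C_def by blast
  have smult: "?s c * a \<in> C" if "a \<in> C" for a c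
  proof -
    have "Poly_Mapping.keys (?s c * a) \<subseteq> Poly_Mapping.keys a"
      using keys_mult[of "?s c" a] by (auto simp: plus_list_def split: if_splits)
    with that show ?thesis
      unfolding C_def by blast
  qed
  have minus: "\<exists>b\<in>C. b + a = 0" if "a \<in> C" for a
    using that by (intro bexI[of _ "- a"]) (simp_all add: C_def)
  have scalars: "?s (x + y) = ?s x + ?s y" "?s (x * y) = ?s x * ?s y" "?s 1 = 1" for x y
    by (simp_all add: single_add mult_single flip: single_one zero_list_def)
  have group: "abelian_group ?V"
  proof (rule abelian_groupI)
    fix x assume "x \<in> carrier ?V"
    then obtain a where a: "a \<in> C" "x = nil_class d a"
      by (auto simp: carrier)
    from minus[OF a(1)] obtain b where "b \<in> C" "b + a = 0"
      by blast
    with a show "\<exists>y\<in>carrier ?V. y \<oplus>\<^bsub>?V\<^esub> x = \<zero>\<^bsub>?V\<^esub>"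
      by (intro bexI[of _ "nil_class d b"]) (simp_all add: carrier ops)
  qed (auto simp: carrier ops zero add algebra_simps)
  have field: "field (class_ring :: 'k ring)"
    by (rule class_field.field_axioms)
  have "module class_ring ?V"
    by (rule moduleI[OF _ group])
      (use field in \<open>auto simp: field_def domain_def carrier ops smult scalars algebra_simps\<close>)
  with field show ?thesis
    by (simp add: vectorspace_def)
qed

section \<open>The sets of words\<close>

abbreviation run :: "nat \<Rightarrow> nat \<Rightarrow> nat list" where
  "run i j \<equiv> [i..<j + 1]"

definition e_word :: "nat \<Rightarrow> nat \<Rightarrow> nat list" where
  "e_word d k = run 3 k @ [1, 2] @ run (k + 1) d"

fun B_multilinear :: "nat \<Rightarrow> nat list set" where
  "B_multilinear 0 = {[]}"
| "B_multilinear (Suc 0) = {[1]}"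
| "B_multilinear (Suc (Suc n)) =
     (\<lambda>v. 1 # map (\<lambda>i. i + 1) v) ` B_multilinear (Suc n) \<union>
     (\<lambda>v. 2 # map (\<lambda>i. if i = 1 then 1 else i + 1) v) ` B_multilinear (Suc n) \<union>
     {e_word (Suc (Suc n)) k | k. 3 \<le> k \<and> k \<le> Suc (Suc n)}"

definition w_word :: "nat \<Rightarrow> nat \<Rightarrow> nat list" where
  "w_word i j = [i, i, j, j, i, j]"

text \<open>Here \<open>u_word k\<close> is the product of the first \<open>k\<close> blocks, in the letters \<open>1, \<dots>, 2 * k\<close>.\<close>

definition u_word :: "nat \<Rightarrow> nat list" where
  "u_word k = concat (map (\<lambda>j. w_word (2 * j - 1) (2 * j)) [1..<k + 1])"

text \<open>The following words have multidegree $3^{2r}1^s$, $3^{2r+1}1^s$ and $3^{2r+1}1^s$.\<close>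

definition q_even :: "nat \<Rightarrow> nat \<Rightarrow> nat \<Rightarrow> nat list" where
  "q_even r s k =
     u_word (r - 1) @ [2*r - 1, 2*r - 1, 2*r, 2*r] @ run (2*r + 1) (2*r + k) @
     [2*r - 1, 2*r] @ run (2*r + k + 1) (2*r + s)"

definition q_odd :: "nat \<Rightarrow> nat \<Rightarrow> nat \<Rightarrow> nat list" where
  "q_odd r s k =
     u_word r @ [2*r + 1, 2*r + 1] @ run (2*r + 3) (2*r + k) @
     [2*r + 1, 2*r + 2] @ run (2*r + k + 1) (2*r + s + 1)"

definition q_odd_last :: "nat \<Rightarrow> nat \<Rightarrow> nat list" where
  "q_odd_last r s =
     u_word (r - 1) @ [2*r - 1, 2*r - 1, 2*r, 2*r, 2*r + 1, 2*r + 1] @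
     [2*r - 1, 2*r, 2*r + 1] @ run (2*r + 2) (2*r + s + 1)"

definition B_even :: "nat \<Rightarrow> nat \<Rightarrow> nat list set" where
  "B_even r s =
     (\<lambda>v. u_word r @ map (\<lambda>i. i + 2*r) v) ` B_multilinear s \<union>
     {q_even r s k | k. 1 \<le> r \<and> 1 \<le> s \<and> 1 \<le> k \<and> k \<le> s}"

definition B_odd :: "nat \<Rightarrow> nat \<Rightarrow> nat list set" where
  "B_odd r s =
     (if s = 0 then {}
      else (\<lambda>v. u_word r @ [2*r + 1, 2*r + 1, 2*r + 2] @
                map (\<lambda>i. if i = 1 then 2*r + 1 else i + 2*r + 1) v) ` B_multilinear s) \<union>
     {q_odd r s k | k. 2 \<le> s \<and> 3 \<le> k \<and> k \<le> s + 1} \<union>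
     (if 1 \<le> r then {q_odd_last r s} else {})"

definition B_threes :: "nat \<Rightarrow> nat \<Rightarrow> nat list set" where
  "B_threes n s = (if even n then B_even (n div 2) s else B_odd (n div 2) s)"

definition B_words :: "nat \<Rightarrow> nat \<Rightarrow> nat \<Rightarrow> nat list set" where
  "B_words r s l =
     (\<lambda>v. concat (map (\<lambda>i. if r + 1 \<le> i \<and> i \<le> r + s then [i, i] else [i]) v)) ` B_threes r (s + l)"

definition multideg_321 :: "nat \<Rightarrow> nat \<Rightarrow> nat \<Rightarrow> nat list" where
  "multideg_321 r s l = replicate r 3 @ replicate s 2 @ replicate l 1"

end

theory Submission
  imports Defs
begin

text \<open>
  Why the theorem holds. In characteristic 3 the linearisation \<open>a\<^sup>2b + aba + ba\<^sup>2\<close> of the cube is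
  the double commutator \<open>[a, [a, b]]\<close>, so the nil algebra is a 2-Engel algebra. It follows that
  \<open>[[x, y], z]\<close> is alternating and central, that a product of commutators is alternating in all its
  entries, also when one factor is a triple commutator, and that a product of two triple commutators
  is 0. Hence there is one element \<open>C\<^sub>S\<close>, up to sign, for each set \<open>S\<close> of letters with
  \<open>|S| \<noteq> 1\<close>: a product of commutators of pairs, with one triple commutator if \<open>|S|\<close> is odd. Sorting
  the letters of a word in the Poincare-Birkhoff-Witt manner, the elements \<open>u C\<^sub>S\<close>, with \<open>u\<close> a
  sorted word, span. The cube of a letter is 0, so in degree \<open>3\<^sup>r2\<^sup>s1\<^sup>l\<close> only the sets \<open>S\<close> that
  contain the \<open>r\<close> letters of degree 3 survive, and nothing survives if some letter has degree at
  least 4.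

  Spanning. By induction on the length of \<open>u\<close> every \<open>u C\<^sub>S\<close> is rewritten in the given words; the
  order of the letters of \<open>u\<close> does not matter modulo shorter \<open>u\<close> (\<open>reorder\<close>,
  \<open>mixed_collect\<close>). In the multilinear case, words that begin with \<open>x\<^sub>1\<close> or \<open>x\<^sub>2\<close> are handled by
  recursion; what remains are the elements \<open>u [[x\<^sub>j, x\<^sub>1], x\<^sub>2]\<close>, and these are differences of
  consecutive words \<open>e_word\<close> modulo such words, because
  \<open>Q x\<^sub>1 x\<^sub>2 = [[Q, x\<^sub>1], x\<^sub>2] + x\<^sub>1 Q x\<^sub>2 + x\<^sub>2 Q x\<^sub>1 - x\<^sub>2 x\<^sub>1 Q\<close> and the triple commutator is a
  derivation in \<open>Q\<close> (\<open>multilinear_span\<close>). Letters of degree 3 come in pairs, since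
  \<open>x\<^sub>i\<^sup>2x\<^sub>j\<^sup>2x\<^sub>ix\<^sub>j = x\<^sub>i\<^sup>2x\<^sub>j\<^sup>2[x\<^sub>i, x\<^sub>j]\<close> (\<open>even_span\<close>, \<open>odd_span\<close>). A letter of degree 2 may be
  replaced by its square, since \<open>[x\<^sup>2, y] = - x [x, y]\<close> (\<open>square_letter\<close>).

  Independence. There are at most as many given words as there are admissible sets \<open>S\<close>
  (\<open>card_B_words\<close>), so it is enough that the elements \<open>C\<^sub>S u\<close> are independent. This needs
  functionals that vanish on the ideal of cubes and are triangular on these elements. They are
  the coefficients of \<open>word_ext w = exp(q)(1 + c)\<close>, where \<open>q\<close> and \<open>c\<close> are a quadratic and a cubic
  element of an exterior algebra attached to the word \<open>w\<close>. The even part \<open>exp(q)\<close> is the known model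
  of the free algebra modulo triple commutators; the odd part detects the triple commutators. The
  cubic element obeys the concatenation law \<open>cubic_append\<close>, which is associative only because the
  product of three linear forms is a coboundary in characteristic 3 (\<open>carry_cocycle\<close>); the cochain
  depends on an order of the letters. The sum over all orders of three words then cancels
  (\<open>word_perms_vanish\<close>), and \<open>word_ext\<close> does not see the cube of a word at all
  (\<open>word_ext_cube\<close>), so that a cube contributes nothing to the coefficient of a set that contains
  its letters.
\<close>

section \<open>The exterior algebra\<close>

text \<open>
  The parity of this number is the sign that sorts the product of two increasing products of
  generators, indexed by the sets.
\<close>

definition inv_count :: "nat set \<Rightarrow> nat set \<Rightarrow> nat" where
  "inv_count S T = card {(s, t). s \<in> S \<and> t \<in> T \<and> t < s}"

text \<open>
  An element is the family of its coefficients; a finite set stands for the product of its elements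
  in increasing order. Infinite sets have coefficient 0, since otherwise \<open>1\<close> would not be neutral.
\<close>

typedef (overloaded) 'k ext = "{f :: nat set \<Rightarrow> 'k::field. \<forall>S. infinite S \<longrightarrow> f S = 0}"
  morphisms coef Abs_ext
  by (rule exI[of _ "\<lambda>_. 0"]) simp

setup_lifting type_definition_ext

lemma ext_eqI: "(\<And>S. finite S \<Longrightarrow> coef x S = coef y S) \<Longrightarrow> x = y"
  by transfer (metis ext mem_Collect_eq)

lemma inv_count_finite:
  "finite S \<Longrightarrow> finite T \<Longrightarrow> finite {(s, t). s \<in> S \<and> t \<in> T \<and> t < (s::nat)}"
  by (rule finite_subset[of _ "S \<times> T"]) auto

lemma inv_count_Un_left:
  assumes "finite S" "finite T" "finite U" "S \<inter> T = {}"
  shows "inv_count (S \<union> T) U = inv_count S U + inv_count T U"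
proof -
  have "{(s, t). s \<in> S \<union> T \<and> t \<in> U \<and> t < s} =
    {(s, t). s \<in> S \<and> t \<in> U \<and> t < s} \<union> {(s, t). s \<in> T \<and> t \<in> U \<and> t < s}"
    by auto
  then show ?thesis
    unfolding inv_count_def using assms
    by (simp only:) (rule card_Un_disjoint, auto intro: inv_count_finite)
qed

lemma inv_count_Un_right:
  assumes "finite S" "finite T" "finite U" "T \<inter> U = {}"
  shows "inv_count S (T \<union> U) = inv_count S T + inv_count S U"
proof -
  have "{(s, t). s \<in> S \<and> t \<in> T \<union> U \<and> t < s} =
    {(s, t). s \<in> S \<and> t \<in> T \<and> t < s} \<union> {(s, t). s \<in> S \<and> t \<in> U \<and> t < s}"
    by auto
  then show ?thesis
    unfolding inv_count_def using assms
    by (simp only:) (rule card_Un_disjoint, auto intro: inv_count_finite)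
qed

lemma inv_count_empty [simp]: "inv_count {} T = 0" "inv_count S {} = 0"
  by (simp_all add: inv_count_def)

definition ext_times_fun :: "(nat set \<Rightarrow> 'k::field) \<Rightarrow> (nat set \<Rightarrow> 'k) \<Rightarrow> nat set \<Rightarrow> 'k" where
  "ext_times_fun f g S = (\<Sum>T\<in>Pow S. (- 1) ^ inv_count T (S - T) * (f T * g (S - T)))"

text \<open>
  Both sides are the sum over all ways to cut \<open>S\<close> into three consecutive factors, and the number of
  inversions is additive in each argument.
\<close>

lemma ext_times_fun_assoc:
  assumes S: "finite S"
  shows "ext_times_fun (ext_times_fun f g) h S = ext_times_fun f (ext_times_fun g h) S"
proof -
  define t where "t T1 T2 T3 = (- 1) ^ (inv_count T1 T2 + inv_count T1 T3 + inv_count T2 T3) *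
    (f T1 * g T2 * h T3)" for T1 T2 T3
  have sub: "finite A" if "A \<subseteq> S" for A using S that by (rule finite_subset[rotated])
  have "ext_times_fun (ext_times_fun f g) h S =
    (\<Sum>T\<in>Pow S. \<Sum>T1\<in>Pow T. t T1 (T - T1) (S - T))"
    unfolding ext_times_fun_def
  proof (rule sum.cong[OF refl])
    fix T assume "T \<in> Pow S"
    then have T: "T \<subseteq> S" by simp
    have *: "inv_count T (S - T) = inv_count T1 (S - T) + inv_count (T - T1) (S - T)" if "T1 \<subseteq> T" for T1
    proof -
      have "inv_count (T1 \<union> (T - T1)) (S - T) = inv_count T1 (S - T) + inv_count (T - T1) (S - T)"
        using T that by (intro inv_count_Un_left) (auto intro: sub)
      with that show ?thesis by (simp add: Un_absorb1)
    qed
    show "(- 1) ^ inv_count T (S - T) *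
      ((\<Sum>T1\<in>Pow T. (- 1) ^ inv_count T1 (T - T1) * (f T1 * g (T - T1))) * h (S - T)) =
      (\<Sum>T1\<in>Pow T. t T1 (T - T1) (S - T))"
      unfolding sum_distrib_left sum_distrib_right
      by (rule sum.cong[OF refl]) (simp add: t_def * power_add mult_ac)
  qed
  also have "\<dots> = (\<Sum>(T, T1)\<in>Sigma (Pow S) Pow. t T1 (T - T1) (S - T))"
    using S by (intro sum.Sigma) (auto intro: sub)
  also have "\<dots> = (\<Sum>(T1, T2)\<in>Sigma (Pow S) (\<lambda>T1. Pow (S - T1)). t T1 T2 (S - T1 - T2))"
    by (rule sum.reindex_bij_witness[of _ "\<lambda>(T1, T2). (T1 \<union> T2, T1)" "\<lambda>(T, T1). (T1, T - T1)"])
      (auto intro!: arg_cong[of _ _ "t _ _"] arg_cong2[of _ _ _ _ "\<lambda>a b. t _ a b"])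
  also have "\<dots> = (\<Sum>T1\<in>Pow S. \<Sum>T2\<in>Pow (S - T1). t T1 T2 (S - T1 - T2))"
    using S by (intro sum.Sigma[symmetric]) (auto intro: sub)
  also have "\<dots> = ext_times_fun f (ext_times_fun g h) S"
    unfolding ext_times_fun_def
  proof (rule sum.cong[OF refl])
    fix T1 assume "T1 \<in> Pow S"
    then have T: "T1 \<subseteq> S" by simp
    have *: "inv_count T1 (S - T1) = inv_count T1 T2 + inv_count T1 (S - T1 - T2)" if "T2 \<subseteq> S - T1" for T2
    proof -
      have "inv_count T1 (T2 \<union> (S - T1 - T2)) = inv_count T1 T2 + inv_count T1 (S - T1 - T2)"
        using T that by (intro inv_count_Un_right) (auto intro: sub)
      moreover have "T2 \<union> (S - T1 - T2) = S - T1" using that by auto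
      ultimately show ?thesis by simp
    qed
    show "(\<Sum>T2\<in>Pow (S - T1). t T1 T2 (S - T1 - T2)) = (- 1) ^ inv_count T1 (S - T1) *
      (f T1 * (\<Sum>T2\<in>Pow (S - T1). (- 1) ^ inv_count T2 (S - T1 - T2) * (g T2 * h (S - T1 - T2))))"
      unfolding sum_distrib_left
      by (rule sum.cong[OF refl]) (simp add: t_def * power_add mult_ac)
  qed
  finally show ?thesis .
qed

instantiation ext :: (field) ring_1
begin

lift_definition zero_ext :: "'a ext" is "\<lambda>_. 0" by simp
lift_definition one_ext :: "'a ext" is "\<lambda>S. if S = {} then 1 else 0" by auto
lift_definition plus_ext :: "'a ext \<Rightarrow> 'a ext \<Rightarrow> 'a ext" is "\<lambda>f g S. f S + g S" by simp
lift_definition minus_ext :: "'a ext \<Rightarrow> 'a ext \<Rightarrow> 'a ext" is "\<lambda>f g S. f S - g S" by simp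
lift_definition uminus_ext :: "'a ext \<Rightarrow> 'a ext" is "\<lambda>f S. - f S" by simp
lift_definition times_ext :: "'a ext \<Rightarrow> 'a ext \<Rightarrow> 'a ext" is
  "\<lambda>f g S. if finite S then ext_times_fun f g S else 0" by simp

instance
proof
  fix a b c :: "'a ext"
  show "a + b + c = a + (b + c)" "a + b = b + a" "0 + a = a" "- a + a = 0" "a - b = a + - b"
    by (transfer; simp add: algebra_simps)+
  show "(0::'a ext) \<noteq> 1" by transfer (auto dest: fun_cong[of _ _ "{}"])
  show "(a + b) * c = a * c + b * c" "a * (b + c) = a * b + a * c"
    by (transfer; auto simp: fun_eq_iff ext_times_fun_def algebra_simps sum.distrib)+
  show "a * b * c = a * (b * c)"
  proof transfer
    fix a b c :: "nat set \<Rightarrow> 'a"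
    let ?m = "\<lambda>f g S. if finite S then ext_times_fun f g S else 0"
    have "ext_times_fun (?m a b) c S = ext_times_fun (ext_times_fun a b) c S"
      "ext_times_fun a (?m b c) S = ext_times_fun a (ext_times_fun b c) S" if "finite S" for S
      unfolding ext_times_fun_def[of _ _ S] using that
      by (auto intro!: sum.cong dest: finite_subset)
    then show "?m (?m a b) c = ?m a (?m b c)"
      by (auto simp: fun_eq_iff ext_times_fun_assoc)
  qed
  show "1 * a = a"
  proof (rule ext_eqI)
    fix S :: "nat set" assume S: "finite S"
    then have "coef (1 * a) S = (\<Sum>T\<in>{{}}. (- 1) ^ inv_count T (S - T) * (1 * coef a (S - T)))"
      unfolding times_ext.rep_eq one_ext.rep_eq ext_times_fun_def
      by (simp only: if_True) (intro sum.mono_neutral_cong_right, auto)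
    then show "coef (1 * a) S = coef a S" by simp
  qed
  show "a * 1 = a"
  proof (rule ext_eqI)
    fix S :: "nat set" assume S: "finite S"
    then have "coef (a * 1) S = (\<Sum>T\<in>{S}. (- 1) ^ inv_count T (S - T) * (coef a T * 1))"
      unfolding times_ext.rep_eq one_ext.rep_eq ext_times_fun_def
      by (simp only: if_True) (intro sum.mono_neutral_cong_right, auto)
    then show "coef (a * 1) S = coef a S" by simp
  qed
qed

end

lift_definition gen :: "nat \<Rightarrow> 'k::field ext" is "\<lambda>i S. if S = {i} then 1 else 0"
  by auto

lemma coef_simps [simp]:
  "coef 0 S = 0" "coef 1 S = (if S = {} then 1 else 0)" "coef (a + b) S = coef a S + coef b S"
  "coef (a - b) S = coef a S - coef b S" "coef (- a) S = - coef a S"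
  by (transfer; simp)+

lemma coef_times: "finite S \<Longrightarrow> coef (a * b) S =
    (\<Sum>T\<in>Pow S. (- 1) ^ inv_count T (S - T) * (coef a T * coef b (S - T)))"
  by transfer (simp add: ext_times_fun_def)

lemma coef_gen: "coef (gen i) S = (if S = {i} then 1 else 0)"
  by transfer simp

lemma coef_infinite: "infinite S \<Longrightarrow> coef a S = 0"
  by transfer simp

lemma coef_gen_times:
  assumes "finite S"
  shows "coef (gen i * a) S =
    (if i \<in> S then (- 1) ^ inv_count {i} (S - {i}) * coef a (S - {i}) else 0)"
proof -
  have "coef (gen i * a) S = (\<Sum>T\<in>Pow S \<inter> {{i}}. (- 1) ^ inv_count T (S - T) * coef a (S - T))"
    unfolding coef_times[OF assms] using assms
    by (intro sum.mono_neutral_cong_right) (auto simp: coef_gen)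
  moreover have "Pow S \<inter> {{i}} = (if i \<in> S then {{i}} else {})" by auto
  ultimately show ?thesis by simp
qed

lemma gen_square: "gen i * gen i = 0"
  by (rule ext_eqI) (auto simp: coef_gen_times coef_gen)

lemma inv_count_single: "inv_count {i} {j} = (if j < i then 1 else 0)"
proof -
  have "{(s, t). s \<in> {i} \<and> t \<in> {j} \<and> t < s} = (if j < i then {(i, j)} else {})" by auto
  then show ?thesis by (simp add: inv_count_def)
qed

lemma gen_anticommute: "gen i * gen j = - (gen j * gen i)"
proof (cases "i = j")
  case False
  have eq: "S - {i} = {j} \<longleftrightarrow> S = {i, j}" if "i \<in> S" for S using that False by auto
  have eq': "S - {j} = {i} \<longleftrightarrow> S = {i, j}" if "j \<in> S" for S using that False by auto
  show ?thesis
    using False by (intro ext_eqI)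
      (auto simp: coef_gen_times coef_gen eq eq' inv_count_single insert_Diff_if)
qed (simp add: gen_square)

section \<open>Linear forms and the carry cocycle\<close>

lemma inv_count_swap:
  assumes "finite S" "finite T" "S \<inter> T = {}"
  shows "inv_count S T + inv_count T S = card S * card T"
proof -
  let ?A = "{(s, t). s \<in> S \<and> t \<in> T \<and> t < s}" and ?B = "{(t, s). t \<in> T \<and> s \<in> S \<and> s < t}"
  have B: "card (prod.swap ` ?B) = card ?B" by (rule card_image) (auto simp: inj_on_def)
  have fA: "finite ?A" and fB: "finite ?B" by (rule inv_count_finite; fact)+
  have "?A \<union> prod.swap ` ?B = S \<times> T"
    using assms(3) by (auto simp: image_iff)
  moreover have "card (?A \<union> prod.swap ` ?B) = card ?A + card (prod.swap ` ?B)"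
    by (rule card_Un_disjoint) (use fA fB in auto)
  ultimately show ?thesis
    using B by (simp add: inv_count_def card_cartesian_product)
qed

lemma three_times: "(3 :: 'a::ring_1) = 0 \<Longrightarrow> x + x + x = (0::'a)"
proof -
  assume three: "(3 :: 'a::ring_1) = 0"
  have "x + x + x = (1 + 1 + 1) * x" by (simp only: distrib_right mult_1)
  also have "1 + 1 + 1 = (3 :: 'a)" by simp
  finally show ?thesis by (simp only: three mult_zero_left)
qed

lemma minus_eq_double: "(3 :: 'a::ring_1) = 0 \<Longrightarrow> - x = x + (x::'a)"
  using three_times[of x] by (intro minus_unique) (simp add: add.assoc)

definition central :: "'a::ring_1 \<Rightarrow> bool" where
  "central x \<longleftrightarrow> (\<forall>y. x * y = y * x)"

lemma centralD: "central x \<Longrightarrow> y * x = x * y"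
  by (simp add: central_def)

lemma central_left_commute: "central x \<Longrightarrow> y * (x * z) = x * (y * z)"
  by (metis central_def mult.assoc)

lemma central_add: "central x \<Longrightarrow> central y \<Longrightarrow> central (x + y)"
  by (simp add: central_def distrib_left distrib_right)

lemma central_mult: "central x \<Longrightarrow> central y \<Longrightarrow> central (x * y)"
  by (metis central_def mult.assoc)

lemma central_of_nat: "central (of_nat k)"
  by (simp add: central_def mult_of_nat_commute)

lemma central_0: "central 0" and central_1: "central 1"
  by (simp_all add: central_def)

text \<open>
  The coefficients of \<open>gen i * gen j\<close> live on sets with two elements, and moving an even number of
  generators past a set costs no sign (\<open>inv_count_swap\<close>).
\<close>

lemma central_gen_gen: "central (gen i * gen j :: 'k::field ext)"
  unfolding central_def
proof (intro allI ext_eqI)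
  fix y :: "'k ext" and S :: "nat set" assume S: "finite S"
  let ?x = "gen i * gen j :: 'k ext"
  have ev: "even (card T)" if "coef ?x T \<noteq> 0" "finite T" for T
  proof -
    have "i \<in> T" "T - {i} = {j}"
      using that by (auto simp: coef_gen_times coef_gen split: if_splits)
    then have "card T = 2" using that(2) by (metis One_nat_def Suc_1 card.remove card.empty card_insert_disjoint finite.emptyI empty_iff)
    then show ?thesis by simp
  qed
  have "coef (y * ?x) S = (\<Sum>T\<in>Pow S. (- 1) ^ inv_count (S - T) T * (coef y (S - T) * coef ?x T))"
    unfolding coef_times[OF S]
    by (rule sum.reindex_bij_witness[of _ "\<lambda>T. S - T" "\<lambda>T. S - T"])
      (auto simp: double_diff)
  also have "\<dots> = coef (?x * y) S"
    unfolding coef_times[OF S]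
  proof (rule sum.cong[OF refl])
    fix T assume "T \<in> Pow S"
    then have T: "finite T" "finite (S - T)" using S by (auto dest: finite_subset)
    show "(- 1) ^ inv_count (S - T) T * (coef y (S - T) * coef ?x T) =
      (- 1) ^ inv_count T (S - T) * (coef ?x T * coef y (S - T))"
    proof (cases "coef ?x T = 0")
      case False
      from ev[OF False T(1)] inv_count_swap[OF T] have "even (inv_count T (S - T) + inv_count (S - T) T)"
        by auto
      then have "(- 1 :: 'k) ^ inv_count (S - T) T = (- 1) ^ inv_count T (S - T)"
        by (cases "even (inv_count T (S - T))") auto
      then show ?thesis by simp
    qed simp
  qed
  finally show "coef (?x * y) S = coef (y * ?x) S" by simp
qed

text \<open>
  The linear form with coefficients \<open>A i\<close> in the generators below the bound. Coefficients are
  natural numbers because they will be multiplicities of letters.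
\<close>

fun lin :: "nat \<Rightarrow> (nat \<Rightarrow> nat) \<Rightarrow> 'k::field ext" where
  "lin 0 A = 0"
| "lin (Suc n) A = lin n A + of_nat (A n) * gen n"

text \<open>
  This plays the role of \<open>((A + B)\<^sup>3 - A\<^sup>3 - B\<^sup>3) / 3\<close>, the carry of a sum in base 3, for
  anticommuting linear forms \<open>A\<close> and \<open>B\<close>. It depends on the order of the generators.
\<close>

fun carry :: "nat \<Rightarrow> (nat \<Rightarrow> nat) \<Rightarrow> (nat \<Rightarrow> nat) \<Rightarrow> 'k::field ext" where
  "carry 0 A B = 0"
| "carry (Suc n) A B = carry n A B + (of_nat (A n) - of_nat (B n)) * (lin n A * (lin n B * gen n))"

lemma lin_add: "lin n (\<lambda>i. A i + B i) = lin n A + lin n B"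
  by (induction n) (simp_all add: algebra_simps)

lemma nat_central:
  "gen i * of_nat k = of_nat k * gen i" "gen i * (of_nat k * z) = of_nat k * (gen i * z)"
  "lin n A * of_nat k = of_nat k * lin n A" "lin n A * (of_nat k * z) = of_nat k * (lin n A * z)"
  by (rule centralD[OF central_of_nat] central_left_commute[OF central_of_nat])+

lemma gen_lin: "gen i * lin n A = - (lin n A * gen i)"
  by (induction n) (simp_all add: distrib_left distrib_right mult.assoc nat_central gen_anticommute[of i])

lemma lin_anticommute: "lin n A * lin m B = - (lin m B * lin n A)"
  by (induction n) (simp_all add: distrib_left distrib_right mult.assoc nat_central gen_lin)

lemma lin_square: "lin n A * lin n A = 0"
  by (induction n) (simp_all add: distrib_left distrib_right mult.assoc nat_central gen_lin gen_square)

lemma central_gen_lin: "central (gen i * lin n A)"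
  by (induction n) (auto simp: central_0 distrib_left nat_central intro!: central_add central_mult[OF central_of_nat] central_gen_gen)

lemma central_lin_lin: "central (lin n A * lin m B)"
  by (induction n) (auto simp: central_0 distrib_right mult.assoc intro!: central_add central_mult[OF central_of_nat] central_gen_lin)

lemma carry_sym: "carry n A B = (carry n B A :: 'k::field ext)"
proof (induction n)
  case (Suc n)
  have "lin n B * (lin n A * gen n) = - (lin n A * (lin n B * gen n) :: 'k ext)"
    by (simp add: mult.assoc[symmetric] lin_anticommute[of n B n A])
  then show ?case by (simp add: Suc[symmetric] left_diff_distrib)
qed simp

text \<open>
  The product of the three linear forms is a coboundary in characteristic 3. The summands with
  index \<open>n\<close> of the four carries add up to the change of this product when the generator \<open>n\<close> is
  allowed, except for a multiple of 3.
\<close>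

lemma carry_cocycle:
  assumes three: "(3 :: 'k::field ext) = 0"
  shows "carry n A B + carry n (\<lambda>i. A i + B i) C =
    carry n B C + carry n A (\<lambda>i. B i + C i) + lin n A * lin n B * (lin n C :: 'k ext)"
proof (induction n)
  case (Suc n)
  define L M N e a b c where defs: "L = (lin n A :: 'k ext)" "M = (lin n B :: 'k ext)" "N = (lin n C :: 'k ext)"
    "e = (gen n :: 'k ext)" "a = (of_nat (A n) :: 'k ext)" "b = (of_nat (B n) :: 'k ext)" "c = (of_nat (C n) :: 'k ext)"
  have eM: "e * M = - (M * e)" "e * N = - (N * e)" by (simp_all add: defs gen_lin)
  have eM': "e * (M * x) = - (M * (e * x))" "e * (N * x) = - (N * (e * x))" for x
    using eM by (metis mult.assoc mult_minus_left)+
  have ee: "e * e = 0" by (simp add: defs gen_square)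
  have ee': "e * (e * x) = 0" for x using ee by (metis mult.assoc mult_zero_left)
  have cen: "central a" "central b" "central c" by (simp_all add: defs central_of_nat)
  have mv: "L * b = b * L" "L * c = c * L" "M * c = c * M" "e * b = b * e" "e * c = c * e"
    "L * (b * x) = b * (L * x)" "L * (c * x) = c * (L * x)" "M * (c * x) = c * (M * x)"
    "e * (b * x) = b * (e * x)" "e * (c * x) = c * (e * x)" for x
    by (rule centralD central_left_commute, rule cen)+
  have 1: "(L + a * e) * (M + b * e) * (N + c * e) =
    L * (M * N) + c * (L * (M * e)) - b * (L * (N * e)) + a * (M * (N * e))"
    by (simp add: algebra_simps mv eM eM' ee ee')
  have t: "b * (L * (N * e)) + (b * (L * (N * e)) + b * (L * (N * e))) = 0"
    using three_times[OF three] by (simp add: add.assoc)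
  have s: "carry n A B + carry n (\<lambda>i. A i + B i) C - (carry n B C + carry n A (\<lambda>i. B i + C i)) - L * (M * N) = 0"
    using Suc unfolding defs by (simp add: mult.assoc)
  have "carry (Suc n) A B + carry (Suc n) (\<lambda>i. A i + B i) C -
    (carry (Suc n) B C + carry (Suc n) A (\<lambda>i. B i + C i)) -
     lin (Suc n) A * lin (Suc n) B * lin (Suc n) C =
    (carry n A B + carry n (\<lambda>i. A i + B i) C - (carry n B C + carry n A (\<lambda>i. B i + C i)) - L * (M * N)) +
    (b * (L * (N * e)) + (b * (L * (N * e)) + b * (L * (N * e))))"
    unfolding carry.simps lin.simps of_nat_add lin_add
    by (simp only: defs[symmetric] 1) (simp add: algebra_simps)
  with s t have "carry (Suc n) A B + carry (Suc n) (\<lambda>i. A i + B i) C -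
    (carry (Suc n) B C + carry (Suc n) A (\<lambda>i. B i + C i)) -
     lin (Suc n) A * lin (Suc n) B * (lin (Suc n) C :: 'k ext) = 0" by simp
  then show ?case by (simp add: algebra_simps)
qed simp

text \<open>
  The function \<open>count_list w\<close> is used as the family of coefficients of a linear form and is to stay
  folded.
\<close>

declare count_list.simps [simp del]

abbreviation eta :: "nat \<Rightarrow> nat list \<Rightarrow> 'k::field ext" where
  "eta n w \<equiv> lin n (count_list w)"

abbreviation carry_w :: "nat \<Rightarrow> nat list \<Rightarrow> nat list \<Rightarrow> 'k::field ext" where
  "carry_w n u v \<equiv> carry n (count_list u) (count_list v)"

text \<open>
  The sum of the products \<open>gen x * gen y\<close> over all pairs of positions of a word.
\<close>

primrec quadratic :: "nat \<Rightarrow> nat list \<Rightarrow> 'k::field ext" where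
  "quadratic n [] = 0"
| "quadratic n (x # w) = quadratic n w + eta n [x] * eta n w"

text \<open>
  Chosen such that the analogue of the concatenation law of \<open>quadratic\<close> holds in degree 3, see
  \<open>cubic_append\<close>. The carry makes the law associative.
\<close>

primrec cubic :: "nat \<Rightarrow> nat list \<Rightarrow> 'k::field ext" where
  "cubic n [] = 0"
| "cubic n (x # w) = cubic n w - eta n [x] * quadratic n w + carry_w n [x] w"

text \<open>
  The exponential of \<open>quadratic\<close>: all summands of the latter have square 0 and commute.
\<close>

primrec word_exp :: "nat \<Rightarrow> nat list \<Rightarrow> 'k::field ext" where
  "word_exp n [] = 1"
| "word_exp n (x # w) = word_exp n w * (1 + eta n [x] * eta n w)"

lemma lin_zero: "lin n (\<lambda>_. 0) = 0"
  by (induction n) simp_all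

lemma count_list_fun: "count_list [] = (\<lambda>_. 0)" "count_list (u @ v) = (\<lambda>i. count_list u i + count_list v i)"
  by (auto simp: fun_eq_iff count_list.simps)

lemma eta_append: "eta n (u @ v) = eta n u + eta n v"
  by (simp only: count_list_fun lin_add)

lemma eta_Cons: "eta n (x # v) = eta n [x] + eta n v"
  using eta_append[of n "[x]" v] by simp

lemma carry_zero: "carry n (\<lambda>_. 0) B = 0"
  by (induction n) (simp_all add: lin_zero)

lemma central_quadratic: "central (quadratic n w)"
  by (induction w) (auto simp: central_0 intro!: central_add central_lin_lin)

lemma central_word_exp: "central (word_exp n w)"
  by (induction w) (auto intro!: central_1 central_mult central_add central_lin_lin)

lemma quadratic_append: "quadratic n (u @ v) = quadratic n u + quadratic n v + eta n u * eta n v"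
proof (induction u)
  case (Cons x u)
  then show ?case
    by (simp add: eta_append eta_Cons[of n x u] algebra_simps)
qed (simp add: lin_zero)

section \<open>Words in the exterior algebra\<close>

lemma word_exp_to_left:
  "lin m A * word_exp n w = word_exp n w * lin m A" "lin m A * (word_exp n w * z) = word_exp n w * (lin m A * z)"
  "(1 + x) * word_exp n w = word_exp n w * (1 + x)" "(1 + x) * (word_exp n w * z) = word_exp n w * ((1 + x) * z)"
  by (rule centralD[OF central_word_exp] central_left_commute[OF central_word_exp])+

lemma quadratic_to_left:
  "lin m A * quadratic n w = quadratic n w * lin m A" "lin m A * (quadratic n w * z) = quadratic n w * (lin m A * z)"
  by (rule centralD[OF central_quadratic] central_left_commute[OF central_quadratic])+

lemma word_exp_append: "word_exp n (u @ v) = word_exp n u * word_exp n v * (1 + eta n u * eta n v :: 'k::field ext)"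
proof (induction u)
  case Nil
  then show ?case by (simp add: lin_zero)
next
  case (Cons x u)
  define X U V where d: "X = (eta n [x] :: 'k ext)" "U = (eta n u :: 'k ext)" "V = (eta n v :: 'k ext)"
  have UU: "U * U = 0" "V * V = 0" "X * X = 0" "U * X = - (X * U)" "V * U = - (U * V)" "V * X = - (X * V)"
    unfolding d by (rule lin_square lin_anticommute)+
  have UU': "U * (U * z) = 0" "U * (X * z) = - (X * (U * z))" "V * (U * z) = - (U * (V * z))"
     "V * (X * z) = - (X * (V * z))" "X * (X * z) = 0" for z
    using UU by (metis mult.assoc mult_minus_left mult_zero_left)+
  have "word_exp n ((x # u) @ v) = word_exp n u * word_exp n v * ((1 + U * V) * (1 + X * (U + V)))"
    by (simp add: Cons.IH eta_append d mult.assoc)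
  also have "(1 + U * V) * (1 + X * (U + V)) = (1 + X * U) * (1 + (X + U) * V)"
    by (simp add: algebra_simps UU UU')
  also have "word_exp n u * word_exp n v * ((1 + X * U) * (1 + (X + U) * V)) = word_exp n (x # u) * word_exp n v * (1 + eta n (x # u) * eta n v)"
    by (simp add: eta_Cons[of n x u] d mult.assoc word_exp_to_left)
  finally show ?case .
qed

text \<open>
  Without the carry the law fails to be associative by twice the product of the three linear forms,
  which \<open>carry_cocycle\<close> compensates.
\<close>

lemma cubic_append:
  assumes three: "(3 :: 'k::field ext) = 0"
  shows "cubic n (u @ v) = (cubic n u + cubic n v + quadratic n u * eta n v - eta n u * quadratic n v + carry_w n u v :: 'k ext)"
proof (induction u)
  case Nil
  then show ?case by (simp add: lin_zero count_list_fun carry_zero)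
next
  case (Cons x u)
  define X U V where d: "X = (eta n [x] :: 'k ext)" "U = (eta n u :: 'k ext)" "V = (eta n v :: 'k ext)"
  have c: "carry_w n [x] (u @ v) = carry_w n [x] u + carry_w n (x # u) v - carry_w n u v - X * U * V"
    using carry_cocycle[OF three, of n "count_list [x]" "count_list u" "count_list v"]
      count_list_fun(2)[of u v] count_list_fun(2)[of "[x]" u]
    by (simp add: d algebra_simps)
  have t: "X * U * V + X * U * V + X * U * V = 0"
    by (rule three_times[OF three])
  have "cubic n ((x # u) @ v) - (cubic n (x # u) + cubic n v + quadratic n (x # u) * eta n v - eta n (x # u) * quadratic n v + carry_w n (x # u) v)
    = - (X * U * V + X * U * V + X * U * V)"
    by (simp add: Cons.IH c quadratic_append eta_Cons[of n x u] d[symmetric])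
      (simp add: algebra_simps)
  with t show ?case by simp
qed

declare word_exp.simps(2) [simp del] quadratic.simps(2) [simp del] cubic.simps(2) [simp del]

text \<open>
  The coefficient at a set \<open>S\<close> of even size is the sign of the order in which the letters of \<open>S\<close>
  occur, if each occurs once; the coefficients at sets of odd size come from the second summand.
\<close>

definition word_ext :: "nat \<Rightarrow> nat list \<Rightarrow> 'k::field ext" where
  "word_ext n w = word_exp n w * (1 + cubic n w)"

text \<open>
  Inside a context \<open>p _ q\<close>, the value at \<open>w\<close> depends linearly on three quantities attached to \<open>w\<close>,
  as long as the multiset of letters of \<open>w\<close> is fixed. It is therefore enough to check relations on
  these three quantities.
\<close>

lemma word_ext_context:
  assumes three: "(3 :: 'k::field ext) = 0"
  obtains c d Q P where "\<And>w. count_list w = A \<Longrightarrow> word_ext n (p @ w @ q) =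
     c * (word_exp n w * d + word_exp n w * cubic n w + word_exp n w * quadratic n w * Q - P * (word_exp n w * quadratic n w) :: 'k ext)"
proof -
  define c where "c = (word_exp n p * word_exp n q * ((1 + lin n A * eta n q) * (1 + eta n p * (lin n A + eta n q))) :: 'k ext)"
  define d where "d = (1 + cubic n p + cubic n q + quadratic n p * (lin n A + eta n q) - eta n p * (quadratic n q + lin n A * eta n q)
    - lin n A * quadratic n q + carry n A (count_list q) + carry n (count_list p) (\<lambda>i. A i + count_list q i) :: 'k ext)"
  show ?thesis
  proof (rule that[of c d "eta n q" "eta n p"])
    fix w assume w: "count_list w = A"
    have lwq: "eta n (w @ q) = lin n A + eta n q" by (simp add: eta_append w)
    have "word_exp n (p @ w @ q) = c * word_exp n w"
      unfolding word_exp_append c_def by (simp add: w lwq mult.assoc word_exp_to_left central_left_commute[OF central_word_exp, of "word_exp n q" n w])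
    moreover have "1 + cubic n (p @ w @ q) = d + cubic n w + quadratic n w * eta n q - eta n p * quadratic n w"
      unfolding cubic_append[OF three] quadratic_append d_def by (simp add: w lwq eta_append count_list_fun lin_add) (simp add: algebra_simps)
    moreover have "eta n p * (word_exp n w * quadratic n w) = (word_exp n w * (eta n p * quadratic n w) :: 'k ext)"
      by (rule central_left_commute[OF central_word_exp])
    ultimately show "word_ext n (p @ w @ q) = c * (word_exp n w * d + word_exp n w * cubic n w + word_exp n w * quadratic n w * eta n q -
         eta n p * (word_exp n w * quadratic n w))"
      unfolding word_ext_def by (simp only: distrib_left right_diff_distrib mult.assoc)
  qed
qed

lemma quadratic_word3: "quadratic n (a @ b @ c) = quadratic n a + quadratic n b + quadratic n c + eta n a * eta n b + eta n a * eta n c + eta n b * eta n c"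
  by (simp add: quadratic_append eta_append algebra_simps)

lemma word_exp_word3: "word_exp n (a @ b @ c) = word_exp n a * (word_exp n b * word_exp n c) * (1 + eta n a * eta n b + eta n a * eta n c + eta n b * eta n c :: 'k::field ext)"
proof -
  define A B C where d: "A = (eta n a :: 'k ext)" "B = (eta n b :: 'k ext)" "C = (eta n c :: 'k ext)"
  have r: "B * A = - (A * B)" "C * B = - (B * C)" "C * A = - (A * C)" "A * A = 0" "B * B = 0" "C * C = 0"
    unfolding d by (rule lin_square lin_anticommute)+
  have r': "B * (A * z) = - (A * (B * z))" "C * (B * z) = - (B * (C * z))" "C * (A * z) = - (A * (C * z))"
    "A * (A * z) = 0" "B * (B * z) = 0" for z
    using r by (metis mult.assoc mult_minus_left mult_zero_left)+
  have "(1 + B * C) * (1 + A * (B + C)) = 1 + A * B + A * C + B * C"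
    by (simp add: algebra_simps r r')
  then show ?thesis by (simp add: word_exp_append eta_append mult.assoc d[symmetric] word_exp_to_left)
qed

lemma cubic_word3:
  assumes three: "(3 :: 'k::field ext) = 0"
  shows "cubic n (a @ b @ c) = (cubic n a + cubic n b + cubic n c + quadratic n a * (eta n b + eta n c) + quadratic n b * (eta n c - eta n a)
      - quadratic n c * (eta n a + eta n b) + (carry_w n a (b @ c) + carry_w n b c - eta n a * eta n b * eta n c) :: 'k ext)"
  by (simp add: cubic_append[OF three] quadratic_append eta_append algebra_simps quadratic_to_left)

text \<open>
  The carries in \<open>cubic_word3\<close> are symmetric in the last two words; this is what a rotation of the
  three words does to them.
\<close>

lemma carry_rotate:
  assumes three: "(3 :: 'k::field ext) = 0"
  shows "carry_w n b (c @ a) + carry_w n c a =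
    (carry_w n a (b @ c) + carry_w n b c - eta n a * eta n b * eta n c :: 'k ext)"
proof -
  have "carry_w n c a + carry_w n b (c @ a) = (carry_w n a c + carry_w n (a @ c) b :: 'k ext)"
    unfolding count_list_fun by (subst carry_sym[of n "count_list c" "count_list a"], subst carry_sym[of n "count_list b"])
      (simp add: add.commute[of "count_list c _"])
  also have "\<dots> = carry_w n c b + carry_w n a (c @ b) + eta n a * eta n c * eta n b"
    unfolding count_list_fun by (rule carry_cocycle[OF three])
  also have "\<dots> = carry_w n b c + carry_w n a (b @ c) - eta n a * eta n b * eta n c"
    unfolding count_list_fun by (subst carry_sym[of n "count_list c" "count_list b"])
      (simp add: add.commute[of "count_list c _"] mult.assoc lin_anticommute[of n "count_list c" n "count_list b"])
  finally show ?thesis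
    by (simp add: algebra_simps)
qed

text \<open>
  The six values of each quantity differ only in signs of \<open>A * B\<close>, \<open>A * C\<close>, \<open>B * C\<close> and of products
  of a quadratic element with \<open>A\<close>, \<open>B\<close> or \<open>C\<close>, and by multiples of \<open>A * B * C\<close>; here \<open>A\<close>, \<open>B\<close>, \<open>C\<close>
  are the linear forms of the words. Products of two of \<open>A * B\<close>, \<open>A * C\<close>, \<open>B * C\<close> are 0, so in the sum
  the terms with signs cancel, and every other term is counted six times.
\<close>

lemma word_perms_vanish:
  assumes three: "(3 :: 'k::field ext) = 0"
  fixes n a b c
  defines "s F \<equiv> F (a @ b @ c) + F (a @ c @ b) + F (b @ a @ c) + F (b @ c @ a) + F (c @ a @ b) + F (c @ b @ a)"
  shows "s (word_exp n) = (0 :: 'k ext)" "s (\<lambda>w. word_exp n w * quadratic n w) = (0 :: 'k ext)"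
    "s (\<lambda>w. word_exp n w * cubic n w) = (0 :: 'k ext)"
proof -
  define A B C where d: "A = (eta n a :: 'k ext)" "B = (eta n b :: 'k ext)" "C = (eta n c :: 'k ext)"
  have r: "B * A = - (A * B)" "C * B = - (B * C)" "C * A = - (A * C)" "A * A = 0" "B * B = 0" "C * C = 0"
    unfolding d by (rule lin_square lin_anticommute)+
  have r': "B * (A * z) = - (A * (B * z))" "C * (B * z) = - (B * (C * z))" "C * (A * z) = - (A * (C * z))"
    "A * (A * z) = 0" "B * (B * z) = 0" "C * (C * z) = 0" for z
    using r by (metis mult.assoc mult_minus_left mult_zero_left)+
  define oa ob oc where od: "oa = (quadratic n a :: 'k ext)" "ob = (quadratic n b :: 'k ext)" "oc = (quadratic n c :: 'k ext)"
  have o: "A * oa = oa * A" "A * ob = ob * A" "A * oc = oc * A" "B * oa = oa * B" "B * ob = ob * B" "B * oc = oc * B"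
     "C * oa = oa * C" "C * ob = ob * C" "C * oc = oc * C"
     unfolding d od by (rule quadratic_to_left)+
  have o': "A * (oa * z) = oa * (A * z)" "A * (ob * z) = ob * (A * z)" "A * (oc * z) = oc * (A * z)"
    "B * (oa * z) = oa * (B * z)" "B * (ob * z) = ob * (B * z)" "B * (oc * z) = oc * (B * z)"
    "C * (oa * z) = oa * (C * z)" "C * (ob * z) = ob * (C * z)" "C * (oc * z) = oc * (C * z)" for z
     unfolding d od by (rule quadratic_to_left)+
  define G where "G = (word_exp n a * (word_exp n b * word_exp n c) :: 'k ext)"
  have G: "word_exp n a * (word_exp n c * word_exp n b) = G" "word_exp n b * (word_exp n a * word_exp n c) = G" "word_exp n b * (word_exp n c * word_exp n a) = G"
    "word_exp n c * (word_exp n a * word_exp n b) = G" "word_exp n c * (word_exp n b * word_exp n a) = G"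
    unfolding G_def by (metis central_def central_word_exp mult.assoc)+
  have e: "word_exp n (a @ b @ c) = G * (1 + A * B + A * C + B * C)"
    "word_exp n (a @ c @ b) = G * (1 + A * B + A * C - B * C)"
    "word_exp n (b @ a @ c) = G * (1 - A * B + A * C + B * C)"
    "word_exp n (b @ c @ a) = G * (1 - A * B - A * C + B * C)"
    "word_exp n (c @ a @ b) = G * (1 + A * B - A * C - B * C)"
    "word_exp n (c @ b @ a) = G * (1 - A * B - A * C - B * C)"
    by (simp_all only: word_exp_word3 G G_def[symmetric] d[symmetric] r) (simp_all add: algebra_simps)
  have m: "quadratic n (a @ b @ c) = oa + ob + oc + A * B + A * C + B * C"
    "quadratic n (a @ c @ b) = oa + ob + oc + A * B + A * C - B * C"
    "quadratic n (b @ a @ c) = oa + ob + oc - A * B + A * C + B * C"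
    "quadratic n (b @ c @ a) = oa + ob + oc - A * B - A * C + B * C"
    "quadratic n (c @ a @ b) = oa + ob + oc + A * B - A * C - B * C"
    "quadratic n (c @ b @ a) = oa + ob + oc - A * B - A * C - B * C"
    by (simp_all only: quadratic_word3 d[symmetric] od[symmetric] r) (simp_all add: algebra_simps)
  define K where "K = (carry_w n a (b @ c) + carry_w n b c :: 'k ext)"
  define D where "D = A * B * C"
  have sw: "carry_w n x (y @ z) + carry_w n y z = (carry_w n x (z @ y) + carry_w n z y :: 'k ext)" for x y z
    unfolding count_list_fun by (simp add: carry_sym[of n "count_list y" "count_list z"] add.commute[of "count_list y _"])
  have D: "B * C * A = D" "C * A * B = D" "A * C * B = - D" "B * A * C = - D" "C * B * A = - D"
    unfolding D_def by (simp_all add: mult.assoc r r')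
  have k1: "carry_w n b (c @ a) + carry_w n c a = K - D"
    using carry_rotate[OF three, of n b c a] by (simp add: K_def D_def d)
  have k2: "carry_w n c (a @ b) + carry_w n a b = K - D - D"
    using carry_rotate[OF three, of n c a b] by (simp add: k1 d[symmetric] D)
  define H where "H = (cubic n a + cubic n b + cubic n c + K :: 'k ext)"
  have t: "cubic n (a @ b @ c) = H + oa * (B + C) + ob * (C - A) - oc * (A + B) - D"
    "cubic n (a @ c @ b) = H + oa * (B + C) - ob * (A + C) + oc * (B - A) + D"
    "cubic n (b @ a @ c) = H + oa * (C - B) + ob * (A + C) - oc * (A + B)"
    "cubic n (b @ c @ a) = H - oa * (B + C) + ob * (A + C) + oc * (A - B) - D - D"
    "cubic n (c @ a @ b) = H + oa * (B - C) - ob * (A + C) + oc * (A + B) - D - D - D"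
    "cubic n (c @ b @ a) = H - oa * (B + C) + ob * (A - C) + oc * (A + B) - D"
    unfolding cubic_word3[OF three] sw[of a c b] sw[of b a c] sw[of c b a] k1 k2
    by (simp_all only: K_def[symmetric] d[symmetric] od[symmetric] D D_def[symmetric] H_def)
      (simp_all add: algebra_simps)
  have six: "x + x + x + x + x + x = 0" for x :: "'k ext"
    using three_times[OF three, of x] by (metis add.assoc add_0)
  have "s (word_exp n) = G * (1 + 1 + 1 + 1 + 1 + 1)"
    unfolding s_def e by (simp only: distrib_left right_diff_distrib) (simp add: algebra_simps)
  then show "s (word_exp n) = 0" by (simp only: six mult_zero_right)
  have "s (\<lambda>w. word_exp n w * quadratic n w) = G * (let x = oa + ob + oc in x + x + x + x + x + x)"
    unfolding s_def e m Let_def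
    by (simp only: mult.assoc distrib_left[symmetric]) (simp add: algebra_simps r r' o o')
  then show "s (\<lambda>w. word_exp n w * quadratic n w) = 0" by (simp only: six mult_zero_right Let_def)
  have "s (\<lambda>w. word_exp n w * cubic n w) = G * (let x = H - D in x + x + x + x + x + x)"
    unfolding s_def e t Let_def D_def
    by (simp only: mult.assoc distrib_left[symmetric]) (simp add: algebra_simps r r' o o')
  then show "s (\<lambda>w. word_exp n w * cubic n w) = 0" by (simp only: six mult_zero_right Let_def)
qed

section \<open>Commutators of letters in the exterior algebra\<close>

lemma lin_single: "lin n (count_list [a]) = (if a < n then gen a else 0)"
  by (induction n) (auto simp: count_list.simps less_Suc_eq)

lemma eta_single: "a < n \<Longrightarrow> eta n [a] = gen a"
  by (simp add: lin_single)

lemma gen_gen_lin_kill: "(gen a :: 'k::field ext) * gen b * lin n (count_list [a, b]) = 0"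
proof -
  have "(gen a :: 'k ext) * gen b * gen b = 0" by (simp add: mult.assoc gen_square)
  moreover have "(gen a :: 'k ext) * gen b * gen a = 0"
    by (simp add: mult.assoc gen_anticommute[of b a]) (simp add: mult.assoc[symmetric] gen_square)
  moreover have "lin n (count_list [a, b]) = (lin n (count_list [a]) + lin n (count_list [b]) :: 'k ext)"
    by (rule eta_Cons)
  ultimately show ?thesis by (simp add: lin_single distrib_left)
qed

lemma gen_gen_kills:
  "(gen a :: 'k::field ext) * gen b * gen a = 0" "(gen a :: 'k::field ext) * gen b * gen b = 0"
proof -
  show "(gen a :: 'k ext) * gen b * gen b = 0" by (simp add: mult.assoc gen_square)
  show "(gen a :: 'k ext) * gen b * gen a = 0"
    by (simp add: mult.assoc gen_anticommute[of b a]) (simp add: mult.assoc[symmetric] gen_square)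
qed

lemma gen_gen_carry_kill: "(gen a :: 'k::field ext) * gen b * carry n (count_list [a, b]) B = 0"
proof (induction n)
  case (Suc n)
  have *: "gen a * gen b * (of_nat j * z) = of_nat j * (gen a * gen b * z)" for j and z :: "'k ext"
    by (simp add: mult.assoc nat_central)
  have "gen a * gen b * ((of_nat i - of_nat j) * (lin n (count_list [a, b]) * z)) =
    (of_nat i - of_nat j) * (gen a * gen b * lin n (count_list [a, b]) * (z :: 'k ext))" for i j z
    by (simp only: left_diff_distrib right_diff_distrib * mult.assoc[of "gen a * gen b"])
  with Suc show ?case by (simp add: distrib_left gen_gen_lin_kill)
qed simp

text \<open>
  Every summand of the carry that involves the letters \<open>a\<close> or \<open>b\<close> contains one of the two
  generators, which the factor in front kills.
\<close>

lemma gen_gen_carry_drop: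
  "(gen a :: 'k::field ext) * gen b * carry n A (\<lambda>i. count_list [a, b] i + B i) = gen a * gen b * carry n A B"
proof (induction n)
  case (Suc n)
  define P where "P = (gen a * gen b :: 'k ext)"
  have c: "central P" unfolding P_def by (rule central_gen_gen)
  have kill: "P * lin n (count_list [a, b]) = 0" unfolding P_def by (rule gen_gen_lin_kill)
  have kill': "P * (lin n A * (lin n (count_list [a, b]) * z)) = 0" for z
  proof -
    have "P * (lin n A * (lin n (count_list [a, b]) * z)) = lin n A * (P * lin n (count_list [a, b]) * z)"
      by (simp only: mult.assoc central_left_commute[OF c, of "lin n A"])
    then show ?thesis by (simp add: kill)
  qed
  have "P * (of_nat (count_list [a, b] n) * (lin n A * (lin n B * gen n))) = 0"
  proof (cases "n = a \<or> n = b")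
    case True
    then have "P * gen n = 0" unfolding P_def using gen_gen_kills by auto
    then have "P * (lin n A * (lin n B * gen n)) = 0"
      by (simp only: central_left_commute[OF c, of "lin n A", symmetric] central_left_commute[OF c, of "lin n B", symmetric] mult_zero_right)
    then show ?thesis by (simp add: central_left_commute[OF central_of_nat])
  qed (simp add: count_list.simps)
  moreover have "P * carry n A (\<lambda>i. count_list [a, b] i + B i) = P * carry n A B"
    using Suc by (simp add: P_def)
  ultimately show ?case
    unfolding P_def[symmetric] carry.simps lin_add
    by (simp add: algebra_simps central_left_commute[OF central_of_nat, of P] kill')
qed simp

lemma carry_zero_right: "carry n A (\<lambda>_. 0) = 0"
  by (simp only: carry_sym[of n A] carry_zero)

lemma word_forms_pair: "a < n \<Longrightarrow> b < n \<Longrightarrow> word_exp n [a, b] = 1 + gen a * gen b"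
  "a < n \<Longrightarrow> b < n \<Longrightarrow> quadratic n [a, b] = gen a * gen b"
  "cubic n [a, b] = carry_w n [a] [b]"
  by (simp_all add: word_exp.simps quadratic.simps cubic.simps lin_zero lin_single count_list_fun carry_zero carry_zero_right)

lemma eta_pair: "a < n \<Longrightarrow> b < n \<Longrightarrow> eta n [a, b] = gen a + gen b"
  by (simp add: eta_Cons[of n a "[b]"] eta_single)

lemma count_list_pair: "count_list [b, a] = count_list [a, b]"
  by (auto simp: fun_eq_iff count_list.simps)

text \<open>
  Swapping the first two letters changes the sign of \<open>P\<close> in each of the three quantities; everything
  that is multiplied by \<open>P\<close> may ignore the letters \<open>a\<close> and \<open>b\<close>.
\<close>

lemma swap_first_letters:
  fixes v :: "nat list"
  assumes three: "(3 :: 'k::field ext) = 0" and n: "a < n" "b < n"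
  defines "P \<equiv> (gen a * gen b :: 'k ext)"
  shows "word_exp n (a # b # v) - word_exp n (b # a # v) = P * (word_exp n v + word_exp n v)"
    "word_exp n (a # b # v) * quadratic n (a # b # v) - word_exp n (b # a # v) * quadratic n (b # a # v) =
      P * (let z = word_exp n v + word_exp n v * quadratic n v in z + z)"
    "word_exp n (a # b # v) * cubic n (a # b # v) - word_exp n (b # a # v) * cubic n (b # a # v) =
      P * (let z = word_exp n v * cubic n v + word_exp n v * eta n v in z + z)"
proof -
  define W E ov tv where d: "W = (eta n v :: 'k ext)" "E = (word_exp n v :: 'k ext)" "ov = (quadratic n v :: 'k ext)" "tv = (cubic n v :: 'k ext)"
  define s where "s = (gen a + gen b) * W"
  define Y where "Y = carry_w n [a] [b] + tv - (gen a + gen b) * ov + carry_w n [a, b] v"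
  have cP: "central P" unfolding P_def by (rule central_gen_gen)
  have cE: "central E" unfolding d by (rule central_word_exp)
  have ba: "gen b * gen a = - P" unfolding P_def by (rule gen_anticommute)
  have kap: "carry_w n [b] [a] = (carry_w n [a] [b] :: 'k ext)" by (rule carry_sym)
  have Pk: "P * carry_w n [a] [b] = 0"
  proof -
    have gl: "P * lin m (count_list [a]) = 0" for m
      by (simp add: lin_single P_def gen_gen_kills)
    have "P * carry m (count_list [a]) (count_list [b]) = 0" for m
    proof (induction m)
      case (Suc m)
      have "P * ((of_nat i - of_nat j) * (lin m (count_list [a]) * z)) =
        (of_nat i - of_nat j) * (P * lin m (count_list [a]) * z)" for i j z
        using cP by (simp add: algebra_simps central_left_commute[OF central_of_nat, of P])
      with Suc show ?case by (simp add: distrib_left gl)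
    qed simp
    then show ?thesis .
  qed
  have Pc: "P * carry_w n [a, b] v = 0" unfolding P_def by (rule gen_gen_carry_kill)
  have Pg: "P * gen a = 0" "P * gen b = 0" unfolding P_def by (rule gen_gen_kills)+
  have Pg': "P * (gen a * z) = 0" "P * (gen b * z) = 0" for z
    using Pg by (metis mult.assoc mult_zero_left)+
  have PY: "P * Y = P * tv" by (simp add: Y_def algebra_simps Pk Pc Pg')
  have PP: "P * P = 0" unfolding P_def by (simp add: mult.assoc[symmetric] gen_gen_kills)
  have PP': "P * (P * z) = 0" for z using PP by (metis mult.assoc mult_zero_left)
  have Ps: "P * s = 0" by (simp add: s_def algebra_simps Pg')
  have Ps': "P * (s * z) = 0" for z using Ps by (metis mult.assoc mult_zero_left)
  have sP: "s * (P * z) = 0" "s * P = 0" for z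
    using Ps' Ps by (simp_all only: central_left_commute[OF cP, of s] centralD[OF cP, of s])
  have ss: "s * s = 0"
  proof -
    have "(gen a + gen b) * W * ((gen a + gen b) * W) = (eta n [a, b] * W) * (eta n [a, b] * W)"
      using n by (simp add: eta_pair)
    also have "\<dots> = eta n [a, b] * (W * (eta n [a, b] * W))" by (simp only: mult.assoc)
    also have "W * (eta n [a, b] * W) = eta n [a, b] * W * W"
      unfolding d by (rule centralD[OF central_lin_lin])
    also have "eta n [a, b] * (eta n [a, b] * W * W) = 0" by (simp add: mult.assoc d lin_square)
    finally show ?thesis by (simp add: s_def)
  qed
  have EP: "P * (E * z) = E * (P * z)" "P * E = E * P" for z
    by (rule centralD[OF cE] central_left_commute[OF cE])+
  have ab: "a # b # v = [a, b] @ v" "b # a # v = [b, a] @ v" by simp_all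
  have pr: "word_exp n [a, b] = 1 + P" "word_exp n [b, a] = 1 - P" "quadratic n [a, b] = P" "quadratic n [b, a] = - P"
    "eta n [a, b] = gen a + gen b" "eta n [b, a] = gen a + gen b"
    using n by (simp_all add: word_forms_pair eta_pair ba P_def add.commute)
  have e: "word_exp n (a # b # v) = E * ((1 + P) * (1 + s))" "word_exp n (b # a # v) = E * ((1 - P) * (1 + s))"
    unfolding ab word_exp_append pr d[symmetric] s_def[symmetric] by (simp_all add: algebra_simps EP)
  have m: "quadratic n (a # b # v) = ov + s + P" "quadratic n (b # a # v) = ov + s - P"
    unfolding ab quadratic_append pr d[symmetric] s_def[symmetric] by (simp_all add: algebra_simps)
  have t: "cubic n (a # b # v) = Y + P * W" "cubic n (b # a # v) = Y - P * W"
    unfolding ab cubic_append[OF three] pr word_forms_pair(3) d[symmetric] Y_def kap count_list_pair[of a b]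
    by (simp_all add: algebra_simps)
  show "word_exp n (a # b # v) - word_exp n (b # a # v) = P * (word_exp n v + word_exp n v)"
    unfolding e d[symmetric] by (simp add: algebra_simps Ps EP)
  show "word_exp n (a # b # v) * quadratic n (a # b # v) - word_exp n (b # a # v) * quadratic n (b # a # v) =
      P * (let z = word_exp n v + word_exp n v * quadratic n v in z + z)"
    unfolding e m d[symmetric] Let_def by (simp add: algebra_simps Ps Ps' sP ss PP PP' EP)
  show "word_exp n (a # b # v) * cubic n (a # b # v) - word_exp n (b # a # v) * cubic n (b # a # v) =
      P * (let z = word_exp n v * cubic n v + word_exp n v * eta n v in z + z)"
    unfolding e t d[symmetric] Let_def by (simp add: algebra_simps Ps Ps' sP PP PP' EP PY)
qed

text \<open>
  For \<open>k = 0\<close> this is \<open>word_ext\<close>. A commutator in front of the word raises \<open>k\<close>, so the family is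
  closed under taking commutators.
\<close>

definition word_ext_shifted :: "nat \<Rightarrow> nat \<Rightarrow> nat list \<Rightarrow> 'k::field ext" where
  "word_ext_shifted n k w = word_exp n w + word_exp n w * cubic n w + of_nat k * (word_exp n w * eta n w)"

lemma word_ext_shifted_commutator:
  assumes three: "(3 :: 'k::field ext) = 0" and n: "a < n" "b < n"
  shows "word_ext_shifted n k (a # b # v) - word_ext_shifted n k (b # a # v) =
    (gen a * gen b * (word_ext_shifted n (Suc k) v + word_ext_shifted n (Suc k) v) :: 'k ext)"
proof -
  define P where "P = (gen a * gen b :: 'k ext)"
  have eq: "eta n (b # a # v) = (eta n (a # b # v) :: 'k ext)"
    by (simp add: eta_Cons[of n a "b # v"] eta_Cons[of n b "a # v"] eta_Cons[of n _ v])
  have kill: "P * eta n (a # b # v) = P * eta n v"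
    using n
    by (simp add: P_def eta_Cons[of n a "b # v"] eta_Cons[of n b v] eta_single distrib_left gen_gen_kills)
  have "P * (word_exp n v * eta n (a # b # v)) = word_exp n v * (P * eta n (a # b # v))"
    by (rule central_left_commute[OF central_word_exp])
  also have "\<dots> = P * (word_exp n v * eta n v)" unfolding kill
    by (rule central_left_commute[OF central_word_exp, symmetric])
  finally have kill'': "P * (word_exp n v * eta n (a # b # v)) = P * (word_exp n v * eta n v)" .
  have nat: "P * (of_nat k * z) = of_nat k * (P * z)" for z
    by (rule central_left_commute[OF central_of_nat])
  have "word_ext_shifted n k (a # b # v) - word_ext_shifted n k (b # a # v) =
    (word_exp n (a # b # v) - word_exp n (b # a # v)) +
    (word_exp n (a # b # v) * cubic n (a # b # v) - word_exp n (b # a # v) * cubic n (b # a # v)) +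
    (of_nat k * ((word_exp n (a # b # v) - word_exp n (b # a # v)) * eta n (a # b # v)) :: 'k ext)"
    unfolding word_ext_shifted_def eq by (simp add: algebra_simps)
  also have "\<dots> = P * (word_ext_shifted n (Suc k) v + word_ext_shifted n (Suc k) v)"
    unfolding swap_first_letters[OF three n, of v] P_def[symmetric] word_ext_shifted_def
    by (simp add: algebra_simps Let_def kill'' nat)
  finally show ?thesis unfolding P_def .
qed

text \<open>
  The terms with \<open>k\<close> cancel, because all four words have the same linear form; this is the
  computation that separates the triple commutators from 0. The factor 4 that arises is 1.
\<close>

lemma word_ext_shifted_triple:
  assumes three: "(3 :: 'k::field ext) = 0" and n: "a < n" "b < n" "c < n"
  shows "word_ext_shifted n k (a # b # c # v) - word_ext_shifted n k (b # a # c # v)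
      - word_ext_shifted n k (c # a # b # v) + word_ext_shifted n k (c # b # a # v) =
    (gen a * gen b * gen c * word_exp n v :: 'k ext)"
proof -
  define P g where d: "P = (gen a * gen b :: 'k ext)" "g = (gen c :: 'k ext)"
  define W E ov tv where dv: "W = (eta n v :: 'k ext)" "E = (word_exp n v :: 'k ext)" "ov = (quadratic n v :: 'k ext)" "tv = (cubic n v :: 'k ext)"
  define U where "U = (eta n (a # b # v) :: 'k ext)"
  define q where "q = (carry_w n [c] (a # b # v) :: 'k ext)"
  define q' where "q' = (carry_w n [c] v :: 'k ext)"
  have cP: "central P" unfolding d by (rule central_gen_gen)
  have cE: "central E" unfolding dv by (rule central_word_exp)
  have mvE: "P * (E * z) = E * (P * z)" "P * E = E * P" "g * (E * z) = E * (g * z)" "g * E = E * g"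
    "W * (E * z) = E * (W * z)" "W * E = E * W" "U * (E * z) = E * (U * z)" "U * E = E * U" for z
    by (rule centralD[OF cE] central_left_commute[OF cE])+
  have mvP: "g * (P * z) = P * (g * z)" "g * P = P * g"
    "W * (P * z) = P * (W * z)" "W * P = P * W" "U * (P * z) = P * (U * z)" "U * P = P * U" for z
    by (rule centralD[OF cP] central_left_commute[OF cP])+
  have mvk: "P * (of_nat k * z) = of_nat k * (P * z)" "g * (of_nat k * z) = of_nat k * (g * z)"
    "E * (of_nat k * z) = of_nat k * (E * z)" for z
    by (rule centralD[OF central_of_nat] central_left_commute[OF central_of_nat])+
  have gg: "g * g = 0" "g * (g * z) = 0" for z
    by (simp_all add: d gen_square mult.assoc[symmetric])
  have WW: "W * W = 0" "W * (W * z) = 0" for z by (simp_all add: dv lin_square mult.assoc[symmetric])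
  have Wg: "W * g = - (g * W)" "W * (g * z) = - (g * (W * z))" for z
  proof -
    show "W * g = - (g * W)" using n lin_anticommute[of n "count_list v" n "count_list [c]"] by (simp add: d dv eta_single)
    then show "W * (g * z) = - (g * (W * z))" by (metis mult.assoc mult_minus_left)
  qed
  have PU: "P * U = P * W"
    using n
    by (simp add: U_def d dv eta_Cons[of n a "b # v"] eta_Cons[of n b v] eta_single distrib_left gen_gen_kills)
  have PU': "P * (U * z) = P * (W * z)" for z using PU by (metis mult.assoc)
  have Pg: "P * (g * (U * z)) = P * (g * (W * z))" "P * (g * U) = P * (g * W)" for z
    using mvP PU PU' by metis+
  have Pq: "P * q = P * q'"
    using gen_gen_carry_drop[of a b n "count_list [c]" "count_list v"] count_list_fun(2)[of "[a, b]" v]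
    by (simp add: q_def q'_def d)
  have Pq': "P * (g * (W * q)) = P * (g * (W * q'))"  "P * (g * q) = P * (g * q')"
    using mvP Pq by metis+
  have swap: "eta n (b # a # v) = U" "carry_w n [c] (b # a # v) = q"
  proof -
    have "count_list (b # a # v) = count_list (a # b # v)" by (auto simp: fun_eq_iff count_list.simps)
    then show "eta n (b # a # v) = U" "carry_w n [c] (b # a # v) = q" by (simp_all add: U_def q_def)
  qed
  have pw: "word_exp n (a # b # v) - word_exp n (b # a # v) = P * (E + E)"
    "word_exp n (a # b # v) * quadratic n (a # b # v) - word_exp n (b # a # v) * quadratic n (b # a # v) =
      P * (E + E * ov + (E + E * ov))"
    "word_exp n (a # b # v) * cubic n (a # b # v) - word_exp n (b # a # v) * cubic n (b # a # v) =
      P * (E * tv + E * W + (E * tv + E * W))"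
    using swap_first_letters[OF three n(1,2), of v] by (simp_all add: d dv Let_def)
  have ga: "g * (word_exp n u * z) = word_exp n u * (g * z)" "g * word_exp n u = word_exp n u * g" for u z
    by (rule centralD[OF central_word_exp] central_left_commute[OF central_word_exp])+
  have exp: "word_ext_shifted n k (c # u) = (1 + g * V) * (word_exp n u + word_exp n u * cubic n u - g * (word_exp n u * quadratic n u) + word_exp n u * r)
      + of_nat k * ((1 + g * V) * (g + V) * word_exp n u)" if "eta n u = V" "carry_w n [c] u = r" for u V r
  proof -
    have m: "V * (word_exp n u * z) = word_exp n u * (V * z)" "V * word_exp n u = word_exp n u * V" for z
      by (rule centralD[OF central_word_exp] central_left_commute[OF central_word_exp])+
    show ?thesis
      using n that unfolding word_ext_shifted_def
      by (simp add: word_exp.simps cubic.simps eta_Cons[of n c u] eta_single d(2)[symmetric] algebra_simps ga m)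
  qed
  define X1 X2 where X: "X1 = word_exp n (a # b # v) + word_exp n (a # b # v) * cubic n (a # b # v) - g * (word_exp n (a # b # v) * quadratic n (a # b # v)) + word_exp n (a # b # v) * q"
    "X2 = word_exp n (b # a # v) + word_exp n (b # a # v) * cubic n (b # a # v) - g * (word_exp n (b # a # v) * quadratic n (b # a # v)) + word_exp n (b # a # v) * q"
  have X12: "X1 - X2 = P * (let z = E + E * tv + E * W - g * (E + E * ov) + E * q in z + z)"
  proof -
    have "X1 - X2 = (word_exp n (a # b # v) - word_exp n (b # a # v)) + (word_exp n (a # b # v) * cubic n (a # b # v) - word_exp n (b # a # v) * cubic n (b # a # v))
      - g * (word_exp n (a # b # v) * quadratic n (a # b # v) - word_exp n (b # a # v) * quadratic n (b # a # v)) + (word_exp n (a # b # v) - word_exp n (b # a # v)) * q"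
      unfolding X by (simp add: algebra_simps)
    also have "\<dots> = P * (let z = E + E * tv + E * W - g * (E + E * ov) + E * q in z + z)"
      unfolding pw Let_def by (simp add: algebra_simps mvP)
    finally show ?thesis .
  qed
  have L1: "word_ext_shifted n k (a # b # c # v) - word_ext_shifted n k (b # a # c # v) =
     P * (let z = (1 + g * W) * (E + E * tv - g * (E * ov) + E * q') + of_nat (Suc k) * ((1 + g * W) * (g + W) * E) in z + z)"
    unfolding word_ext_shifted_commutator[OF three n(1,2)] d(1) Let_def
    using n by (simp add: word_exp.simps cubic.simps word_ext_shifted_def eta_Cons[of n c v] eta_single d(2)[symmetric] dv[symmetric] q'_def[symmetric] algebra_simps mvE)
  have L2: "word_ext_shifted n k (c # a # b # v) - word_ext_shifted n k (c # b # a # v) =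
     (1 + g * U) * (X1 - X2) + of_nat k * ((1 + g * U) * (g + U) * (P * (E + E)))"
    unfolding exp[OF U_def[symmetric] q_def[symmetric]] exp[OF swap] X[symmetric] pw(1)[symmetric]
    by (simp add: algebra_simps)
  have "word_ext_shifted n k (a # b # c # v) - word_ext_shifted n k (b # a # c # v)
      - word_ext_shifted n k (c # a # b # v) + word_ext_shifted n k (c # b # a # v) = 
      (word_ext_shifted n k (a # b # c # v) - word_ext_shifted n k (b # a # c # v))
      - (word_ext_shifted n k (c # a # b # v) - word_ext_shifted n k (c # b # a # v))" by simp
  also have "\<dots> = P * (g * E + g * E + (g * E + g * E))"
    unfolding L1 L2 X12 Let_def
    by (simp add: algebra_simps mvE mvP mvk gg WW Wg PU PU' Pg Pq Pq')
  \<comment> \<open>the four equal terms are a single one, since 3 is 0\<close>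
  also have "\<dots> = gen a * gen b * gen c * word_exp n v"
    using three_times[OF three, of "gen a * gen b * (gen c * word_exp n v)"]
    by (simp add: d dv algebra_simps)
  finally show ?thesis .
qed

section \<open>Functionals on the free algebra that vanish on cubes\<close>

abbreviation monom :: "nat list \<Rightarrow> 'k::field \<Rightarrow> 'k free" where
  "monom w c \<equiv> Poly_Mapping.single w c"

lemma monom_mult: "monom u a * monom v b = monom (u @ v) (a * b)"
  by (simp add: mult_single plus_list_def)

lemma sum_of_monoms: "(\<Sum>w\<in>Poly_Mapping.keys a. monom w (Poly_Mapping.lookup a w)) = a"
  by (rule poly_mapping_eqI)
    (simp add: lookup_sum lookup_single when_def sum.delta[OF finite_keys] in_keys_iff)

lemma free_induct:
  assumes "P 0" "\<And>w c. P (monom w c)" "\<And>a b. P a \<Longrightarrow> P b \<Longrightarrow> P (a + b)"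
  shows "P (a :: 'k::field free)"
proof -
  have "P (\<Sum>w\<in>F. monom w (Poly_Mapping.lookup a w))" if "finite F" for F
    using that by (induction F) (auto intro: assms)
  from this[of "Poly_Mapping.keys a"] show ?thesis
    by (simp add: sum_of_monoms)
qed

definition linear_extension :: "(nat list \<Rightarrow> 'k::field) \<Rightarrow> 'k free \<Rightarrow> 'k" where
  "linear_extension \<phi> x = (\<Sum>w\<in>Poly_Mapping.keys x. Poly_Mapping.lookup x w * \<phi> w)"

lemma linear_extension_superset:
  "finite F \<Longrightarrow> Poly_Mapping.keys x \<subseteq> F \<Longrightarrow>
    linear_extension \<phi> x = (\<Sum>w\<in>F. Poly_Mapping.lookup x w * \<phi> w)"
  unfolding linear_extension_def by (rule sum.mono_neutral_left) (auto simp: in_keys_iff)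

lemma linear_extension_0 [simp]: "linear_extension \<phi> 0 = 0"
  by (simp add: linear_extension_def)

lemma linear_extension_add: "linear_extension \<phi> (x + y) = linear_extension \<phi> x + linear_extension \<phi> y"
proof -
  let ?F = "Poly_Mapping.keys x \<union> Poly_Mapping.keys y"
  show ?thesis
    using keys_add[of x y]
    by (simp add: linear_extension_superset[of ?F] lookup_add algebra_simps sum.distrib)
qed

lemma linear_extension_monom [simp]: "linear_extension \<phi> (monom w c) = c * \<phi> w"
  by (simp add: linear_extension_def)

lemma linear_extension_uminus: "linear_extension \<phi> (- x) = - linear_extension \<phi> x"
  using linear_extension_add[of \<phi> x "- x"] by (simp add: eq_neg_iff_add_eq_0 add.commute)

lemma linear_extension_diff: "linear_extension \<phi> (x - y) = linear_extension \<phi> x - linear_extension \<phi> y"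
  using linear_extension_add[of \<phi> x "- y"] by (simp add: linear_extension_uminus)

lemma linear_extension_sum: "linear_extension \<phi> (\<Sum>i\<in>I. f i) = (\<Sum>i\<in>I. linear_extension \<phi> (f i))"
  by (induction I rule: infinite_finite_induct) (simp_all add: linear_extension_add)

lemma linear_extension_scale: "linear_extension \<phi> (monom [] c * x) = c * linear_extension \<phi> x"
  by (induction x rule: free_induct) (simp_all add: monom_mult distrib_left linear_extension_add)

lemma linear_extension_prefix: "linear_extension \<phi> (monom u c * x) = c * linear_extension (\<lambda>v. \<phi> (u @ v)) x"
  by (induction x rule: free_induct) (simp_all add: monom_mult distrib_left linear_extension_add)

text \<open>
  The ideal of the cubes in the free algebra on all letters. Working with infinitely many letters
  makes the quotient a single type; the passage to \<open>d\<close> letters is \<open>cube_ideal_iff\<close>.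
\<close>

inductive_set nil_ideal :: "'k::field free set" where
  cube: "Poly_Mapping.lookup a [] = 0 \<Longrightarrow> a ^ 3 \<in> nil_ideal"
| add: "a \<in> nil_ideal \<Longrightarrow> b \<in> nil_ideal \<Longrightarrow> a + b \<in> nil_ideal"
| mult_left: "a \<in> nil_ideal \<Longrightarrow> b * a \<in> nil_ideal"
| mult_right: "a \<in> nil_ideal \<Longrightarrow> a * b \<in> nil_ideal"

definition sym3 :: "'a::ring_1 \<Rightarrow> 'a \<Rightarrow> 'a \<Rightarrow> 'a" where
  "sym3 a b c = a * b * c + a * c * b + b * a * c + b * c * a + c * a * b + c * b * a"

definition engel_form :: "'a::ring_1 \<Rightarrow> 'a \<Rightarrow> 'a" where
  "engel_form a b = a * a * b + a * b * a + b * a * a"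

text \<open>
  Linear functionals that vanish on all symmetrised triples of words, in every context, also vanish on
  \<open>engel_form\<close>, because \<open>sym3 a a b\<close> is twice \<open>engel_form a b\<close> and 3 is 0. The cube is then additive
  modulo such elements, and it is enough to kill the cubes of words.
\<close>

lemma functional_vanishes_on_nil_ideal:
  fixes \<phi> :: "nat list \<Rightarrow> 'k::field"
  assumes three: "(3 :: 'k) = 0"
    and sym: "\<And>p q a b c. \<phi> (p @ (a @ b @ c) @ q) + \<phi> (p @ (a @ c @ b) @ q) + \<phi> (p @ (b @ a @ c) @ q) +
      \<phi> (p @ (b @ c @ a) @ q) + \<phi> (p @ (c @ a @ b) @ q) + \<phi> (p @ (c @ b @ a) @ q) = 0"
    and cube: "\<And>p q a. a \<noteq> [] \<Longrightarrow> \<phi> (p @ (a @ a @ a) @ q) = 0"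
    and x: "x \<in> nil_ideal"
  shows "linear_extension \<phi> x = 0"
proof -
  define J where "J = {x. \<forall>p q. linear_extension \<phi> (monom p 1 * x * monom q 1) = 0}"
  have J_add: "x + y \<in> J" if "x \<in> J" "y \<in> J" for x y
    using that by (simp add: J_def distrib_left distrib_right linear_extension_add)
  have J_diff: "x - y \<in> J" if "x \<in> J" "y \<in> J" for x y
    using that by (simp add: J_def left_diff_distrib right_diff_distrib linear_extension_diff)
  have J_0: "0 \<in> J" by (simp add: J_def)
  have pull: "monom p 1 * (monom u c * x) * monom q 1 = monom [] c * (monom (p @ u) 1 * x * monom q 1)"
    "monom p 1 * (x * monom u c) * monom q 1 = monom [] c * (monom p 1 * x * monom (u @ q) 1)" for p q u c and x :: "'k free"
  proof -
    show "monom p 1 * (monom u c * x) * monom q 1 = monom [] c * (monom (p @ u) 1 * x * monom q 1)"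
      by (simp add: mult.assoc[symmetric] monom_mult)
    show "monom p 1 * (x * monom u c) * monom q 1 = monom [] c * (monom p 1 * x * monom (u @ q) 1)"
    proof (induction x rule: free_induct)
      case 1 show ?case by simp
      case 2 show ?case by (simp add: monom_mult mult_ac)
      case (3 a b) then show ?case by (simp add: distrib_left distrib_right)
    qed
  qed
  have J_left: "b * x \<in> J" if x: "x \<in> J" for b x
  proof (induction b rule: free_induct)
    case (2 w c)
    show ?case using x by (simp add: J_def pull linear_extension_scale)
  qed (simp_all add: J_0 J_add distrib_right)
  have J_right: "x * b \<in> J" if x: "x \<in> J" for b x
  proof (induction b rule: free_induct)
    case (2 w c)
    show ?case using x by (simp add: J_def pull linear_extension_scale)
  qed (simp_all add: J_0 J_add distrib_left)
  have sym3_monom: "sym3 (monom u a) (monom v b) (monom w c) \<in> J" for u v w a b c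
  proof -
    have "linear_extension \<phi> (monom p 1 * sym3 (monom u a) (monom v b) (monom w c) * monom q 1) =
      (a * b * c) * (\<phi> (p @ (u @ v @ w) @ q) + \<phi> (p @ (u @ w @ v) @ q) + \<phi> (p @ (v @ u @ w) @ q) +
      \<phi> (p @ (v @ w @ u) @ q) + \<phi> (p @ (w @ u @ v) @ q) + \<phi> (p @ (w @ v @ u) @ q))" for p q
      by (simp add: sym3_def distrib_left distrib_right monom_mult linear_extension_add mult_ac)
    then show ?thesis unfolding J_def by (simp only: sym) simp
  qed
  have s3: "sym3 a b c \<in> J" for a b c
  proof (induction a rule: free_induct)
    case 1 show ?case by (simp add: sym3_def J_0)
    case (2 u a)
    show ?case
    proof (induction b rule: free_induct)
      case 1 show ?case by (simp add: sym3_def J_0)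
      case (2 v b)
      show ?case
      proof (induction c rule: free_induct)
        case 1 show ?case by (simp add: sym3_def J_0)
        case 2 show ?case by (rule sym3_monom)
        case (3 x y)
        from J_add[OF this] show ?case by (simp add: sym3_def algebra_simps)
      qed
      case (3 x y)
      from J_add[OF this] show ?case by (simp add: sym3_def algebra_simps)
    qed
    case (3 x y)
    from J_add[OF this] show ?case by (simp add: sym3_def algebra_simps)
  qed
  have J_three: "x + x + x \<in> J" for x
  proof -
    have "l + l + l = 0" for l :: 'k
    proof -
      have "l + l + l = 3 * l" by simp
      then show ?thesis by (simp only: three mult_zero_left)
    qed
    then show ?thesis by (simp add: J_def distrib_left distrib_right linear_extension_add)
  qed
  have T2: "engel_form a b \<in> J" for a b
  proof -
    have "engel_form a b = (engel_form a b + engel_form a b + engel_form a b) - sym3 a a b"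
      by (simp add: engel_form_def sym3_def algebra_simps)
    then show ?thesis using J_diff[OF J_three s3] by metis
  qed
  have cube_sum: "(\<Sum>w\<in>F. monom w (c w)) ^ 3 \<in> J" if "finite F" "[] \<notin> F" for F and c :: "nat list \<Rightarrow> 'k"
    using that
  proof (induction F)
    case (insert w F)
    let ?a = "monom w (c w)" and ?b = "\<Sum>w\<in>F. monom w (c w)"
    have "(?a + ?b) ^ 3 = ?a ^ 3 + ?b ^ 3 + (engel_form ?a ?b + engel_form ?b ?a)"
      by (simp add: engel_form_def power3_eq_cube algebra_simps)
    moreover have "?a ^ 3 \<in> J"
      using insert.prems cube[of w] by (auto simp: J_def power3_eq_cube monom_mult)
    ultimately show ?case using insert by (auto intro!: J_add T2)
  qed (simp add: J_0)
  have "x \<in> J"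
    using x
  proof (induction rule: nil_ideal.induct)
    case (cube a)
    then have "[] \<notin> Poly_Mapping.keys a" by (simp add: in_keys_iff)
    from cube_sum[OF finite_keys this, of "Poly_Mapping.lookup a"] show ?case
      by (simp add: sum_of_monoms)
  qed (auto intro: J_add J_left J_right)
  then have "linear_extension \<phi> (monom [] 1 * x * monom [] 1) = 0" by (simp add: J_def)
  moreover have "monom [] 1 = (1 :: 'k free)" by (metis single_one zero_list_def)
  ultimately show ?thesis by simp
qed

section \<open>The functionals given by the exterior algebra\<close>

lemma word_ext_sym:
  assumes three: "(3 :: 'k::field ext) = 0"
  shows "word_ext n (p @ (a @ b @ c) @ q) + word_ext n (p @ (a @ c @ b) @ q) + word_ext n (p @ (b @ a @ c) @ q) +
      word_ext n (p @ (b @ c @ a) @ q) + word_ext n (p @ (c @ a @ b) @ q) + word_ext n (p @ (c @ b @ a) @ q) = (0 :: 'k ext)"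
proof -
  obtain f d Q P where F: "\<And>w. count_list w = count_list (a @ b @ c) \<Longrightarrow> word_ext n (p @ w @ q) =
     f * (word_exp n w * d + word_exp n w * cubic n w + word_exp n w * quadratic n w * Q - P * (word_exp n w * quadratic n w) :: 'k ext)"
    by (rule word_ext_context[OF three, where A = "count_list (a @ b @ c)" and n = n and p = p and q = q]) blast
  let ?s = "\<lambda>F. F (a @ b @ c) + F (a @ c @ b) + F (b @ a @ c) + F (b @ c @ a) + F (c @ a @ b) + F (c @ b @ a) :: 'k ext"
  have "?s (\<lambda>w. word_ext n (p @ w @ q)) =
    f * (?s (word_exp n) * d + ?s (\<lambda>w. word_exp n w * cubic n w) + ?s (\<lambda>w. word_exp n w * quadratic n w) * Q - P * ?s (\<lambda>w. word_exp n w * quadratic n w))"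
    by (subst F, (simp add: count_list_fun fun_eq_iff; fail))+ (simp add: algebra_simps)
  then show ?thesis by (simp only: word_perms_vanish[OF three]) simp
qed

lemma carry_cong:
  assumes "\<And>i. of_nat (A i) = (of_nat (A' i) :: 'k::field ext)"
  shows "lin n A = (lin n A' :: 'k ext)" "carry n A B = (carry n A' B :: 'k ext)"
proof -
  show *: "lin n A = (lin n A' :: 'k ext)" for n by (induction n) (simp_all add: assms)
  show "carry n A B = (carry n A' B :: 'k ext)" by (induction n) (simp_all add: assms *)
qed

lemma carry_self: "carry n A A = 0" "carry n A (\<lambda>i. A i + A i) = (0 :: 'k::field ext)"
proof -
  show "carry n A A = 0" by (induction n) simp_all
  have "lin m A * ((lin m A + lin m A) * z) = (lin m A * lin m A) * z + (lin m A * lin m A) * z" for m and z :: "'k ext"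
    by (simp add: distrib_left distrib_right mult.assoc)
  then show "carry n A (\<lambda>i. A i + A i) = (0 :: 'k ext)" by (induction n) (simp_all add: lin_add lin_square)
qed

lemma word_exp_cube:
  assumes three: "(3 :: 'k::field ext) = 0"
  shows "word_exp n a * (word_exp n a * word_exp n a) = (1 :: 'k ext)"
proof (induction a)
  case (Cons x a)
  define s where "s = (eta n [x] * eta n a :: 'k ext)"
  have ss: "s * s = 0"
  proof -
    have "s * s = eta n [x] * (eta n a * (eta n [x] * eta n a))" by (simp add: s_def mult.assoc)
    also have "eta n a * (eta n [x] * eta n a) = (eta n [x] * eta n a) * eta n a"
      by (rule centralD[OF central_lin_lin])
    finally show ?thesis by (simp add: mult.assoc lin_square)
  qed
  have mv: "(1 + s) * (word_exp n a * z) = word_exp n a * ((1 + s) * z)" for z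
    by (rule central_left_commute[OF central_word_exp])
  have "(1 + s) * ((1 + s) * (1 + s)) = 1 + (s + s + s)"
    using ss by (simp add: algebra_simps)
  also have "\<dots> = 1" using three_times[OF three, of s] by simp
  finally have "word_exp n a * (word_exp n a * (word_exp n a * ((1 + s) * ((1 + s) * (1 + s))))) = 1"
    using Cons.IH by simp
  then show ?case by (simp only: word_exp.simps s_def[symmetric] mult.assoc mv)
qed simp

text \<open>
  The linear form, the quadratic and the cubic element of the cube are all multiples of 3, and the
  exponential is the exponential of 0.
\<close>

lemma word_ext_cube:
  assumes three: "(3 :: 'k::field ext) = 0"
  shows "word_ext n (p @ (a @ a @ a) @ q) = (word_ext n (p @ q) :: 'k ext)"
proof -
  let ?c = "a @ a @ a"
  have e: "eta n ?c = (0 :: 'k ext)" using three_times[OF three, of "eta n a"] by (simp add: eta_append add.assoc)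
  have o: "quadratic n ?c = (0 :: 'k ext)"
    using three_times[OF three, of "quadratic n a"] by (simp only: quadratic_word3 lin_square) simp
  have t: "cubic n ?c = (0 :: 'k ext)"
  proof -
    have k: "carry_w n a a = (0 :: 'k ext)" "carry_w n a (a @ a) = (0 :: 'k ext)"
      unfolding count_list_fun by (rule carry_self)+
    have "cubic n ?c = (cubic n a + cubic n a + cubic n a :: 'k ext)" unfolding cubic_word3[OF three] by (simp add: lin_square k)
    then show ?thesis by (simp only: three_times[OF three])
  qed
  have x: "word_exp n ?c = (1 :: 'k ext)"
    unfolding word_exp_word3 using word_exp_cube[OF three, of n a] by (simp add: lin_square mult.assoc[symmetric])
  have nat: "of_nat (count_list ?c i) = (0 :: 'k ext)" for i
    using three_times[OF three, of "of_nat (count_list a i)"] by (simp add: add.assoc)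
  have cq: "carry_w n ?c q = (0 :: 'k ext)"
  proof -
    have "carry_w n ?c q = (carry n (\<lambda>_. 0) (count_list q) :: 'k ext)"
      by (rule carry_cong(2)) (use nat in simp)
    then show ?thesis by (simp add: carry_zero)
  qed
  have pc: "carry_w n p (?c @ q) = (carry_w n p q :: 'k ext)"
    unfolding carry_sym[of n "count_list p"] by (rule carry_cong(2)) (use nat[simplified] in simp)
  have eq: "eta n (?c @ q) = (eta n q :: 'k ext)" unfolding eta_append[of n ?c] e by simp
  have xq: "word_exp n (?c @ q) = (word_exp n q :: 'k ext)" unfolding word_exp_append[of n ?c] x e by simp
  have oq: "quadratic n (?c @ q) = (quadratic n q :: 'k ext)" unfolding quadratic_append[of n ?c] o e by simp
  have tq: "cubic n (?c @ q) = (cubic n q :: 'k ext)" unfolding cubic_append[OF three, of n ?c] t o e cq by simp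
  show ?thesis
    unfolding word_ext_def word_exp_append[of n p] cubic_append[OF three, of n p] pc eq xq oq tq ..
qed

definition supported :: "nat set \<Rightarrow> 'k::field ext set" where
  "supported V = {x. \<forall>S. coef x S \<noteq> 0 \<longrightarrow> S \<subseteq> V}"

lemma supportedD: "x \<in> supported V \<Longrightarrow> \<not> S \<subseteq> V \<Longrightarrow> coef x S = 0"
  by (auto simp: supported_def)

lemma supported_basic: "0 \<in> supported V" "1 \<in> supported V" "i \<in> V \<Longrightarrow> gen i \<in> supported V"
  by (auto simp: supported_def coef_gen split: if_splits)

lemma supported_add: "x \<in> supported V \<Longrightarrow> y \<in> supported V \<Longrightarrow> x + y \<in> supported V"
  by (auto simp: supported_def) (metis add.right_neutral subsetD)

lemma supported_minus: "x \<in> supported V \<Longrightarrow> y \<in> supported V \<Longrightarrow> x - y \<in> supported V"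
  by (auto simp: supported_def) (metis diff_0_right right_minus_eq subsetD)

lemma supported_mult:
  assumes "x \<in> supported V" "y \<in> supported V"
  shows "x * y \<in> supported V"
  unfolding supported_def
proof (safe, rule ccontr)
  fix S i assume S: "coef (x * y) S \<noteq> 0" "i \<in> S" "i \<notin> V"
  then have f: "finite S" using coef_infinite by metis
  have "coef x T * coef y (S - T) = 0" for T
  proof (cases "i \<in> T")
    case True then show ?thesis using supportedD[OF assms(1), of T] S by auto
  next
    case False then show ?thesis using supportedD[OF assms(2), of "S - T"] S by auto
  qed
  with S(1) show False by (simp add: coef_times[OF f])
qed

lemma supported_of_nat: "of_nat k \<in> supported V"
  by (induction k) (auto intro: supported_basic supported_add)

lemma supported_lin: "(\<And>i. A i \<noteq> 0 \<Longrightarrow> i \<in> V) \<Longrightarrow> lin n A \<in> supported V"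
proof (induction n)
  case (Suc n)
  then show ?case
    by (cases "A n = 0") (auto intro!: supported_add supported_mult supported_of_nat supported_basic)
qed (simp add: supported_basic)

lemma supported_carry:
  assumes "\<And>i. A i \<noteq> 0 \<Longrightarrow> i \<in> V" "\<And>i. B i \<noteq> 0 \<Longrightarrow> i \<in> V"
  shows "carry n A B \<in> supported V"
proof (induction n)
  case (Suc n)
  show ?case
  proof (cases "A n = 0 \<and> B n = 0")
    case False
    then have "n \<in> V" using assms by auto
    then show ?thesis
      using Suc assms by (auto intro!: supported_add supported_mult supported_minus supported_of_nat supported_lin supported_basic)
  qed (use Suc in simp)
qed (simp add: supported_basic)

lemma supported_word:
  "set w \<subseteq> V \<Longrightarrow> quadratic n w \<in> supported V"
  "set w \<subseteq> V \<Longrightarrow> word_exp n w \<in> supported V"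
  "set w \<subseteq> V \<Longrightarrow> cubic n w \<in> supported V"
proof -
  have c: "count_list v i \<noteq> 0 \<Longrightarrow> set v \<subseteq> V \<Longrightarrow> i \<in> V" for v :: "nat list" and i
    by (auto simp: count_list_0_iff)
  have l: "set v \<subseteq> V \<Longrightarrow> eta n v \<in> supported V" for v
    by (rule supported_lin) (rule c)
  have k: "set u \<subseteq> V \<Longrightarrow> set v \<subseteq> V \<Longrightarrow> carry_w n u v \<in> supported V" for u v
    by (rule supported_carry) (erule c; simp)+
  show o: "set w \<subseteq> V \<Longrightarrow> quadratic n w \<in> supported V" for w
    by (induction w) (auto simp: quadratic.simps intro!: supported_basic supported_add supported_mult l)
  show "set w \<subseteq> V \<Longrightarrow> word_exp n w \<in> supported V"
    by (induction w) (auto simp: word_exp.simps intro!: supported_basic supported_add supported_mult l)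
  show "set w \<subseteq> V \<Longrightarrow> cubic n w \<in> supported V"
    by (induction w) (auto simp: cubic.simps intro!: supported_basic supported_add supported_minus supported_mult l k o)
qed

lemma word_ext_supported: "word_ext n w \<in> supported (set w)"
  unfolding word_ext_def by (intro supported_mult supported_add supported_basic supported_word) auto

definition pbw_functional :: "nat \<Rightarrow> nat multiset \<Rightarrow> nat set \<Rightarrow> nat list \<Rightarrow> 'k::field" where
  "pbw_functional n M T w = (if mset w = M then coef (word_ext n w) T else 0)"

lemma three_ext: "(3 :: 'k::field) = 0 \<Longrightarrow> (3 :: 'k ext) = 0"
proof (rule ext_eqI)
  fix S :: "nat set" assume "(3 :: 'k) = 0"
  then have "(1 + (1 + 1) :: 'k) = 0" by simp
  moreover have "coef (1 + (1 + 1) :: 'k ext) S = (if S = {} then 1 + (1 + 1) else 0)"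
    by (simp only: coef_simps add_0_right split: if_split) simp
  moreover have "(3 :: 'k ext) = 1 + (1 + 1)" by simp
  ultimately show "coef (3 :: 'k ext) S = coef 0 S" by (simp only: coef_simps split: if_split) simp
qed

text \<open>
  A cube \<open>a a a\<close> uses up the full degree of the letters of \<open>a\<close>, so these lie in \<open>T\<close> but not in the
  remaining word, to which \<open>word_ext_cube\<close> reduces the coefficient.
\<close>

lemma pbw_functional_vanishes:
  fixes x :: "'k::field free"
  assumes three: "(3 :: 'k) = 0"
    and M: "\<And>i. count M i \<le> 3" "\<And>i. count M i = 3 \<Longrightarrow> i \<in> T"
    and x: "x \<in> nil_ideal"
  shows "linear_extension (pbw_functional n M T) x = 0"
proof (rule functional_vanishes_on_nil_ideal[OF three _ _ x])
  fix p q a b c :: "nat list"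
  have "coef (word_ext n (p @ (a @ b @ c) @ q) + word_ext n (p @ (a @ c @ b) @ q) + word_ext n (p @ (b @ a @ c) @ q) +
      word_ext n (p @ (b @ c @ a) @ q) + word_ext n (p @ (c @ a @ b) @ q) + word_ext n (p @ (c @ b @ a) @ q) :: 'k ext) T = 0"
    unfolding word_ext_sym[OF three_ext[OF three]] by simp
  then show "pbw_functional n M T (p @ (a @ b @ c) @ q) + pbw_functional n M T (p @ (a @ c @ b) @ q) + pbw_functional n M T (p @ (b @ a @ c) @ q) +
      pbw_functional n M T (p @ (b @ c @ a) @ q) + pbw_functional n M T (p @ (c @ a @ b) @ q) + pbw_functional n M T (p @ (c @ b @ a) @ q) = (0 :: 'k)"
    by (simp add: pbw_functional_def add_ac)
next
  fix p q a :: "nat list" assume a: "a \<noteq> []"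
  show "pbw_functional n M T (p @ (a @ a @ a) @ q) = (0 :: 'k)"
  proof (cases "mset (p @ (a @ a @ a) @ q) = M")
    case True
    define i where "i = hd a"
    have "count M i = count (mset (p @ q)) i + (count (mset a) i + count (mset a) i + count (mset a) i)"
      using True by auto
    moreover have "count (mset a) i \<ge> 1" using a by (simp add: i_def Suc_le_eq)
    ultimately have "count (mset (p @ q)) i = 0" "count M i = 3"
      using M(1)[of i] by linarith+
    then have "i \<notin> set (p @ q)" "i \<in> T" using M(2) by (auto simp: count_eq_zero_iff)
    then have "coef (word_ext n (p @ q) :: 'k ext) T = 0"
      using supportedD[OF word_ext_supported] by blast
    then show ?thesis unfolding pbw_functional_def word_ext_cube[OF three_ext[OF three]] by simp
  qed (simp add: pbw_functional_def)
qed

definition commutator :: "'a::ring_1 \<Rightarrow> 'a \<Rightarrow> 'a" where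
  "commutator x y = x * y - y * x"

text \<open>
  This is \<open>C\<^sub>S\<close>. No basis element belongs to a set of size 1; with the value 0 on lists of length 1,
  statements about all lists need no exception for them.
\<close>

fun comm_prod :: "'a::ring_1 list \<Rightarrow> 'a" where
  "comm_prod [] = 1"
| "comm_prod [x] = 0"
| "comm_prod [x, y, z] = commutator (commutator x y) z"
| "comm_prod (x # y # xs) = commutator x y * comm_prod xs"

text \<open>
  The effect of multiplication by \<open>comm_prod\<close> from the left on the level of functions of words,
  see \<open>linear_extension_comm_prod\<close>.
\<close>

fun alternate :: "(nat list \<Rightarrow> 'b::ab_group_add) \<Rightarrow> nat list \<Rightarrow> nat list \<Rightarrow> 'b" where
  "alternate \<phi> [] w = \<phi> w"
| "alternate \<phi> [x] w = 0"
| "alternate \<phi> [x, y, z] w = \<phi> (x # y # z # w) - \<phi> (y # x # z # w) - \<phi> (z # x # y # w) + \<phi> (z # y # x # w)"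
| "alternate \<phi> (x # y # xs) w = alternate (\<lambda>v. \<phi> (x # y # v) - \<phi> (y # x # v)) xs w"

text \<open>
  Induction that follows the recursion of \<open>comm_prod\<close>, which treats lists of length 3 separately.
\<close>

lemma pair_list_induct [case_names Nil single triple pair]:
  assumes "P []" "\<And>x. P [x]" "\<And>x y z. P [x, y, z]"
    and step: "\<And>x y xs. length xs \<noteq> 1 \<Longrightarrow> P xs \<Longrightarrow> P (x # y # xs)"
  shows "P xs"
proof (induction xs rule: length_induct)
  case (1 xs)
  show ?case
  proof (cases xs)
    case (Cons x ys)
    show ?thesis
    proof (cases ys)
      case Cons': (Cons y zs)
      show ?thesis
      proof (cases "length zs = 1")
        case True
        then obtain z where "zs = [z]" by (auto simp: length_Suc_conv)
        then show ?thesis using assms(3) Cons Cons' by simp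
      next
        case False
        moreover have "P zs" using 1 Cons Cons' by simp
        ultimately show ?thesis using step Cons Cons' by simp
      qed
    qed (use assms(2) Cons in simp)
  qed (use assms(1) in simp)
qed

lemma comm_prod_Cons_Cons: "length xs \<noteq> 1 \<Longrightarrow> comm_prod (x # y # xs) = commutator x y * comm_prod xs"
  by (cases "(x # y # xs)" rule: comm_prod.cases) auto

lemma alternate_Cons_Cons: "length xs \<noteq> 1 \<Longrightarrow>
    alternate \<phi> (x # y # xs) w = alternate (\<lambda>v. \<phi> (x # y # v) - \<phi> (y # x # v)) xs w"
  by (cases "(\<phi>, (x # y # xs), w)" rule: alternate.cases) auto

lemma linear_extension_fun_diff:
  "linear_extension (\<lambda>v. \<phi> v - \<psi> v) x = linear_extension \<phi> x - linear_extension \<psi> x"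
  by (simp add: linear_extension_def algebra_simps sum_subtractf)

lemma linear_extension_comm_prod:
  fixes \<phi> :: "nat list \<Rightarrow> 'k::field"
  shows "linear_extension \<phi> (comm_prod (map (\<lambda>i. monom [i] 1) S) * monom w 1) = alternate \<phi> S w"
proof (induction S arbitrary: \<phi> rule: pair_list_induct)
  case (pair x y xs)
  let ?X = "comm_prod (map (\<lambda>i. monom [i] 1) xs) * monom w 1 :: 'k free"
  have "comm_prod (map (\<lambda>i. monom [i] 1) (x # y # xs)) * monom w 1 = monom [x, y] 1 * ?X - monom [y, x] 1 * ?X"
    using pair.hyps by (simp add: comm_prod_Cons_Cons commutator_def monom_mult left_diff_distrib mult.assoc[symmetric])
  then have "linear_extension \<phi> (comm_prod (map (\<lambda>i. monom [i] 1) (x # y # xs)) * monom w 1) =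
    linear_extension (\<lambda>v. \<phi> ([x, y] @ v) - \<phi> ([y, x] @ v)) ?X"
    by (simp only: linear_extension_diff linear_extension_prefix linear_extension_fun_diff mult_1)
  then show ?case
    using pair by (simp add: alternate_Cons_Cons)
qed (simp_all add: commutator_def left_diff_distrib right_diff_distrib monom_mult linear_extension_add linear_extension_diff mult.assoc[symmetric])

lemma alternate_cong:
  "(\<And>v. mset v = mset S + mset w \<Longrightarrow> \<phi> v = \<psi> v) \<Longrightarrow> alternate \<phi> S w = alternate \<psi> S w"
proof (induction S arbitrary: \<phi> \<psi> rule: pair_list_induct)
  case (pair x y xs)
  have "alternate (\<lambda>v. \<phi> (x # y # v) - \<phi> (y # x # v)) xs w = alternate (\<lambda>v. \<psi> (x # y # v) - \<psi> (y # x # v)) xs w"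
    by (rule pair.IH) (simp add: pair.prems)
  with pair.hyps show ?case by (simp add: alternate_Cons_Cons)
qed (simp_all)

lemma alternate_coef: "alternate (\<lambda>v. coef (F v) T) S w = coef (alternate F S w) T"
proof (induction S arbitrary: F rule: pair_list_induct)
  case (pair x y xs)
  then show ?case by (simp add: alternate_Cons_Cons flip: coef_simps)
qed simp_all

lemma coef_mult_empty: "coef (x * y) {} = coef x {} * coef y {}"
  by (simp add: coef_times)

lemma coef_lin_empty: "coef (lin n A) {} = 0"
  by (induction n) (simp_all add: coef_mult_empty coef_gen)

lemma coef_carry_empty: "coef (carry n A B) {} = 0"
  by (induction n) (simp_all add: coef_mult_empty coef_gen)

lemma coef_word_empty: "coef (word_exp n w) {} = 1" "coef (cubic n w) {} = 0"
  by (induction w) (simp_all add: coef_mult_empty coef_lin_empty coef_carry_empty word_exp.simps cubic.simps)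

text \<open>
  Each commutator contributes twice the product of its two generators and raises the parameter of
  \<open>word_ext_shifted\<close>. The second factor is a unit of the exterior algebra.
\<close>

lemma alternate_word_ext_shifted:
  assumes three: "(3 :: 'k::field) = 0" and S: "length S \<noteq> 1" "set S \<subseteq> {..<n}"
  shows "\<exists>R. alternate (\<lambda>v. c * word_ext_shifted n k v) S w = c * (prod_list (map gen S) * R) \<and> coef R {} \<noteq> (0 :: 'k)"
  using S
proof (induction S arbitrary: c k rule: pair_list_induct)
  case Nil
  show ?case by (rule exI[of _ "word_ext_shifted n k w"])
    (simp add: word_ext_shifted_def coef_mult_empty coef_word_empty coef_lin_empty)
next
  case (triple x y z)
  have "alternate (\<lambda>v. c * word_ext_shifted n k v) [x, y, z] w =
    c * (word_ext_shifted n k (x # y # z # w) - word_ext_shifted n k (y # x # z # w)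
      - word_ext_shifted n k (z # x # y # w) + word_ext_shifted n k (z # y # x # w))"
    by (simp add: algebra_simps)
  also have "\<dots> = c * (prod_list (map gen [x, y, z]) * word_exp n w)"
    using triple by (subst word_ext_shifted_triple[OF three_ext[OF three]]) (auto simp: mult.assoc)
  finally show ?case using coef_word_empty(1)[of n w] by (metis zero_neq_one)
next
  case (pair x y xs)
  have three': "(3 :: 'k ext) = 0" by (rule three_ext[OF three])
  define P where "P = (gen x * gen y :: 'k ext)"
  have "(\<lambda>v. c * word_ext_shifted n k (x # y # v) - c * word_ext_shifted n k (y # x # v)) =
    (\<lambda>v. (c * (P + P)) * word_ext_shifted n (Suc k) v)"
    using pair.prems unfolding right_diff_distrib[symmetric]
    by (auto simp: word_ext_shifted_commutator[OF three'] P_def algebra_simps)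
  moreover obtain R where R: "alternate (\<lambda>v. (c * (P + P)) * word_ext_shifted n (Suc k) v) xs w =
      (c * (P + P)) * (prod_list (map gen xs) * R)" "coef R {} \<noteq> 0"
    using pair by (metis set_subset_Cons subset_trans)
  moreover have "(c * (P + P)) * (prod_list (map gen xs) * R) = c * (prod_list (map gen (x # y # xs)) * (R + R))"
    by (simp add: P_def algebra_simps)
  moreover have "coef (R + R) {} \<noteq> 0"
  proof
    assume "coef (R + R) {} = 0"
    then have r: "coef R {} + coef R {} = 0" by simp
    have "coef R {} + coef R {} + coef R {} = 3 * coef R {}" by simp
    then have "coef R {} + coef R {} + coef R {} = 0" by (simp only: three mult_zero_left)
    with r R(2) show False by simp
  qed
  ultimately show ?case using pair.hyps by (auto simp: alternate_Cons_Cons)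
qed simp

lemma coef_gens_times:
  assumes "finite T" "distinct S"
  shows "\<not> set S \<subseteq> T \<Longrightarrow> coef (prod_list (map gen S) * R) T = 0"
    "set S = T \<Longrightarrow> coef R {} \<noteq> 0 \<Longrightarrow> coef (prod_list (map gen S) * R) T \<noteq> (0 :: 'k::field)"
proof -
  show "\<not> set S \<subseteq> T \<Longrightarrow> coef (prod_list (map gen S) * R) T = (0 :: 'k)"
    using assms
  proof (induction S arbitrary: T)
    case (Cons a S)
    then have "\<not> set S \<subseteq> T - {a}" if "a \<in> T" using that by auto
    with Cons show ?case by (auto simp: mult.assoc coef_gen_times)
  qed simp
  show "set S = T \<Longrightarrow> coef R {} \<noteq> 0 \<Longrightarrow> coef (prod_list (map gen S) * R) T \<noteq> (0 :: 'k)"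
    using assms
    by (induction S arbitrary: T) (auto simp: mult.assoc coef_gen_times)
qed

text \<open>
  The value of \<open>word_ext\<close> at \<open>C\<^sub>S w\<close> is a multiple of the product of the generators in \<open>S\<close>, so
  the coefficients at sets that do not contain \<open>S\<close> are 0.
\<close>

lemma pbw_functional_triangular:
  assumes three: "(3 :: 'k::field) = 0" and S: "length S \<noteq> 1" "set S \<subseteq> {..<n}" "distinct S"
    and M: "mset S + mset w = M" and T: "finite T"
  defines "x \<equiv> linear_extension (pbw_functional n M T) (comm_prod (map (\<lambda>i. monom [i] 1) S) * monom w 1)"
  shows "\<not> set S \<subseteq> T \<Longrightarrow> x = (0 :: 'k)" "set S = T \<Longrightarrow> x \<noteq> 0"
proof -
  obtain R where R: "alternate (\<lambda>v. 1 * word_ext_shifted n 0 v) S w = 1 * (prod_list (map gen S) * R)" "coef R {} \<noteq> (0 :: 'k)"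
    using alternate_word_ext_shifted[OF three S(1,2)] by blast
  have w: "(\<lambda>v. 1 * word_ext_shifted n 0 v :: 'k ext) = word_ext n"
    by (auto simp: word_ext_shifted_def word_ext_def distrib_left)
  have "x = alternate (pbw_functional n M T) S w" unfolding x_def by (rule linear_extension_comm_prod)
  also have "\<dots> = alternate (\<lambda>v. coef (word_ext n v) T) S w"
    by (rule alternate_cong) (simp add: pbw_functional_def M)
  also have "\<dots> = coef (prod_list (map gen S) * R) T"
    unfolding alternate_coef R(1)[unfolded w] by simp
  finally have x: "x = coef (prod_list (map gen S) * R) T" .
  show "\<not> set S \<subseteq> T \<Longrightarrow> x = 0" "set S = T \<Longrightarrow> x \<noteq> 0"
    unfolding x using coef_gens_times[OF T S(3)] R(2) by auto
qed

section \<open>Commutators in 2-Engel rings of characteristic 3\<close>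

text \<open>
  In characteristic 3 the second assumption says \<open>[a, [a, b]] = 0\<close>.
\<close>

locale engel_ring =
  fixes ring_type :: "'a::ring_1 itself"
  assumes three: "(3 :: 'a) = 0" and engel: "engel_form a (b :: 'a) = 0"
begin

abbreviation triple :: "'a \<Rightarrow> 'a \<Rightarrow> 'a \<Rightarrow> 'a" where
  "triple x y z \<equiv> commutator (commutator x y) z"

lemma triple_mod_3: "x + x + x = (0 :: 'a)"
  by (rule three_times[OF three])

lemma double_eq: "x + x = - (x :: 'a)"
  using minus_eq_double[OF three, of x] by simp

lemma double_zero: "x + x = 0 \<Longrightarrow> x = (0 :: 'a)"
  by (simp add: double_eq)

lemma eq_minus_self: "x = - x \<Longrightarrow> x = (0 :: 'a)"
  using double_zero[of x] by (simp add: eq_neg_iff_add_eq_0)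

lemma commutator_swap: "commutator x y = - commutator y (x :: 'a)"
  by (simp add: commutator_def)

lemma commutator_add: "commutator (x + y) z = commutator x z + commutator y (z :: 'a)"
  "commutator x (y + z) = commutator x y + commutator x (z :: 'a)"
  by (simp_all add: commutator_def algebra_simps)

lemma commutator_minus: "commutator (- x) z = - commutator x (z :: 'a)"
  "commutator z (- x) = - commutator z (x :: 'a)"
  by (simp_all add: commutator_def)

lemma commutator_mult: "commutator (x * y) z = x * commutator y z + commutator x z * (y :: 'a)"
  "commutator z (x * y) = x * commutator z y + commutator z x * (y :: 'a)"
  by (simp_all add: commutator_def algebra_simps)

lemma commutator_zero_iff: "commutator x y = 0 \<longleftrightarrow> x * y = y * (x :: 'a)"
  by (simp add: commutator_def)

lemma triple_last_equal: "triple x y y = (0 :: 'a)"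
proof -
  have "triple x y y = engel_form y x - (y * x * y + y * x * y + y * x * y)"
    by (simp add: commutator_def engel_form_def algebra_simps)
  then show ?thesis by (simp only: engel triple_mod_3 diff_self)
qed

lemma triple_swap_last: "triple x y z = - triple x z (y :: 'a)"
proof -
  have "triple x (y + z) (y + z) = 0" by (rule triple_last_equal)
  then show ?thesis by (simp add: commutator_add triple_last_equal eq_neg_iff_add_eq_0 add.commute)
qed

lemma triple_swap_first: "triple x y z = - triple y x (z :: 'a)"
  by (simp add: commutator_swap[of x y] commutator_minus)

lemma triple_first_equal: "triple x y x = (0 :: 'a)"
  using triple_swap_first[of x y x] triple_last_equal[of y x] by simp

text \<open>
  Expand \<open>[[x y, z], z] = 0\<close>: the product in question occurs twice, the other terms are 0.
\<close>

lemma commutator_mult_last_equal: "commutator x z * commutator y z = (0 :: 'a)"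
proof -
  have "triple (x * y) z z = x * triple y z z + commutator x z * commutator y z
      + (commutator x z * commutator y z + triple x z z * y)"
    by (simp add: commutator_mult commutator_add)
  then have "commutator x z * commutator y z + commutator x z * commutator y z = 0"
    by (simp add: triple_last_equal)
  then show ?thesis by (rule double_zero)
qed

lemma commutator_mult_swap: "commutator x z * commutator y w = - (commutator x w * commutator y (z :: 'a))"
proof -
  have "commutator x (z + w) * commutator y (z + w) = 0" by (rule commutator_mult_last_equal)
  then show ?thesis
    by (simp add: commutator_add distrib_left distrib_right commutator_mult_last_equal eq_neg_iff_add_eq_0 add.commute)
qed

lemma commutator_mult_swap_inner: "commutator a x * commutator y b = - (commutator a y * commutator x (b :: 'a))"
  using commutator_mult_swap[of a x b y] commutator_swap[of y b] commutator_swap[of x b] by simp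

text \<open>
  The form \<open>g\<close> is alternating in its four arguments. Written by the Jacobi identity,
  \<open>[[x, y], [z, t]]\<close> is \<open>2 g(x, y, z, t)\<close>; exchanging the two inner commutators is an even
  permutation of the arguments of \<open>g\<close> but changes the sign of the left-hand side.
\<close>

lemma triple_central: "triple x y z * t = t * triple x y (z :: 'a)"
proof -
  define g where "g a b c d = commutator (triple a b c) d" for a b c d :: 'a
  have g12: "g a b c d = - g b a c d" for a b c d
    unfolding g_def by (subst triple_swap_first) (simp add: commutator_minus)
  have g23: "g a b c d = - g a c b d" for a b c d
    unfolding g_def by (subst triple_swap_last) (simp add: commutator_minus)
  have g34: "g a b c d = - g a b d c" for a b c d
    unfolding g_def by (rule triple_swap_last)
  have jac: "commutator (commutator a b) (commutator c d) = g a b c d + g a b c d" for a b c d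
  proof -
    have "commutator (commutator a b) (commutator c d) = g a b c d - g a b d c"
      unfolding g_def by (simp add: commutator_def algebra_simps)
    then show ?thesis using g34[of a b d c] by simp
  qed
  have "g x y z t = g z x y t"
    using g12[of x z y t] g23[of x y z t] by simp
  also have "\<dots> = g z t x y"
    using g23[of z t x y] g34[of z x y t] by simp
  finally have "g x y z t = g z t x y" .
  moreover have "g z t x y + g z t x y = - (g x y z t + g x y z t)"
    unfolding jac[symmetric] by (rule commutator_swap)
  ultimately have "g x y z t + g x y z t = - (g x y z t + g x y z t)" by simp
  then have "g x y z t + g x y z t = 0" by (rule eq_minus_self)
  then have "g x y z t = 0" by (rule double_zero)
  then show ?thesis by (simp add: g_def commutator_zero_iff)
qed

lemma triple_left_commute: "t * (triple x y z * s) = triple x y z * (t * (s :: 'a))"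
  by (simp add: triple_central[of x y z] mult.assoc)

lemma triple_zero: "commutator (triple x y z) t = (0 :: 'a)"
  by (simp add: commutator_zero_iff triple_central)

text \<open>
  The two cross terms cancel, so a triple commutator is a derivation in its first argument; by
  symmetry it is one in each argument.
\<close>

lemma triple_mult: "triple (x * y) z w = x * triple y z w + triple x z w * (y :: 'a)"
proof -
  have "triple (x * y) z w = x * triple y z w + commutator x w * commutator y z
      + (commutator x z * commutator y w + triple x z w * y)"
    by (simp add: commutator_mult commutator_add)
  then show ?thesis using commutator_mult_swap[of x w y z] by simp
qed

text \<open>
  Expand the commutator of \<open>t\<close> with \<open>triple (x * y) z w\<close>, which is 0.
\<close>

lemma triple_commutator_swap: "triple y z w * commutator x t = - (triple x z w * commutator y (t :: 'a))"
proof -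
  have "0 = commutator (triple (x * y) z w) t" by (simp add: triple_zero)
  also have "\<dots> = commutator x t * triple y z w + triple x z w * commutator y t"
    by (subst triple_mult) (simp add: commutator_add commutator_mult triple_zero)
  finally show ?thesis
    by (simp add: triple_central[symmetric] eq_neg_iff_add_eq_0 add.commute)
qed

lemma triple_triple: "triple x y z * triple a b c = (0 :: 'a)"
proof -
  have "triple x y z * triple a b c = - (triple (commutator a b) y z * commutator x c)"
    by (rule triple_commutator_swap)
  moreover have "triple (commutator a b) y z = 0" by (simp add: triple_zero)
  ultimately show ?thesis by simp
qed

lemma commutator_square: "commutator (x * x) y = - (x * commutator x (y :: 'a))"
proof -
  have "commutator x y * x = x * commutator x y"
    using triple_first_equal[of x y] by (simp add: commutator_zero_iff)
  then show ?thesis by (simp add: commutator_mult double_eq)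
qed

lemma triple_square: "triple (x * x) y z = - (x * triple x y (z :: 'a))"
  by (simp add: triple_mult triple_central double_eq)

text \<open>
  The swap takes place inside a commutator, between two commutators, or inside or at the border of the
  triple commutator.
\<close>

lemma comm_prod_swap: "comm_prod (us @ x # y # vs) = - comm_prod (us @ y # x # (vs :: 'a list))"
proof (induction us rule: induct_list012)
  case 1
  show ?case
  proof (cases "length vs = 1")
    case True
    then obtain z where "vs = [z]" by (auto simp: length_Suc_conv)
    then show ?thesis using triple_swap_first[of x y z] by simp
  qed (use commutator_swap[of x y] in \<open>simp add: comm_prod_Cons_Cons\<close>)
next
  case (2 a)
  show ?case
  proof (cases vs)
    case Nil
    then show ?thesis using triple_swap_last[of a x y] by simp
  next
    case vs: (Cons b vs')
    show ?thesis
    proof (cases "length vs' = 1")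
      case True
      then obtain c where c: "vs' = [c]" by (auto simp: length_Suc_conv)
      have "commutator a x * triple y b c = - (commutator a y * triple x b c)"
        using triple_commutator_swap[of y b c x a] commutator_swap[of a x] commutator_swap[of a y]
        by (simp add: triple_central)
      then show ?thesis by (simp add: vs c comm_prod_Cons_Cons)
    next
      case False
      then show ?thesis using commutator_mult_swap_inner[of a x y b]
        by (simp add: vs comm_prod_Cons_Cons mult.assoc[symmetric])
    qed
  qed
next
  case (3 a b us)
  then show ?case by (simp add: comm_prod_Cons_Cons)
qed

end

section \<open>Sorting words modulo shorter words\<close>

text \<open>
  Spanning statements below say that every additive subgroup that contains the given words contains
  all words. In this form they can be pulled back along multiplication by a fixed element
  (\<open>additive_subgroup_vimage_mult\<close>), which is how prefixes of words are treated.
\<close>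

definition additive_subgroup :: "'a::ring_1 set \<Rightarrow> bool" where
  "additive_subgroup U \<longleftrightarrow> 0 \<in> U \<and> (\<forall>x\<in>U. \<forall>y\<in>U. x - y \<in> U)"

lemma additive_subgroupD:
  assumes "additive_subgroup U"
  shows "0 \<in> U" "x \<in> U \<Longrightarrow> y \<in> U \<Longrightarrow> x - y \<in> U" "x \<in> U \<Longrightarrow> - x \<in> U" "x \<in> U \<Longrightarrow> y \<in> U \<Longrightarrow> x + y \<in> U"
proof -
  show 0: "0 \<in> U" and d: "x \<in> U \<Longrightarrow> y \<in> U \<Longrightarrow> x - y \<in> U" for x y
    using assms by (auto simp: additive_subgroup_def)
  show m: "x \<in> U \<Longrightarrow> - x \<in> U" for x using d[OF 0, of x] by simp
  show "x \<in> U \<Longrightarrow> y \<in> U \<Longrightarrow> x + y \<in> U" using d[OF _ m, of x y] by simp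
qed

lemma additive_subgroup_diff_iff:
  "additive_subgroup U \<Longrightarrow> x - y \<in> U \<Longrightarrow> y \<in> U \<Longrightarrow> x \<in> U"
  using additive_subgroupD(4)[of U "x - y" y] by simp

lemma additive_subgroup_vimage_mult: "additive_subgroup U \<Longrightarrow> additive_subgroup {z. g * z \<in> U}"
  by (simp add: additive_subgroup_def right_diff_distrib)

definition val :: "(nat \<Rightarrow> 'a::ring_1) \<Rightarrow> nat list \<Rightarrow> 'a" where
  "val y w = prod_list (map y w)"

lemma val_simps [simp]: "val y [] = 1" "val y (x # w) = y x * val y w" "val y (u @ v) = val y u * val y v"
  by (simp_all add: val_def)

text \<open>
  The element \<open>u C\<^sub>S\<close>.
\<close>

definition pbw :: "(nat \<Rightarrow> 'a::ring_1) \<Rightarrow> nat list \<Rightarrow> nat list \<Rightarrow> 'a" where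
  "pbw y u S = val y u * comm_prod (map y S)"

text \<open>
  Permutations are products of transpositions of neighbours.
\<close>

lemma permutation_via_swaps:
  assumes refl: "\<And>xs. R xs xs" and trans: "\<And>xs ys zs. R xs ys \<Longrightarrow> R ys zs \<Longrightarrow> R xs zs"
    and swap: "\<And>us x y vs. R (us @ x # y # vs) (us @ y # x # vs)"
    and perm: "mset xs = mset ys"
  shows "R xs ys"
proof -
  have move: "R (ps @ x # us @ vs) (ps @ us @ x # vs)" for ps us vs :: "'a list" and x
  proof (induction us arbitrary: ps)
    case (Cons u us)
    have "R (ps @ x # u # us @ vs) (ps @ u # x # us @ vs)" by (rule swap)
    moreover have "R (ps @ u # x # us @ vs) (ps @ u # us @ x # vs)" using Cons.IH[of "ps @ [u]"] by simp
    ultimately show ?case using trans by fastforce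
  qed (simp add: refl)
  have "R (ps @ xs) (ps @ ys)" for ps
    using perm
  proof (induction xs arbitrary: ys ps)
    case (Cons x xs)
    then have "x \<in> set ys" by (metis list.set_intros(1) mset_eq_setD)
    then obtain us vs where ys: "ys = us @ x # vs" by (auto dest: split_list)
    with Cons.prems have "mset xs = mset (us @ vs)" by simp
    from Cons.IH[OF this, of "ps @ [x]"] have "R (ps @ x # xs) (ps @ x # us @ vs)" by simp
    then have "R (ps @ x # xs) (ps @ us @ x # vs)" by (rule trans[OF _ move])
    then show ?case by (simp add: ys)
  qed (simp add: refl)
  from this[of "[]"] show ?thesis by simp
qed

context engel_ring
begin

lemma comm_prod_perm:
  assumes "mset xs = mset ys"
  shows "comm_prod xs = comm_prod ys \<or> comm_prod xs = - comm_prod (ys :: 'a list)"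
proof (rule permutation_via_swaps[OF _ _ _ assms])
  fix us x y and vs :: "'a list"
  show "comm_prod (us @ x # y # vs) = comm_prod (us @ y # x # vs) \<or> comm_prod (us @ x # y # vs) = - comm_prod (us @ y # x # vs)"
    by (rule disjI2) (rule comm_prod_swap)
qed auto

lemma comm_prod_not_distinct:
  assumes "\<not> distinct xs"
  shows "comm_prod xs = (0 :: 'a)"
proof -
  obtain us vs ws x where xs: "xs = us @ [x] @ vs @ [x] @ ws"
    using not_distinct_decomp[OF assms] by blast
  have "comm_prod ([] @ x # x # us @ vs @ ws) = - comm_prod ([] @ x # x # us @ vs @ ws)"
    by (rule comm_prod_swap)
  then have "comm_prod (x # x # us @ vs @ ws) = 0" by (simp only: append_Nil) (rule eq_minus_self)
  moreover have "mset xs = mset (x # x # us @ vs @ ws)" by (simp add: xs)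
  ultimately show ?thesis using comm_prod_perm by fastforce
qed

text \<open>
  For odd length the list ends with a triple commutator, and the product of two of these is 0.
\<close>

lemma triple_comm_prod:
  "triple a b c * comm_prod xs = (if even (length xs) then comm_prod (xs @ [a, b, c]) else (0 :: 'a))"
proof (induction xs rule: pair_list_induct)
  case (triple x y z)
  show ?case using triple_triple by simp
next
  case (pair x y xs)
  have "triple a b c * comm_prod (x # y # xs) = commutator x y * (triple a b c * comm_prod xs)"
    using pair.hyps by (simp add: comm_prod_Cons_Cons triple_left_commute)
  then show ?case using pair.IH by (simp add: comm_prod_Cons_Cons)
qed simp_all

lemma pbw_perm:
  assumes "additive_subgroup U" "mset S = mset S'" "pbw y u S \<in> U"
  shows "pbw y u S' \<in> (U :: 'a set)"
  using comm_prod_perm[of "map y S'" "map y S"] assms(2,3) additive_subgroupD(3)[OF assms(1)]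
  by (auto simp: pbw_def)

lemma pbw_degenerate:
  "\<not> distinct S \<Longrightarrow> pbw y u S = (0 :: 'a)" "length S = 1 \<Longrightarrow> pbw y u S = (0 :: 'a)"
  by (auto simp: pbw_def comm_prod_not_distinct distinct_map length_Suc_conv)

lemma expand_in:
  assumes U: "additive_subgroup U"
    and words: "\<And>w. mset w = mset u + mset S + mset v \<Longrightarrow> val y w \<in> (U :: 'a set)"
  shows "val y u * (comm_prod (map y S) * val y v) \<in> U"
  using words
proof (induction S arbitrary: u rule: pair_list_induct)
  case Nil
  from Nil[of "u @ v"] show ?case by simp
next
  case (single x)
  show ?case using additive_subgroupD(1)[OF U] by simp
next
  case (triple a b c)
  have "val y (u @ [a, b, c] @ v) - val y (u @ [b, a, c] @ v) - (val y (u @ [c, a, b] @ v) - val y (u @ [c, b, a] @ v)) \<in> U"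
    by (intro additive_subgroupD(2)[OF U]; rule triple) simp_all
  then show ?case by (simp add: commutator_def algebra_simps)
next
  case (pair a b xs)
  have "val y (u @ [a, b]) * (comm_prod (map y xs) * val y v) - val y (u @ [b, a]) * (comm_prod (map y xs) * val y v) \<in> U"
    by (intro additive_subgroupD(2)[OF U] pair.IH; rule pair.prems) simp_all
  then show ?case using pair.hyps by (simp add: comm_prod_Cons_Cons commutator_def algebra_simps)
qed

lemma expand_pbw_in:
  assumes U: "additive_subgroup U"
    and words: "\<And>w. mset w = mset u + mset S \<Longrightarrow> val y w \<in> (U :: 'a set)"
  shows "pbw y u S \<in> U"
  using expand_in[OF U, of u S "[]" y] words by (simp add: pbw_def)

lemma commutator_comm_prod:
  assumes "additive_subgroup U" "length S \<noteq> 1 \<Longrightarrow> pbw y u (a # b # S) \<in> U"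
  shows "val y u * (commutator (y a) (y b) * comm_prod (map y S)) \<in> (U :: 'a set)"
proof (cases "length S = 1")
  case True
  then show ?thesis using additive_subgroupD(1)[OF assms(1)] by (auto simp: length_Suc_conv)
next
  case False
  then show ?thesis using assms(2) by (simp add: pbw_def comm_prod_Cons_Cons)
qed

text \<open>
  Moving a commutator to the right past one letter produces a triple commutator, which is central and
  joins \<open>C\<^sub>S\<close>; the word that is left has lost that letter.
\<close>

lemma commutator_shift:
  assumes U: "additive_subgroup (U :: 'a set)"
    and short: "\<And>u S. mset u + mset S = M \<Longrightarrow> length u < n \<Longrightarrow> pbw y u S \<in> U"
    and M: "mset us + mset vs + {#a, b#} + mset S = M"
    and n: "length us + length vs \<le> n"
  shows "val y us * (commutator (y a) (y b) * (val y vs * comm_prod (map y S))) -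
    val y (us @ vs) * (commutator (y a) (y b) * comm_prod (map y S)) \<in> U"
  using M n
proof (induction vs arbitrary: us)
  case Nil
  show ?case using additive_subgroupD(1)[OF U] by simp
next
  case (Cons z vs)
  let ?c = "commutator (y a) (y b)" and ?t = "triple (y a) (y b) (y z)" and ?C = "comm_prod (map y S)"
  have "pbw y (us @ vs) (S @ [a, b, z]) \<in> U"
    using Cons.prems by (intro short) (simp_all add: add_ac add_mset_commute)
  then have t: "val y us * (?t * (val y vs * ?C)) \<in> U"
    using triple_comm_prod[of "y a" "y b" "y z" "map y S"] additive_subgroupD(1)[OF U]
    by (cases "even (length S)") (simp_all add: pbw_def triple_left_commute[symmetric] mult.assoc)
  have IH: "val y (us @ [z]) * (?c * (val y vs * ?C)) - val y ((us @ [z]) @ vs) * (?c * ?C) \<in> U"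
    by (rule Cons.IH) (use Cons.prems in \<open>simp_all add: add_ac\<close>)
  have "?c * (y z * X) = y z * (?c * X) + ?t * X" for X
    by (simp add: commutator_def algebra_simps)
  then have "val y us * (?c * (val y (z # vs) * ?C)) - val y (us @ z # vs) * (?c * ?C) =
    val y us * (?t * (val y vs * ?C)) + (val y (us @ [z]) * (?c * (val y vs * ?C)) - val y ((us @ [z]) @ vs) * (?c * ?C))"
    by (simp add: mult.assoc distrib_left)
  then show ?case using additive_subgroupD(4)[OF U t IH] by (simp add: add_diff_eq)
qed

text \<open>
  Swapping two neighbouring letters of \<open>u\<close> produces their commutator, and \<open>commutator_shift\<close>
  moves it to \<open>C\<^sub>S\<close>, leaving a word with two letters less.
\<close>

lemma reorder:
  assumes U: "additive_subgroup (U :: 'a set)"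
    and short: "\<And>u S. mset u + mset S = M \<Longrightarrow> length u < n \<Longrightarrow> pbw y u S \<in> U"
    and M: "mset u + mset S = M" and n: "length u \<le> n"
    and v: "mset u = mset v" "pbw y v S \<in> U"
  shows "pbw y u S \<in> U"
proof -
  have "mset u + mset S = M \<longrightarrow> length u \<le> n \<longrightarrow> mset u = mset v \<and> pbw y u S - pbw y v S \<in> U"
  proof (rule permutation_via_swaps[OF _ _ _ v(1)])
    fix us vs x z
    show "mset (us @ x # z # vs) + mset S = M \<longrightarrow> length (us @ x # z # vs) \<le> n \<longrightarrow>
      mset (us @ x # z # vs) = mset (us @ z # x # vs) \<and> pbw y (us @ x # z # vs) S - pbw y (us @ z # x # vs) S \<in> U"
    proof (intro impI conjI)
      let ?c = "commutator (y x) (y z)" and ?C = "comm_prod (map y S)"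
      assume M: "mset (us @ x # z # vs) + mset S = M" and n: "length (us @ x # z # vs) \<le> n"
      have "val y us * (?c * (val y vs * ?C)) - val y (us @ vs) * (?c * ?C) \<in> U"
        by (rule commutator_shift[OF U short]) (use M n in \<open>auto simp: add_ac\<close>)
      moreover have "val y (us @ vs) * (?c * ?C) \<in> U"
        by (rule commutator_comm_prod[OF U], rule short) (use M n in \<open>auto simp: add_ac\<close>)
      ultimately have "val y us * (?c * (val y vs * ?C)) \<in> U" by (rule additive_subgroup_diff_iff[OF U])
      then show "pbw y (us @ x # z # vs) S - pbw y (us @ z # x # vs) S \<in> U"
        by (simp add: pbw_def commutator_def algebra_simps)
    qed simp
  next
    fix xs ys zs
    assume "mset xs + mset S = M \<longrightarrow> length xs \<le> n \<longrightarrow> mset xs = mset ys \<and> pbw y xs S - pbw y ys S \<in> U"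
      "mset ys + mset S = M \<longrightarrow> length ys \<le> n \<longrightarrow> mset ys = mset zs \<and> pbw y ys S - pbw y zs S \<in> U"
    then show "mset xs + mset S = M \<longrightarrow> length xs \<le> n \<longrightarrow> mset xs = mset zs \<and> pbw y xs S - pbw y zs S \<in> U"
      using additive_subgroupD(4)[OF U, of "pbw y xs S - pbw y ys S" "pbw y ys S - pbw y zs S"] mset_eq_length[of xs ys]
      by auto
  qed (use additive_subgroupD(1)[OF U] in auto)
  with M n have "pbw y u S - pbw y v S \<in> U" by blast
  then show ?thesis using v(2) by (rule additive_subgroup_diff_iff[OF U])
qed

text \<open>
  Words are the elements \<open>u C\<^sub>S\<close> with empty \<open>S\<close>. Induction on the length of \<open>u\<close> is the frame
  of all spanning arguments; the premise of \<open>step\<close> about shorter words is the induction hypothesis.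
\<close>

lemma words_from_pbw:
  assumes U: "additive_subgroup (U :: 'a set)"
    and step: "\<And>u S. \<lbrakk>mset u + mset S = M; distinct S; length S \<noteq> 1;
      \<And>u' S'. mset u' + mset S' = M \<Longrightarrow> length u' < length u \<Longrightarrow> pbw y u' S' \<in> U\<rbrakk> \<Longrightarrow> pbw y u S \<in> U"
    and w: "mset w = M"
  shows "val y w \<in> U"
proof -
  have "pbw y u S \<in> U" if "mset u + mset S = M" for u S
    using that
  proof (induction "length u" arbitrary: u S rule: less_induct)
    case less
    show ?case
      by (cases "distinct S \<and> length S \<noteq> 1")
        (use less step[of u S] pbw_degenerate additive_subgroupD(1)[OF U] in auto)
  qed
  from this[of w "[]"] w show ?thesis by (simp add: pbw_def)
qed

text \<open>
  The value of a product in which letters and commutators of two letters alternate arbitrarily.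
\<close>

primrec mixed_val :: "(nat \<Rightarrow> 'a) \<Rightarrow> (nat + nat \<times> nat) list \<Rightarrow> 'a" where
  "mixed_val y [] = 1"
| "mixed_val y (t # ts) = (case t of Inl i \<Rightarrow> y i | Inr (a, b) \<Rightarrow> commutator (y a) (y b)) * mixed_val y ts"

end

primrec letters :: "(nat + nat \<times> nat) list \<Rightarrow> nat list" where
  "letters [] = []"
| "letters (t # ts) = (case t of Inl i \<Rightarrow> i # letters ts | Inr (a, b) \<Rightarrow> letters ts)"

primrec pairs :: "(nat + nat \<times> nat) list \<Rightarrow> nat list" where
  "pairs [] = []"
| "pairs (t # ts) = (case t of Inl i \<Rightarrow> pairs ts | Inr (a, b) \<Rightarrow> a # b # pairs ts)"

lemma even_pairs: "even (length (pairs ts))"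
  by (induction ts) (auto split: sum.split)

lemma letters_pairs_append: "letters (s @ t) = letters s @ letters t" "pairs (s @ t) = pairs s @ pairs t"
  by (induction s) (auto split: sum.split)

lemma letters_pairs_Inl: "letters (map Inl w) = w" "pairs (map Inl w) = []"
  by (induction w) auto

context engel_ring
begin

lemma mixed_val_append: "mixed_val y (s @ t) = mixed_val y s * (mixed_val y t :: 'a)"
  by (induction s) (auto simp: mult.assoc)

lemma mixed_val_Inl: "mixed_val y (map Inl w) = (val y w :: 'a)"
  by (induction w) auto

text \<open>
  Modulo shorter words, all commutators of a mixed product can be moved to the right end.
\<close>

lemma mixed_collect:
  assumes "additive_subgroup (U :: 'a set)"
    and "\<And>u S. mset u + mset S = M \<Longrightarrow> length u < length (letters t) \<Longrightarrow> pbw y u S \<in> U"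
    and "mset (letters t) + mset (pairs t) + mset S = M" "length S \<noteq> 1"
  shows "mixed_val y t * comm_prod (map y S) - pbw y (letters t) (pairs t @ S) \<in> U"
  using assms
proof (induction t arbitrary: U M)
  case Nil
  then show ?case by (simp add: pbw_def additive_subgroupD)
next
  case (Cons tok t)
  note U = Cons.prems(1) and short = Cons.prems(2)
  show ?case
  proof (cases tok)
    case (Inl i)
    have "mixed_val y t * comm_prod (map y S) - pbw y (letters t) (pairs t @ S) \<in> {z. y i * z \<in> U}"
    proof (rule Cons.IH[OF additive_subgroup_vimage_mult[OF U]])
      fix u S' assume "mset u + mset S' = M - {#i#}" "length u < length (letters t)"
      then have "pbw y (i # u) S' \<in> U"
        using Cons.prems(3) Inl by (intro short) auto
      then show "pbw y u S' \<in> {z. y i * z \<in> U}" by (simp add: pbw_def mult.assoc)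
    qed (use Cons.prems(3,4) Inl in auto)
    then show ?thesis by (simp add: Inl pbw_def algebra_simps)
  next
    case (Inr p)
    obtain a b where p: "p = (a, b)" by fastforce
    let ?c = "commutator (y a) (y b)"
    have M: "M = {#a, b#} + (mset (letters t) + mset (pairs t) + mset S)"
      using Cons.prems(3) Inr p by (simp add: add_ac)
    have shift: "?c * pbw y u S' - val y u * (?c * comm_prod (map y S')) \<in> U"
      if "mset u + mset S' = mset (letters t) + mset (pairs t) + mset S" "length u \<le> length (letters t)" for u S'
      using commutator_shift[OF U short, where us = "[]" and vs = u and a = a and b = b and S = S'] that M Inr p by (auto simp: pbw_def add_ac)
    have "mixed_val y t * comm_prod (map y S) - pbw y (letters t) (pairs t @ S) \<in> {z. ?c * z \<in> U}"
    proof (rule Cons.IH[OF additive_subgroup_vimage_mult[OF U] _ refl Cons.prems(4)])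
      fix u S' assume u: "mset u + mset S' = mset (letters t) + mset (pairs t) + mset S" "length u < length (letters t)"
      have "val y u * (?c * comm_prod (map y S')) \<in> U"
        by (rule commutator_comm_prod[OF U], rule short) (use u M Inr p in \<open>auto simp: add_ac\<close>)
      then show "pbw y u S' \<in> {z. ?c * z \<in> U}"
        using additive_subgroup_diff_iff[OF U shift[OF u(1)]] u(2) by simp
    qed
    then have 1: "?c * (mixed_val y t * comm_prod (map y S)) - ?c * pbw y (letters t) (pairs t @ S) \<in> U"
      by (simp add: algebra_simps)
    have 2: "?c * pbw y (letters t) (pairs t @ S) - val y (letters t) * (?c * comm_prod (map y (pairs t @ S))) \<in> U"
      by (rule shift) (simp_all add: add_ac)
    have "length (pairs t @ S) \<noteq> 1"
      using even_pairs[of t] Cons.prems(4) by (cases "length (pairs t)") (auto simp: even_Suc)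
    then have 3: "val y (letters t) * (?c * comm_prod (map y (pairs t @ S))) = pbw y (letters t) (a # b # pairs t @ S)"
      by (simp add: pbw_def comm_prod_Cons_Cons del: map_append)
    show ?thesis using additive_subgroupD(4)[OF U 1 2] unfolding 3 by (simp add: Inr p mult.assoc)
  qed
qed

text \<open>
  If the letter \<open>i\<close> occurs twice in \<open>u\<close>, its occurrences can be made neighbours. If it occurs once
  in \<open>u\<close> and once in \<open>S\<close>, it can be moved next to \<open>C\<^sub>S\<close>, and \<open>x C(x, \<dots>) = - C(x\<^sup>2, \<dots>)\<close>.
\<close>

lemma square_letter:
  assumes U: "additive_subgroup (U :: 'a set)" and i: "i \<notin># M"
    and words: "\<And>w. mset w = M + {#i#} \<Longrightarrow> val (y(i := y i * y i)) w \<in> U"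
    and w: "mset w = M + {#i, i#}"
  shows "val y w \<in> U"
proof (rule words_from_pbw[OF U _ w])
  let ?y = "y(i := y i * y i)"
  fix u S
  assume M: "mset u + mset S = M + {#i, i#}" and S: "distinct S" "length S \<noteq> 1"
    and short: "\<And>u' S'. mset u' + mset S' = M + {#i, i#} \<Longrightarrow> length u' < length u \<Longrightarrow> pbw y u' S' \<in> U"
  have same: "val ?y v = val y v" if "i \<notin> set v" for v
    using that by (induction v) auto
  have same': "map ?y v = map y v" if "i \<notin> set v" for v
    using that by auto
  have cM: "count M i = 0" using i by (simp add: not_in_iff)
  have cnt: "count (mset u) i + count (mset S) i = 2"
    using arg_cong[OF M, of "\<lambda>m. count m i"] cM by simp
  show "pbw y u S \<in> U"
  proof (cases "i \<in> set S")
    case False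
    then have "count (mset u) i = 2" using cnt by (simp add: count_eq_zero_iff[THEN iffD2])
    define v where "v = filter (\<lambda>j. j \<noteq> i) u"
    have u: "mset u = mset (i # i # v)"
      by (rule multiset_eqI) (use \<open>count (mset u) i = 2\<close> in \<open>auto simp: v_def mset_filter\<close>)
    have v: "i \<notin> set v" by (simp add: v_def)
    have "pbw ?y (i # v) S \<in> U"
      by (rule expand_pbw_in[OF U], rule words) (use M u in auto)
    then have "pbw y (i # i # v) S \<in> U"
      using False v by (simp add: pbw_def same same' mult.assoc del: map_fun_upd)
    then show ?thesis by (intro reorder[OF U short M _ u]) auto
  next
    case True
    then have "count (mset S) i = 1" using S(1) by (simp add: distinct_count_atmost_1)
    then have "count (mset u) i = 1" using cnt by simp
    define v T where "v = filter (\<lambda>j. j \<noteq> i) u" and "T = filter (\<lambda>j. j \<noteq> i) S"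
    have u: "mset u = mset (v @ [i])"
      by (rule multiset_eqI) (use \<open>count (mset u) i = 1\<close> in \<open>auto simp: v_def mset_filter\<close>)
    have S': "mset (i # T) = mset S"
      by (rule multiset_eqI) (use \<open>count (mset S) i = 1\<close> in \<open>auto simp: T_def mset_filter\<close>)
    have vT: "i \<notin> set v" "i \<notin> set T" by (simp_all add: v_def T_def)
    have T: "T \<noteq> []" using S' S(2) by (metis One_nat_def length_Cons list.size(3) mset_eq_length)
    have sq: "y i * comm_prod (y i # xs) = - comm_prod ((y i * y i) # xs)" if "xs \<noteq> []" for xs
    proof -
      from that obtain a xs' where xs: "xs = a # xs'" by (cases xs) auto
      show ?thesis
      proof (cases "length xs' = 1")
        case True
        then obtain b where "xs' = [b]" by (auto simp: length_Suc_conv)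
        then show ?thesis by (simp add: xs triple_square)
      next
        case False
        then show ?thesis by (simp add: xs comm_prod_Cons_Cons commutator_square mult.assoc)
      qed
    qed
    have "pbw ?y v (i # T) \<in> U"
      by (rule expand_pbw_in[OF U], rule words) (use M u S'[symmetric] in \<open>auto simp: add_ac\<close>)
    then have "- pbw ?y v (i # T) \<in> U" by (rule additive_subgroupD(3)[OF U])
    also have "- pbw ?y v (i # T) = pbw y (v @ [i]) (i # T)"
      using vT T by (simp add: pbw_def same same' mult.assoc sq del: map_fun_upd)
    finally have "pbw y (v @ [i]) (i # T) \<in> U" .
    then have "pbw y (v @ [i]) S \<in> U" by (rule pbw_perm[OF U S'])
    then show ?thesis by (intro reorder[OF U short M _ u]) auto
  qed
qed

end

section \<open>Spanning the multilinear component\<close>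

lemma mset_extract: "x \<in> set xs \<Longrightarrow> \<exists>ys. mset xs = mset (x # ys)"
  using mset_remove1[of x xs] by (intro exI[of _ "remove1 x xs"]) simp

lemma map_eq_permuted:
  "mset w = image_mset f (mset xs) \<Longrightarrow> \<exists>xs'. mset xs' = mset xs \<and> map f xs' = w"
proof (induction w arbitrary: xs)
  case (Cons a w)
  have "a \<in># image_mset f (mset xs)" unfolding Cons.prems[symmetric] by simp
  then obtain x where x: "x \<in># mset xs" "f x = a" by auto
  from x(1) have "mset xs = mset (x # remove1 x xs)" by simp
  then obtain zs where xs: "mset xs = mset (x # zs)" by blast
  have "mset w = image_mset f (mset zs)" using Cons.prems x(2) unfolding xs by simp
  from Cons.IH[OF this] obtain xs' where "mset xs' = mset zs" "map f xs' = w" by blast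
  then show ?case using xs x(2) by (intro exI[of _ "x # xs'"]) simp
qed simp

lemma val_map: "val y (map f w) = val (\<lambda>i. y (f i)) w"
  by (simp add: val_def comp_def)

lemma count_mset_upt: "count (mset [a..<b]) i = (if a \<le> i \<and> i < b then 1 else 0)"
  using distinct_count_atmost_1[of "[a..<b]"] by simp

context engel_ring
begin

lemma front_letter:
  assumes U: "additive_subgroup (U :: 'a set)"
    and short: "\<And>u' S'. mset u' + mset S' = M \<Longrightarrow> length u' < length u \<Longrightarrow> pbw y u' S' \<in> U"
    and M: "mset u + mset S = M" and i: "i \<in> set u"
    and words: "\<And>w. mset w = M - {#i#} \<Longrightarrow> y i * val y w \<in> U"
  shows "pbw y u S \<in> U"
proof (rule reorder[OF U short M order.refl])
  show u: "mset u = mset (i # remove1 i u)" using i by simp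
  have "pbw y (remove1 i u) S \<in> {z. y i * z \<in> U}"
    by (rule expand_pbw_in[OF additive_subgroup_vimage_mult[OF U]]) (use words M i in auto)
  then show "pbw y (i # remove1 i u) S \<in> U" by (simp add: pbw_def mult.assoc)
qed

lemma cubed_letter:
  assumes U: "additive_subgroup (U :: 'a set)"
    and short: "\<And>u' S'. mset u' + mset S' = M \<Longrightarrow> length u' < length u \<Longrightarrow> pbw y u' S' \<in> U"
    and M: "mset u + mset S = M" and i: "count (mset u) i \<ge> 3" and y: "y i * y i * y i = 0"
  shows "pbw y u S \<in> U"
proof -
  have "replicate_mset 3 i \<subseteq># mset u" using i by (simp add: count_le_replicate_mset_subset_eq)
  then obtain N where "mset u = {#i, i, i#} + N"
    by (auto simp: subset_mset.le_iff_add numeral_3_eq_3)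
  moreover obtain v where "N = mset v" by (metis ex_mset)
  ultimately have u: "mset u = mset (i # i # i # v)" by simp
  have "y i * (y i * (y i * z)) = 0" for z
    using y by (simp add: mult.assoc[symmetric])
  then have "pbw y (i # i # i # v) S \<in> U" using additive_subgroupD(1)[OF U] by (simp add: pbw_def mult.assoc)
  from reorder[OF U short M order.refl u this] show ?thesis .
qed

text \<open>
  To show \<open>u C\<^sub>S \<in> U\<close> one may choose any mixed product with the same letters and commutators.
\<close>

lemma collect_conclude:
  assumes U: "additive_subgroup (U :: 'a set)"
    and short: "\<And>u' S'. mset u' + mset S' = M \<Longrightarrow> length u' < length u \<Longrightarrow> pbw y u' S' \<in> U"
    and M: "mset u + mset S = M"
    and t: "mset u = mset (letters t)" "mset S = mset (pairs t) + mset S'" "length S' \<noteq> 1"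
      "mixed_val y t * comm_prod (map y S') \<in> U"
  shows "pbw y u S \<in> U"
proof (rule reorder[OF U short M order.refl t(1)])
  have len: "length (letters t) = length u" using t(1) by (metis mset_eq_length)
  have "mixed_val y t * comm_prod (map y S') - pbw y (letters t) (pairs t @ S') \<in> U"
    by (rule mixed_collect[OF U short]) (use M t len in \<open>auto simp: add_ac\<close>)
  then have "mixed_val y t * comm_prod (map y S') - (mixed_val y t * comm_prod (map y S') - pbw y (letters t) (pairs t @ S')) \<in> U"
    by (rule additive_subgroupD(2)[OF U t(4)])
  then have "pbw y (letters t) (pairs t @ S') \<in> U" by simp
  then show "pbw y (letters t) S \<in> U" by (rule pbw_perm[OF U, rotated]) (simp add: t(2))
qed

text \<open>
  By the derivation rule, the element is the difference of the hypotheses for \<open>k = Suc i\<close> and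
  \<open>k = i\<close>; for \<open>k = 0\<close> the triple commutator is 0.
\<close>

lemma triple_telescope:
  assumes U: "additive_subgroup (U :: 'a set)"
    and g: "\<And>k. 1 \<le> k \<Longrightarrow> k \<le> length L \<Longrightarrow> g * (triple (val y (take k L)) a b * val y (drop k L)) \<in> U"
    and i: "i < length L"
  shows "g * (val y (take i L @ drop (Suc i) L) * triple (y (L ! i)) a b) \<in> U"
proof -
  have 1: "g * (triple (val y (take i L)) a b * val y (drop i L)) \<in> U"
  proof (cases "i = 0")
    case True
    then show ?thesis using additive_subgroupD(1)[OF U] by (simp add: commutator_def)
  qed (use g i in simp)
  have 2: "g * (triple (val y (take (Suc i) L)) a b * val y (drop (Suc i) L)) \<in> U"
    using g[of "Suc i"] i by simp
  have "val y (take (Suc i) L) = val y (take i L) * y (L ! i)" using i by (simp add: take_Suc_conv_app_nth)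
  moreover have "val y (drop i L) = y (L ! i) * val y (drop (Suc i) L)"
    using i by (simp add: Cons_nth_drop_Suc[symmetric])
  ultimately have "g * (val y (take i L @ drop (Suc i) L) * triple (y (L ! i)) a b) =
    g * (triple (val y (take (Suc i) L)) a b * val y (drop (Suc i) L)) - g * (triple (val y (take i L)) a b * val y (drop i L))"
    by (simp add: triple_mult distrib_left distrib_right mult.assoc triple_central[of "y (L ! i)" a b])
  then show ?thesis using additive_subgroupD(2)[OF U 2 1] by simp
qed

lemma move_two_letters:
  "Q * (a * (b * R)) = triple Q a b * R + (a * (Q * (b * R)) + b * (Q * (a * R)) - b * (a * (Q * (R :: 'a))))"
  by (simp add: commutator_def algebra_simps)

lemma span_relabel:
  assumes span: "\<And>U' y' w. additive_subgroup U' \<Longrightarrow> (\<And>v. v \<in> B \<Longrightarrow> val y' v \<in> U') \<Longrightarrow> mset w = mset xs \<Longrightarrow> val y' w \<in> (U' :: 'a set)"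
    and U: "additive_subgroup (U :: 'a set)"
    and B: "\<And>v. v \<in> B \<Longrightarrow> g * val y (map f v) \<in> U"
    and w: "mset w = mset (map f xs)"
  shows "g * val y w \<in> U"
proof -
  from w obtain w' where w': "mset w' = mset xs" "map f w' = w"
    using map_eq_permuted[of w f xs] by auto
  have "val (\<lambda>i. y (f i)) w' \<in> {z. g * z \<in> U}"
    by (rule span[OF additive_subgroup_vimage_mult[OF U]]) (use B w' in \<open>simp_all add: val_map\<close>)
  then show ?thesis by (simp add: w'(2)[symmetric] val_map)
qed

text \<open>
  If \<open>u\<close> contains one of the first two letters, move it to the front and use recursion. Otherwise
  both lie in \<open>S\<close>. If \<open>S\<close> has further letters and their number is not 1, the commutator of the first
  two splits off and is moved to the front. The case of one further letter is where the words
  \<open>e_word\<close> are needed.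
\<close>

theorem multilinear_span:
  assumes "additive_subgroup (U :: 'a set)" "\<And>v. v \<in> B_multilinear d \<Longrightarrow> val y v \<in> U" "mset w = mset [1..<d + 1]"
  shows "val y w \<in> U"
  using assms
proof (induction d arbitrary: U y w rule: B_multilinear.induct)
  case 1
  then show ?case by simp
next
  case 2
  then have "w = [1]" by simp
  with 2 show ?case by simp
next
  case (3 n U y w)
  note U = "3.prems"(1) and B = "3.prems"(2)
  define D where "D = Suc (Suc n)"
  define M where "M = mset [1..<D + 1]"
  define L where "L = [3..<D + 1]"
  have M: "M = {#1, 2#} + mset L"
  proof -
    have "[1..<D + 1] = 1 # 2 # L" unfolding L_def by (simp add: upt_conv_Cons D_def numeral_2_eq_2 numeral_3_eq_3)
    then show ?thesis by (simp add: M_def)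
  qed
  have w1: "y 1 * val y w \<in> U" if "mset w = M - {#1#}" for w
  proof (rule span_relabel[where B = "B_multilinear (Suc n)" and f = "\<lambda>i. i + 1" and xs = "[1..<Suc n + 1]"])
    show "\<And>U' y' w. additive_subgroup U' \<Longrightarrow> (\<And>v. v \<in> B_multilinear (Suc n) \<Longrightarrow> val y' v \<in> U') \<Longrightarrow>
      mset w = mset [1..<Suc n + 1] \<Longrightarrow> val y' w \<in> (U' :: 'a set)" by (rule "3.IH"(1))
    show "y 1 * val y (map (\<lambda>i. i + 1) v) \<in> U" if "v \<in> B_multilinear (Suc n)" for v
      using B[of "1 # map (\<lambda>i. i + 1) v"] that by simp
    have "map (\<lambda>i. i + 1) [1..<Suc n + 1] = 2 # L"
      by (simp add: L_def D_def upt_conv_Cons map_Suc_upt numeral_2_eq_2 numeral_3_eq_3 del: upt_Suc)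
    then show "mset w = mset (map (\<lambda>i. i + 1) [1..<Suc n + 1])" using that M by simp
  qed (rule U)
  have w2: "y 2 * val y w \<in> U" if "mset w = M - {#2#}" for w
  proof (rule span_relabel[where B = "B_multilinear (Suc n)" and f = "\<lambda>i. if i = 1 then 1 else i + 1" and xs = "[1..<Suc n + 1]"])
    show "\<And>U' y' w. additive_subgroup U' \<Longrightarrow> (\<And>v. v \<in> B_multilinear (Suc n) \<Longrightarrow> val y' v \<in> U') \<Longrightarrow>
      mset w = mset [1..<Suc n + 1] \<Longrightarrow> val y' w \<in> (U' :: 'a set)" by (rule "3.IH"(1))
    show "y 2 * val y (map (\<lambda>i. if i = 1 then 1 else i + 1) v) \<in> U" if "v \<in> B_multilinear (Suc n)" for v
      using B[of "2 # map (\<lambda>i. if i = 1 then 1 else i + 1) v"] that by simp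
    have "map (\<lambda>i. if i = 1 then 1 else i + 1) [1..<Suc n + 1] = 1 # map Suc [2..<Suc n + 1]"
    proof -
      have "[1..<Suc n + 1] = 1 # [2..<Suc n + 1]" by (simp add: upt_conv_Cons numeral_2_eq_2)
      then show ?thesis by (simp only: list.map) (auto intro!: map_cong)
    qed
    then have "map (\<lambda>i. if i = 1 then 1 else i + 1) [1..<Suc n + 1] = 1 # L"
      unfolding map_Suc_upt by (simp add: L_def D_def)
    then show "mset w = mset (map (\<lambda>i. if i = 1 then 1 else i + 1) [1..<Suc n + 1])" using that M by simp
  qed (rule U)
  show ?case
  proof (rule words_from_pbw[OF U])
    show "mset w = M" using "3.prems"(3) by (simp add: M_def D_def)
    fix u S
    assume uS: "mset u + mset S = M" and S: "distinct S" "length S \<noteq> 1"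
      and short: "\<And>u' S'. mset u' + mset S' = M \<Longrightarrow> length u' < length u \<Longrightarrow> pbw y u' S' \<in> U"
    show "pbw y u S \<in> U"
    proof (cases "1 \<in> set u \<or> 2 \<in> set u")
      case True
      then show ?thesis using front_letter[OF U short uS _ w1] front_letter[OF U short uS _ w2] by blast
    next
      case False
      have "1 \<in># mset u + mset S" "2 \<in># mset u + mset S" unfolding uS M by simp_all
      with False have "1 \<in> set S" "2 \<in> set S" by auto
      from mset_extract[OF this(1)] obtain S1 where S1: "mset S = mset (1 # S1)" by blast
      have "2 \<in> set S1" using arg_cong[OF S1, of set_mset] \<open>2 \<in> set S\<close> by auto
      from mset_extract[OF this] obtain T where "mset S1 = mset (2 # T)" by blast
      with S1 have T: "mset S = mset (1 # 2 # T)" by simp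
      have uT: "mset u + mset T = mset L" using uS M T by simp
      show ?thesis
      proof (cases "length T = 1")
        case False
        let ?c = "commutator (y 1) (y 2)"
        have "val y [1, 2] * pbw y u T \<in> U" "val y [2, 1] * pbw y u T \<in> U"
          using expand_pbw_in[OF additive_subgroup_vimage_mult[OF U, of "val y [1, 2]"], of u T y]
            expand_pbw_in[OF additive_subgroup_vimage_mult[OF U, of "val y [2, 1]"], of u T y]
            w1[of "2 # _"] w2[of "1 # _"] uT M by (simp_all add: mult.assoc)
        then have "?c * pbw y u T \<in> U"
          using additive_subgroupD(2)[OF U, of "val y [1, 2] * pbw y u T" "val y [2, 1] * pbw y u T"]
          by (simp add: commutator_def left_diff_distrib)
        moreover have "?c * pbw y u T - val y u * (?c * comm_prod (map y T)) \<in> U"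
          using commutator_shift[OF U short, where us = "[]" and vs = u and a = 1 and b = 2 and S = T] uT M
          by (simp add: pbw_def add_ac)
        ultimately have "val y u * (?c * comm_prod (map y T)) \<in> U"
          using additive_subgroupD(2)[OF U] by fastforce
        then have "pbw y u (1 # 2 # T) \<in> U" using False by (simp add: pbw_def comm_prod_Cons_Cons)
        then show ?thesis by (rule pbw_perm[OF U T[symmetric]])
      next
        case True
        then obtain j where j: "T = [j]" by (auto simp: length_Suc_conv)
        have "j \<in> set L" using arg_cong[OF uT, of set_mset] j by auto
        then obtain i where i: "i < length L" "L ! i = j" by (auto simp: in_set_conv_nth)
        have "1 * (triple (val y (take k L)) (y 1) (y 2) * val y (drop k L)) \<in> U" if k: "1 \<le> k" "k \<le> length L" for k
        proof -
          define Q R where QR: "Q = take k L" "R = drop k L"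
          have "mset Q + mset R = mset L" unfolding QR by (metis append_take_drop_id mset_append)
          then have "y 1 * val y (Q @ [2] @ R) \<in> U" "y 2 * val y (Q @ [1] @ R) \<in> U" "y 2 * val y ([1] @ Q @ R) \<in> U"
            by (intro w1 w2; simp add: M)+
          moreover have "e_word D (k + 2) = Q @ [1, 2] @ R"
          proof -
            have "3 + k \<le> D + 1" using k by (simp add: L_def del: upt_Suc)
            then have "Q = [3..<3 + k]" "R = [3 + k..<D + 1]" by (simp_all only: QR L_def take_upt drop_upt)
            moreover have "k + 2 + 1 = 3 + k" by simp
            ultimately show ?thesis by (simp only: e_word_def append.assoc)
          qed
          then have "Q @ [1, 2] @ R \<in> B_multilinear D"
            using k by (auto simp: D_def L_def simp del: upt_Suc intro!: exI[of _ "k + 2"])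
          then have "val y (Q @ [1, 2] @ R) \<in> U" unfolding D_def by (rule B)
          ultimately have "val y (Q @ [1, 2] @ R) - (y 1 * val y (Q @ [2] @ R) + y 2 * val y (Q @ [1] @ R) - y 2 * val y ([1] @ Q @ R)) \<in> U"
            by (intro additive_subgroupD[OF U])
          then show ?thesis unfolding QR[symmetric]
            using move_two_letters[of "val y Q" "y 1" "y 2" "val y R"] by (simp add: mult.assoc)
        qed
        from triple_telescope[OF U this i(1)]
        have "pbw y (take i L @ drop (Suc i) L) [j, 1, 2] \<in> U" by (simp add: pbw_def i(2))
        then have v: "pbw y (take i L @ drop (Suc i) L) S \<in> U"
          by (rule pbw_perm[OF U, rotated]) (simp add: T j)
        have "mset L = mset (take i L @ L ! i # drop (Suc i) L)" using i(1) by (simp add: id_take_nth_drop[symmetric])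
        then have "mset u = mset (take i L @ drop (Suc i) L)" using uT j i(2) by simp
        then show ?thesis using v by (intro reorder[OF U short uS order.refl])
      qed
    qed
  qed
qed

end

section \<open>Spanning with letters of degree 3\<close>

text \<open>
  A letter of degree 3 occurs at most once in \<open>S\<close>; if it occurs there, it occurs twice in \<open>u\<close>.
\<close>

lemma cubes_decompose:
  assumes M: "mset u + mset S = N + N + N + P" and S: "distinct S" "set_mset N \<subseteq> set S"
    and N: "\<And>i. i \<in># N \<Longrightarrow> count N i = 1 \<and> i \<notin># P"
  obtains v T where "mset u = N + N + mset v" "mset S = N + mset T" "mset v + mset T = P"
proof
  let ?p = "\<lambda>i. i \<notin># N"
  have cnt: "count (mset u) i + count (mset S) i = count N i + count N i + count N i + count P i" for i
    using arg_cong[OF M, of "\<lambda>m. count m i"] by simp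
  have cS: "count (mset S) i = 1" if "i \<in># N" for i
    using S that distinct_count_atmost_1[of S] by auto
  have cu: "count (mset u) i = 2" if "i \<in># N" for i
    using cnt[of i] cS[OF that] N[OF that] by (auto simp: count_eq_zero_iff)
  show "mset u = N + N + mset (filter ?p u)"
  proof (rule multiset_eqI)
    fix i show "count (mset u) i = count (N + N + mset (filter ?p u)) i"
      using cu[of i] N[of i] by (cases "i \<in># N") (auto simp: count_eq_zero_iff)
  qed
  show "mset S = N + mset (filter ?p S)"
  proof (rule multiset_eqI)
    fix i show "count (mset S) i = count (N + mset (filter ?p S)) i"
      using cS[of i] N[of i] by (cases "i \<in># N") (auto simp: count_eq_zero_iff)
  qed
  show "mset (filter ?p u) + mset (filter ?p S) = P"
  proof (rule multiset_eqI)
    fix i show "count (mset (filter ?p u) + mset (filter ?p S)) i = count P i"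
      using cnt[of i] N[of i] by (cases "i \<in># N") (auto simp: count_eq_zero_iff)
  qed
qed

lemma map_shift_upt: "map (\<lambda>i. i + n) [a..<b] = [a + n..<b + n]"
  by (induction b) auto

text \<open>
  The word \<open>u_word r\<close> as a mixed product, with \<open>[x\<^sub>i, x\<^sub>j]\<close> in place of the final
  letters \<open>x\<^sub>i x\<^sub>j\<close> of each block.
\<close>

definition blocks :: "nat \<Rightarrow> (nat + nat \<times> nat) list" where
  "blocks r = concat (map (\<lambda>j. [Inl (2 * j - 1), Inl (2 * j - 1), Inl (2 * j), Inl (2 * j), Inr (2 * j - 1, 2 * j)]) [1..<r + 1])"

lemma blocks_simps: "blocks 0 = []"
  "blocks (Suc r) = blocks r @ [Inl (2*r+1), Inl (2*r+1), Inl (2*r+2), Inl (2*r+2), Inr (2*r+1, 2*r+2)]"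
  by (simp_all add: blocks_def)

lemma u_word_simps: "u_word 0 = []" "u_word (Suc r) = u_word r @ w_word (2*r+1) (2*r+2)"
  by (simp_all add: u_word_def)

lemma upt_two_more: "[1..<2 * Suc r + 1] = [1..<2 * r + 1] @ [2*r+1, 2*r+2]"
  by simp

lemma blocks_content: "mset (letters (blocks r)) = mset [1..<2 * r + 1] + mset [1..<2 * r + 1]"
  "pairs (blocks r) = [1..<2 * r + 1]"
proof (induction r)
  case (Suc r)
  { case 1 show ?case unfolding upt_two_more by (simp add: blocks_simps letters_pairs_append Suc del: upt_Suc) }
  { case 2 show ?case unfolding upt_two_more by (simp add: blocks_simps letters_pairs_append Suc del: upt_Suc) }
qed (simp_all add: blocks_simps)

context engel_ring
begin

lemma cube_zero_left: "a * a * a = 0 \<Longrightarrow> a * (a * (a * z)) = (0 :: 'a)"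
  by (simp add: mult.assoc[symmetric])

lemma move_square: "b * (b * (a * z)) = a * (b * (b * z)) - b * (commutator b a * (z :: 'a))"
proof -
  have "b * b * a = a * (b * b) + commutator (b * b) a" by (simp add: commutator_def)
  also have "\<dots> = a * (b * b) - b * commutator b a" by (simp add: commutator_square)
  finally have "b * b * a * z = (a * (b * b) - b * commutator b a) * z" by simp
  then show ?thesis by (simp add: mult.assoc left_diff_distrib)
qed

lemma commutator_own_letter: "commutator b a * (b * z) = b * (commutator b a * (z :: 'a))"
  using triple_first_equal[of b a] by (metis commutator_zero_iff mult.assoc)

text \<open>
  Moving \<open>a\<close> to the left past \<open>b\<^sup>2\<close> creates \<open>a\<^sup>3 = 0\<close> and a commutator, which commutes with
  \<open>b\<close>.
\<close>

lemma squares_block: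
  assumes "a * a * a = (0 :: 'a)"
  shows "a * (a * (b * (b * (a * (b * R))))) = a * (a * (b * (b * (commutator a b * R))))"
proof -
  have "a * (a * (b * (b * (a * (b * R))))) = - (a * (a * (b * (b * (commutator b a * R)))))"
    unfolding move_square[of b a] commutator_own_letter
    by (simp add: right_diff_distrib cube_zero_left[OF assms])
  then show ?thesis unfolding commutator_swap[of b a] by simp
qed

text \<open>
  The analogue of \<open>squares_block\<close> with a factor \<open>Q\<close> in between; this is how the words
  \<open>q_even\<close> produce triple commutators.
\<close>

lemma squares_move:
  assumes a: "a * a * a = (0 :: 'a)" and b: "b * b * b = (0 :: 'a)"
  shows "a * (a * (b * (b * (Q * (a * (b * R)))))) =
    a * (a * (b * (b * (triple Q a b * R)))) + a * (a * (b * (b * (commutator a b * (Q * R)))))"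
proof -
  have "commutator b a * (Q * (b * R)) = b * (commutator b a * (Q * R)) + commutator b a * commutator Q b * R"
  proof -
    have "Q * (b * R) = b * (Q * R) + commutator Q b * R" by (simp add: commutator_def algebra_simps)
    then show ?thesis by (simp add: distrib_left commutator_own_letter mult.assoc)
  qed
  moreover have "commutator b a * commutator Q b = 0"
    using commutator_mult_last_equal[of a b Q] commutator_swap[of b a] by simp
  ultimately have "commutator b a * (Q * (b * R)) = b * (commutator b a * (Q * R))" by simp
  then have "a * (a * (b * (b * (a * (Q * (b * R)))))) = a * (a * (b * (b * (commutator a b * (Q * R)))))"
    unfolding move_square[of b a] commutator_swap[of b a]
    by (simp add: distrib_left right_diff_distrib cube_zero_left[OF a])
  then show ?thesis
    unfolding move_two_letters[of Q a b R]
    by (simp add: distrib_left right_diff_distrib cube_zero_left[OF b])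
qed

lemma squares_move_last:
  assumes a: "a * a * a = (0 :: 'a)" and b: "b * b * b = (0 :: 'a)" and c: "c * c * c = (0 :: 'a)"
  shows "a * (a * (b * (b * (c * (c * (a * (b * (c * R)))))))) =
    - (a * (a * (b * (b * (c * (c * (R * triple c a b)))))))"
  using squares_move[OF a b, of "c * c" "c * R"]
  by (simp add: mult.assoc cube_zero_left[OF c] triple_square triple_central triple_left_commute)

lemma mixed_val_blocks:
  assumes "\<And>i. 1 \<le> i \<Longrightarrow> i \<le> 2 * r \<Longrightarrow> y i * y i * y i = (0 :: 'a)"
  shows "mixed_val y (blocks r) = val y (u_word r)"
  using assms
proof (induction r)
  case (Suc r)
  have "mixed_val y (blocks (Suc r)) = val y (u_word r) * mixed_val y [Inl (2*r+1), Inl (2*r+1), Inl (2*r+2), Inl (2*r+2), Inr (2*r+1, 2*r+2)]"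
    using Suc by (simp add: blocks_simps mixed_val_append)
  also have "mixed_val y [Inl (2*r+1), Inl (2*r+1), Inl (2*r+2), Inl (2*r+2), Inr (2*r+1, 2*r+2)] = val y (w_word (2*r+1) (2*r+2))"
    using squares_block[OF Suc.prems[of "2*r+1"], of "y (2*r+2)" 1] by (simp add: w_word_def)
  finally show ?case by (simp add: u_word_simps)
qed (simp add: blocks_simps u_word_simps)

lemma multilinear_span_shifted:
  assumes U: "additive_subgroup (U :: 'a set)" and B: "\<And>v. v \<in> B_multilinear s \<Longrightarrow> g * val y (map f v) \<in> U"
    and w: "mset w = mset (map f [1..<s + 1])"
  shows "g * val y w \<in> U"
  by (rule span_relabel[OF _ U B w]) (rule multilinear_span)

lemma nth_split: "i < length L \<Longrightarrow> mset L = {#L ! i#} + mset (take i L @ drop (Suc i) L)"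
  by (subst id_take_nth_drop[of i L]) simp_all

text \<open>
  Only sets \<open>S\<close> that contain all letters of degree 3 need attention: such a letter outside \<open>S\<close>
  occurs three times in \<open>u\<close>.
\<close>

lemma threes_from_pbw:
  assumes U: "additive_subgroup (U :: 'a set)"
    and N: "\<And>i. i \<in># N \<Longrightarrow> count N i = 1 \<and> i \<notin># P"
    and cubes: "\<And>i. i \<in># N \<Longrightarrow> y i * y i * y i = 0"
    and step: "\<And>u S v T. \<lbrakk>mset u + mset S = N + N + N + P; length S \<noteq> 1;
      mset u = N + N + mset v; mset S = N + mset T; mset v + mset T = P;
      \<And>u' S'. mset u' + mset S' = N + N + N + P \<Longrightarrow> length u' < length u \<Longrightarrow> pbw y u' S' \<in> U\<rbrakk>
      \<Longrightarrow> pbw y u S \<in> U"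
    and w: "mset w = N + N + N + P"
  shows "val y w \<in> U"
proof (rule words_from_pbw[OF U _ w])
  fix u S
  assume uS: "mset u + mset S = N + N + N + P" and S: "distinct S" "length S \<noteq> 1"
    and short: "\<And>u' S'. mset u' + mset S' = N + N + N + P \<Longrightarrow> length u' < length u \<Longrightarrow> pbw y u' S' \<in> U"
  show "pbw y u S \<in> U"
  proof (cases "set_mset N \<subseteq> set S")
    case False
    then obtain i where i: "i \<in># N" "i \<notin> set S" by auto
    then have "count (mset u) i + count (mset S) i = 3"
      using arg_cong[OF uS, of "\<lambda>m. count m i"] N[OF i(1)] by (simp add: not_in_iff)
    then have u3: "count (mset u) i \<ge> 3" using i(2) by (simp add: count_eq_zero_iff[THEN iffD2])
    from cubed_letter[OF U short uS u3 cubes[OF i(1)]] show ?thesis .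
  next
    case True
    obtain v T where "mset u = N + N + mset v" "mset S = N + mset T" "mset v + mset T = P"
      by (rule cubes_decompose[OF uS S(1) True N])
    from step[OF uS S(2) this short] show ?thesis .
  qed
qed

text \<open>
  Write \<open>S\<close> as the letters of degree 3 and a set \<open>T\<close>. The former provide the blocks, and what
  follows is \<open>v C\<^sub>T\<close>, which is a combination of words of degree \<open>1\<^sup>s\<close> unless \<open>T\<close> has a single
  element \<open>j\<close>. Then the last block is replaced by \<open>a\<^sup>2 b\<^sup>2 [[j, a], b]\<close>, and the words
  \<open>q_even\<close> enter.
\<close>

theorem even_span:
  assumes U: "additive_subgroup (U :: 'a set)"
    and cubes: "\<And>i. 1 \<le> i \<Longrightarrow> i \<le> 2 * r \<Longrightarrow> y i * y i * y i = 0"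
    and B: "\<And>v. v \<in> B_even r s \<Longrightarrow> val y v \<in> U"
    and w: "mset w = mset [1..<2 * r + 1] + mset [1..<2 * r + 1] + mset [1..<2 * r + 1] + mset [2 * r + 1..<2 * r + s + 1]"
  shows "val y w \<in> U"
proof -
  define N where "N = mset [1..<2 * r + 1]"
  define L where "L = [2 * r + 1..<2 * r + s + 1]"
  have N_count: "count N i = 1 \<and> i \<notin># mset L" if "i \<in># N" for i
    using that by (auto simp: N_def L_def count_mset_upt simp del: upt_Suc)
  have shift: "map (\<lambda>i. i + 2 * r) [1..<s + 1] = L"
    by (simp add: L_def map_shift_upt add_ac del: upt_Suc)
  have u_words: "val y (u_word r) * val y w \<in> U" if "mset w = mset L" for w
  proof (rule multilinear_span_shifted[OF U])
    show "val y (u_word r) * val y (map (\<lambda>i. i + 2 * r) v) \<in> U" if "v \<in> B_multilinear s" for v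
      using B[of "u_word r @ map (\<lambda>i. i + 2 * r) v"] that by (simp add: B_even_def)
    show "mset w = mset (map (\<lambda>i. i + 2 * r) [1..<s + 1])" unfolding shift by (rule that)
  qed
  show ?thesis
  proof (rule threes_from_pbw[OF U N_count _ _ w[folded N_def L_def]])
    show "y i * y i * y i = 0" if "i \<in># N" for i using that by (intro cubes) (auto simp: N_def)
    fix u S v T
    assume uS: "mset u + mset S = N + N + N + mset L" and S: "length S \<noteq> 1"
      and vT: "mset u = N + N + mset v" "mset S = N + mset T" "mset v + mset T = mset L"
      and short: "\<And>u' S'. mset u' + mset S' = N + N + N + mset L \<Longrightarrow> length u' < length u \<Longrightarrow> pbw y u' S' \<in> U"
    show "pbw y u S \<in> U"
    proof (cases "length T = 1")
      case False
      show ?thesis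
      proof (rule collect_conclude[OF U short uS, where t = "blocks r @ map Inl v" and S' = T])
        have "pbw y v T \<in> {z. val y (u_word r) * z \<in> U}"
          by (rule expand_pbw_in[OF additive_subgroup_vimage_mult[OF U]]) (use u_words vT in simp)
        then show "mixed_val y (blocks r @ map Inl v) * comm_prod (map y T) \<in> U"
          by (simp add: mixed_val_append mixed_val_blocks[OF cubes] mixed_val_Inl pbw_def mult.assoc)
      qed (use vT False in \<open>simp_all add: letters_pairs_append letters_pairs_Inl blocks_content N_def del: upt_Suc\<close>)
    next
      case True
      then obtain j where j: "T = [j]" by (auto simp: length_Suc_conv)
      have "r \<noteq> 0"
      proof
        assume "r = 0"
        then have "mset S = {#j#}" using vT(2) j by (simp add: N_def)
        then have "length S = 1" by (metis size_mset size_single)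
        with S show False ..
      qed
      then obtain r' where r: "r = Suc r'" by (cases r) auto
      \<comment> \<open>the pair of letters of degree 3 whose block is replaced\<close>
      define a b where ab: "a = 2 * r - 1" "b = 2 * r"
      have ab': "a = 2 * r' + 1" "b = 2 * r' + 2" by (simp_all add: ab r)
      have uw: "u_word r = u_word r' @ w_word a b" unfolding r u_word_simps ab' ..
      have cab: "y a * y a * y a = 0" "y b * y b * y b = 0" by (rule cubes; simp add: ab r)+
      define g where "g = val y (u_word r' @ [a, a, b, b])"
      have "j \<in> set L" using arg_cong[OF vT(3), of set_mset] j by auto
      then obtain i where i: "i < length L" "L ! i = j" by (auto simp: in_set_conv_nth)
      define x where "x = take i L @ drop (Suc i) L"
      have v: "mset v = mset x" using vT(3) nth_split[OF i(1)] i(2) j by (simp add: x_def)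
      have N_split: "N = mset [1..<2 * r' + 1] + {#a, b#}"
        unfolding N_def r upt_two_more ab' by simp
      have "g * (triple (val y (take k L)) (y a) (y b) * val y (drop k L)) \<in> U"
        if k: "1 \<le> k" "k \<le> length L" for k
      proof -
        define Q R where QR: "Q = take k L" "R = drop k L"
        have ks: "k \<le> s" using k by (simp add: L_def del: upt_Suc)
        then have "Q = run (2*r + 1) (2*r + k)" "R = run (2*r + k + 1) (2*r + s)"
          by (simp_all add: QR L_def take_upt drop_upt add_ac del: upt_Suc)
        then have "q_even r s k = u_word r' @ [a, a, b, b] @ Q @ [a, b] @ R"
          by (simp only: q_even_def ab r) simp
        then have "u_word r' @ [a, a, b, b] @ Q @ [a, b] @ R \<in> B_even r s"
          using k ks r unfolding B_even_def by (intro UnI2 CollectI exI[of _ k]) auto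
        from B[OF this] have "val y (u_word r') * (y a * (y a * (y b * (y b * (val y Q * (y a * (y b * val y R))))))) \<in> U"
          by (simp add: mult.assoc)
        moreover have "val y (u_word r) * val y (Q @ R) \<in> U"
          by (rule u_words) (simp add: QR)
        then have "val y (u_word r') * (y a * (y a * (y b * (y b * (commutator (y a) (y b) * (val y Q * val y R)))))) \<in> U"
          using squares_block[OF cab(1), of "y b" "val y Q * val y R"]
          by (simp add: uw w_word_def mult.assoc)
        ultimately show ?thesis
          using additive_subgroupD(2)[OF U] unfolding squares_move[OF cab] QR[symmetric] g_def
          by (fastforce simp: distrib_left mult.assoc)
      qed
      from triple_telescope[OF U this i(1)]
      have x: "g * (val y x * triple (y j) (y a) (y b)) \<in> U" by (simp add: x_def i(2))
      show ?thesis
      proof (rule collect_conclude[OF U short uS, where t = "blocks r' @ map Inl ([a, a, b, b] @ x)" and S' = "[j, a, b]"])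
        show "mixed_val y (blocks r' @ map Inl ([a, a, b, b] @ x)) * comm_prod (map y [j, a, b]) \<in> U"
          using x unfolding mixed_val_append mixed_val_Inl g_def
          by (subst mixed_val_blocks) (use cubes r in \<open>simp_all add: mult.assoc\<close>)
      qed (use vT(1,2) v j N_split in \<open>simp_all add: letters_pairs_append letters_pairs_Inl blocks_content add_mset_commute del: upt_Suc map_append\<close>)
    qed
  qed
qed

text \<open>
  Let \<open>a\<close> be the last letter of degree 3 and \<open>b\<close> the first letter of degree 1. If \<open>b\<close> is in
  \<open>u\<close>, or the commutator \<open>[a, b]\<close> splits off, the element begins with \<open>a\<^sup>2 b\<close> after the blocks,
  since \<open>a\<^sup>2 [a, b] = - a\<^sup>2 b a\<close>. The remaining sets consist of the letters of degree 3 alone, where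
  \<open>q_odd_last\<close> is used, or of these, \<open>b\<close> and one more letter, where the words \<open>q_odd\<close> are used.
\<close>

theorem odd_span:
  assumes U: "additive_subgroup (U :: 'a set)"
    and cubes: "\<And>i. 1 \<le> i \<Longrightarrow> i \<le> 2 * r + 1 \<Longrightarrow> y i * y i * y i = 0"
    and B: "\<And>v. v \<in> B_odd r s \<Longrightarrow> val y v \<in> U"
    and w: "mset w = mset [1..<2 * r + 2] + mset [1..<2 * r + 2] + mset [1..<2 * r + 2] + mset [2 * r + 2..<2 * r + s + 2]"
  shows "val y w \<in> U"
proof -
  \<comment> \<open>the last letter of degree 3 and the first letter of degree 1\<close>
  define a b where ab: "a = 2 * r + 1" "b = 2 * r + 2"
  define N where "N = mset [1..<2 * r + 2]"
  define Z where "Z = [b..<2 * r + s + 2]"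
  have Z: "Z = [2 * r + 2..<2 * r + s + 2]" by (simp add: Z_def ab)
  have ca: "y a * y a * y a = 0" by (rule cubes) (simp_all add: ab)
  have N_a: "N = mset [1..<2 * r + 1] + {#a#}" by (simp add: N_def ab)
  have N_count: "count N i = 1 \<and> i \<notin># mset Z" if "i \<in># N" for i
    using that by (auto simp: N_def Z count_mset_upt simp del: upt_Suc)
  define g where "g = val y (u_word r @ [a, a])"
  have blocks_g: "mixed_val y (blocks r @ map Inl ([a, a] @ x)) = g * val y x" for x
    unfolding mixed_val_append mixed_val_Inl g_def
    by (subst mixed_val_blocks) (use cubes in \<open>simp_all add: mult.assoc\<close>)
  have g_a: "g * (y a * z) = 0" for z
    using cube_zero_left[OF ca, of z] by (simp add: g_def mult.assoc)
  define L where "L = [2 * r + 3..<2 * r + s + 2]"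
  have Z_L: "Z = b # L" if "s \<ge> 1"
    using that by (simp add: Z_def L_def ab upt_conv_Cons numeral_3_eq_3 del: upt_Suc)
  have ab_words: "g * (y b * val y w) \<in> U" if s: "s \<ge> 1" and w: "mset w = mset (a # L)" for w
  proof -
    let ?f = "\<lambda>i. if i = 1 then 2 * r + 1 else i + 2 * r + 1"
    have "[1..<s + 1] = 1 # [2..<s + 1]" using s by (simp add: upt_conv_Cons numeral_2_eq_2 del: upt_Suc)
    then have "map ?f [1..<s + 1] = a # map (\<lambda>i. i + (2 * r + 1)) [2..<s + 1]"
      by (simp only: list.map) (auto simp: ab intro!: map_cong)
    also have "\<dots> = a # L" unfolding map_shift_upt by (simp add: L_def add_ac numeral_3_eq_3 del: upt_Suc)
    finally have f: "map ?f [1..<s + 1] = a # L" .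
    have "g * y b * val y w \<in> U"
    proof (rule multilinear_span_shifted[OF U])
      show "g * y b * val y (map ?f v) \<in> U" if "v \<in> B_multilinear s" for v
      proof -
        have "u_word r @ [2*r+1, 2*r+1, 2*r+2] @ map ?f v \<in> B_odd r s"
          using that s by (auto simp: B_odd_def)
        from B[OF this] show ?thesis by (simp add: g_def ab mult.assoc)
      qed
      show "mset w = mset (map ?f [1..<s + 1])" unfolding f by (rule w)
    qed
    then show ?thesis by (simp add: mult.assoc)
  qed
  have ab_pbw: "g * (y b * (val y u * comm_prod (map y S))) \<in> U"
    if "s \<ge> 1" "mset u + mset S = mset (a # L)" for u S
  proof -
    have "pbw y u S \<in> {z. (g * y b) * z \<in> U}"
      by (rule expand_pbw_in[OF additive_subgroup_vimage_mult[OF U]])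
        (use ab_words[OF that(1)] that(2) in \<open>simp add: mult.assoc\<close>)
    then show ?thesis by (simp add: pbw_def mult.assoc)
  qed
  show ?thesis
  proof (rule threes_from_pbw[OF U N_count _ _ w[folded N_def Z]])
    show "y i * y i * y i = 0" if "i \<in># N" for i using that by (intro cubes) (auto simp: N_def)
    fix u S v T
    assume uS: "mset u + mset S = N + N + N + mset Z" and S: "length S \<noteq> 1"
      and vT: "mset u = N + N + mset v" "mset S = N + mset T" "mset v + mset T = mset Z"
      and short: "\<And>u' S'. mset u' + mset S' = N + N + N + mset Z \<Longrightarrow> length u' < length u \<Longrightarrow> pbw y u' S' \<in> U"
    show "pbw y u S \<in> U"
    proof -
      consider "T = []" | "b \<in> set v" "T \<noteq> []" | T' where "b \<notin> set v" "mset T = mset (b # T')" "length T' \<noteq> 1"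
        | j where "b \<notin> set v" "mset T = mset [b, j]"
      proof (cases "T = [] \<or> b \<in> set v")
        case True
        then show ?thesis using that(1,2) by blast
      next
        case False
        then obtain t where "t \<in> set T" by (cases T) auto
        then have "t \<in># mset Z" unfolding vT(3)[symmetric] by simp
        then have "s \<ge> 1" by (auto simp: Z)
        then have "b \<in># mset v + mset T" unfolding vT(3) by (simp add: Z_L)
        with False have "b \<in> set T" by simp
        from mset_extract[OF this] obtain T' where T': "mset T = mset (b # T')" by blast
        show ?thesis
        proof (cases "length T' = 1")
          case True
          then obtain j where "T' = [j]" by (auto simp: length_Suc_conv)
          then show ?thesis using that(4) T' False by blast
        qed (use that(3) T' False in blast)
      qed
      then show ?thesis
      proof cases
        case 1
        have "r \<noteq> 0"
        proof
          assume "r = 0"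
          then have "mset S = {#a#}" using vT(2) 1 by (simp add: N_a)
          then have "length S = 1" by (metis size_mset size_single)
          with S show False ..
        qed
        then obtain r' where r: "r = Suc r'" by (cases r) auto
        define p q where pq: "p = 2 * r' + 1" "q = 2 * r' + 2"
        have cpq: "y p * y p * y p = 0" "y q * y q * y q = 0" by (rule cubes; simp add: pq r)+
        have N_split: "N = mset [1..<2 * r' + 1] + {#p, q, a#}"
          unfolding N_a r upt_two_more pq by simp
        have "q_odd_last r s = u_word r' @ [p, p, q, q, a, a, p, q, a] @ Z"
          by (simp add: q_odd_last_def r pq ab Z_def del: upt_Suc)
        moreover have "q_odd_last r s \<in> B_odd r s" by (simp add: B_odd_def r)
        ultimately have "val y (u_word r' @ [p, p, q, q, a, a, p, q, a] @ Z) \<in> U" using B by metis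
        then have "- val y (u_word r' @ [p, p, q, q, a, a, p, q, a] @ Z) \<in> U" by (rule additive_subgroupD(3)[OF U])
        then have x: "val y (u_word r') * (val y ([p, p, q, q, a, a] @ Z) * triple (y a) (y p) (y q)) \<in> U"
          by (simp add: mult.assoc squares_move_last[OF cpq ca])
        show ?thesis
        proof (rule collect_conclude[OF U short uS, where t = "blocks r' @ map Inl ([p, p, q, q, a, a] @ Z)" and S' = "[a, p, q]"])
          show "mixed_val y (blocks r' @ map Inl ([p, p, q, q, a, a] @ Z)) * comm_prod (map y [a, p, q]) \<in> U"
            using x unfolding mixed_val_append mixed_val_Inl
            by (subst mixed_val_blocks) (use cubes r in \<open>simp_all add: mult.assoc\<close>)
        qed (use vT 1 N_split in \<open>simp_all add: letters_pairs_append letters_pairs_Inl blocks_content add_mset_commute del: upt_Suc map_append\<close>)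
      next
        case 2
        from mset_extract[OF 2(1)] obtain v' where v': "mset v = mset (b # v')" by blast
        have s: "s \<ge> 1"
        proof (rule ccontr)
          assume "\<not> s \<ge> 1"
          then have "mset Z = {#}" by (simp add: Z_def ab)
          with vT(3) v' show False by simp
        qed
        have "g * (y b * (val y v' * comm_prod (map y (a # T)))) \<in> U"
          by (rule ab_pbw[OF s]) (use vT(3) v' Z_L[OF s] in simp)
        then show ?thesis
          by (intro collect_conclude[OF U short uS, where t = "blocks r @ map Inl ([a, a] @ b # v')" and S' = "a # T"])
            (use vT v' N_a 2(2) blocks_g[of "b # v'"] in \<open>simp_all add: mult.assoc letters_pairs_append letters_pairs_Inl blocks_content del: upt_Suc\<close>)
      next
        case (3 T')
        have s: "s \<ge> 1"
        proof (rule ccontr)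
          assume "\<not> s \<ge> 1"
          then have "mset Z = {#}" by (simp add: Z_def ab)
          with vT(3) 3 show False by simp
        qed
        have "g * (y b * (val y (a # v) * comm_prod (map y T'))) \<in> U"
          by (rule ab_pbw[OF s]) (use vT(3) 3 Z_L[OF s] in simp)
        then have "- (g * (y b * (val y (a # v) * comm_prod (map y T')))) \<in> U" by (rule additive_subgroupD(3)[OF U])
        also have "- (g * (y b * (val y (a # v) * comm_prod (map y T')))) =
          g * (commutator (y a) (y b) * (val y v * comm_prod (map y T')))"
          using g_a[of "y b * (val y v * comm_prod (map y T'))"] by (simp add: commutator_def left_diff_distrib right_diff_distrib mult.assoc)
        finally have x: "g * (commutator (y a) (y b) * (val y v * comm_prod (map y T'))) \<in> U" .
        have "mixed_val y (blocks r @ map Inl ([a, a] @ []) @ [Inr (a, b)] @ map Inl v) =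
          g * (commutator (y a) (y b) * val y v)"
          using blocks_g[of "[]"] unfolding append.assoc[symmetric] mixed_val_append[of y "blocks r @ map Inl ([a, a] @ [])"]
            mixed_val_append[of y "_ @ [Inr (a, b)]"] mixed_val_Inl by (simp add: mult.assoc)
        then show ?thesis using x
          by (intro collect_conclude[OF U short uS, where t = "blocks r @ map Inl ([a, a] @ []) @ [Inr (a, b)] @ map Inl v" and S' = T'])
            (use vT 3 N_a in \<open>simp_all add: mult.assoc letters_pairs_append letters_pairs_Inl blocks_content del: upt_Suc\<close>)
      next
        case (4 j)
        have s: "s \<ge> 1"
        proof (rule ccontr)
          assume "\<not> s \<ge> 1"
          then have "mset Z = {#}" by (simp add: Z_def ab)
          with vT(3) 4 show False by simp
        qed
        have vL: "mset v + {#j#} = mset L" using vT(3) 4 Z_L[OF s] by simp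
        have "j \<in># mset L" unfolding vL[symmetric] by simp
        then have "j \<in> set L" by (simp del: upt_Suc)
        then obtain i where i: "i < length L" "L ! i = j" by (auto simp: in_set_conv_nth)
        define x where "x = take i L @ drop (Suc i) L"
        have v: "mset v = mset x" using vL nth_split[OF i(1)] i(2) by (simp add: x_def)
        have "g * (triple (val y (take k L)) (y a) (y b) * val y (drop k L)) \<in> U"
          if k: "1 \<le> k" "k \<le> length L" for k
        proof -
          define Q R where QR: "Q = take k L" "R = drop k L"
          have ks: "k + 1 \<le> s" using k by (simp add: L_def del: upt_Suc)
          have "2 * r + 3 + k \<le> 2 * r + s + 2" using ks by simp
          then have "Q = [2 * r + 3..<2 * r + 3 + k]" "R = [2 * r + 3 + k..<2 * r + s + 2]"
            by (simp_all only: QR L_def take_upt drop_upt)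
          moreover have "2 * r + (k + 2) + 1 = 2 * r + 3 + k" "2 * r + s + 1 + 1 = 2 * r + s + 2" by simp_all
          ultimately have "q_odd r s (k + 2) = u_word r @ [a, a] @ Q @ [a, b] @ R"
            by (simp only: q_odd_def ab append.assoc)
          then have "u_word r @ [a, a] @ Q @ [a, b] @ R \<in> B_odd r s"
            using k ks unfolding B_odd_def by (intro UnI1 UnI2 CollectI exI[of _ "k + 2"]) auto
          from B[OF this] have 1: "g * (val y Q * (y a * (y b * val y R))) \<in> U"
            by (simp add: g_def mult.assoc)
          have "mset Q + mset R = mset L" unfolding QR by (metis append_take_drop_id mset_append)
          then have 2: "g * (y b * (val y Q * (y a * val y R))) \<in> U" "g * (y b * (y a * (val y Q * val y R))) \<in> U"
            using ab_words[OF s, of "Q @ [a] @ R"] ab_words[OF s, of "[a] @ Q @ R"] by (simp_all add: mult.assoc)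
          have "g * (triple (val y Q) (y a) (y b) * val y R) =
            g * (val y Q * (y a * (y b * val y R))) - (g * (y b * (val y Q * (y a * val y R))) - g * (y b * (y a * (val y Q * val y R))))"
            unfolding move_two_letters[of "val y Q" "y a" "y b" "val y R"]
            by (simp add: distrib_left right_diff_distrib g_a)
          then show ?thesis unfolding QR[symmetric] using additive_subgroupD(2)[OF U 1 additive_subgroupD(2)[OF U 2]] by simp
        qed
        from triple_telescope[OF U this i(1)]
        have x: "g * (val y x * triple (y j) (y a) (y b)) \<in> U" by (simp add: x_def i(2))
        then show ?thesis
          by (intro collect_conclude[OF U short uS, where t = "blocks r @ map Inl ([a, a] @ x)" and S' = "[j, a, b]"])
            (use vT v 4 N_a blocks_g[of x] in \<open>simp_all add: mult.assoc letters_pairs_append letters_pairs_Inl blocks_content add_mset_commute del: upt_Suc\<close>)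
      qed
    qed
  qed
qed

end

section \<open>The nil algebra as a quotient ring\<close>

lemma nil_ideal_zero: "0 \<in> nil_ideal"
  using nil_ideal.cube[of 0] by simp

lemma nil_ideal_uminus: "a \<in> nil_ideal \<Longrightarrow> - a \<in> nil_ideal"
  using nil_ideal.mult_left[of a "- 1"] by simp

lemma nil_ideal_diff: "a \<in> nil_ideal \<Longrightarrow> b \<in> nil_ideal \<Longrightarrow> a - b \<in> nil_ideal"
  using nil_ideal.add[OF _ nil_ideal_uminus, of a b] by simp

lemma lookup_mult_Nil:
  "Poly_Mapping.lookup (x * y) [] = Poly_Mapping.lookup x [] * Poly_Mapping.lookup (y :: 'k::field free) []"
proof (induction x rule: free_induct)
  case (2 u a)
  show ?case
    by (induction y rule: free_induct) (auto simp: monom_mult lookup_single when_def distrib_left lookup_add)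
qed (simp_all add: distrib_right lookup_add)

text \<open>
  In particular 1 is not in the ideal, which makes the quotient a ring with \<open>0 \<noteq> 1\<close>.
\<close>

lemma nil_ideal_lookup_Nil: "a \<in> nil_ideal \<Longrightarrow> Poly_Mapping.lookup a [] = 0"
  by (induction rule: nil_ideal.induct) (simp_all add: power3_eq_cube lookup_mult_Nil lookup_add)

quotient_type (overloaded) 'k nil_quot = "'k::field free" / "\<lambda>x y. x - y \<in> nil_ideal" morphisms rep_nil cls
proof (rule equivpI)
  show "reflp (\<lambda>x y :: 'k free. x - y \<in> nil_ideal)" by (rule reflpI) (simp add: nil_ideal_zero)
  show "symp (\<lambda>x y :: 'k free. x - y \<in> nil_ideal)"
    by (rule sympI) (use nil_ideal_uminus in fastforce)
  show "transp (\<lambda>x y :: 'k free. x - y \<in> nil_ideal)"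
    by (rule transpI) (use nil_ideal.add in fastforce)
qed

instantiation nil_quot :: (field) ring_1
begin

lift_definition zero_nil_quot :: "'a nil_quot" is 0 .
lift_definition one_nil_quot :: "'a nil_quot" is 1 .
lift_definition plus_nil_quot :: "'a nil_quot \<Rightarrow> 'a nil_quot \<Rightarrow> 'a nil_quot" is "(+)"
proof -
  fix a b c d :: "'a free" assume "a - b \<in> nil_ideal" "c - d \<in> nil_ideal"
  from nil_ideal.add[OF this] show "a + c - (b + d) \<in> nil_ideal" by (simp add: algebra_simps)
qed
lift_definition minus_nil_quot :: "'a nil_quot \<Rightarrow> 'a nil_quot \<Rightarrow> 'a nil_quot" is "(-)"
proof -
  fix a b c d :: "'a free" assume "a - b \<in> nil_ideal" "c - d \<in> nil_ideal"
  from nil_ideal_diff[OF this] show "a - c - (b - d) \<in> nil_ideal" by (simp add: algebra_simps)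
qed
lift_definition uminus_nil_quot :: "'a nil_quot \<Rightarrow> 'a nil_quot" is uminus
proof -
  fix a b :: "'a free" assume "a - b \<in> nil_ideal"
  from nil_ideal_uminus[OF this] show "- a - - b \<in> nil_ideal" by (simp add: algebra_simps)
qed
lift_definition times_nil_quot :: "'a nil_quot \<Rightarrow> 'a nil_quot \<Rightarrow> 'a nil_quot" is "(*)"
proof -
  fix a b c d :: "'a free" assume "a - b \<in> nil_ideal" "c - d \<in> nil_ideal"
  then have "(a - b) * c + b * (c - d) \<in> nil_ideal" by (intro nil_ideal.intros)
  then show "a * c - b * d \<in> nil_ideal" by (simp add: algebra_simps)
qed

instance
proof
  show "(0 :: 'a nil_quot) \<noteq> 1"
  proof transfer
    show "(0 :: 'a free) - 1 \<notin> nil_ideal"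
      using nil_ideal_lookup_Nil[of "- 1 :: 'a free"]
      by (auto simp: lookup_one zero_list_def)
  qed
qed (transfer; simp add: algebra_simps nil_ideal_zero)+

end

lemma cls_hom: "cls 0 = 0" "cls 1 = 1" "cls (a + b) = cls a + cls b" "cls (a - b) = cls a - cls b" "cls (a * b) = cls a * cls b"
  by (transfer; simp add: nil_ideal_zero)+

lemma cls_eq_0_iff: "cls a = 0 \<longleftrightarrow> a \<in> nil_ideal"
  by (transfer) simp

lemma cls_cases: obtains a where "x = cls a"
  using that by (metis nil_quot.abs_eq_iff Quotient_nil_quot Quotient_abs_rep)

lemma cls_sum: "cls (\<Sum>i\<in>I. f i) = (\<Sum>i\<in>I. cls (f i))"
  by (induction I rule: infinite_finite_induct) (simp_all add: cls_hom)

lemma constant_commute: "x * monom [] c = monom [] c * (x :: 'k::field free)"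
  by (induction x rule: free_induct) (simp_all add: monom_mult distrib_left distrib_right mult.commute)

lemma constant_part: obtains a0 c where "a = a0 + monom [] c" "Poly_Mapping.lookup a0 [] = 0"
  by (rule that[of "a - monom [] (Poly_Mapping.lookup a [])" "Poly_Mapping.lookup a []"]) (simp_all add: lookup_minus)

lemma three_free: "(3 :: 'k::field) = 0 \<Longrightarrow> (3 :: 'k free) = 0"
proof -
  assume "(3 :: 'k) = 0"
  then have "monom [] (1 + (1 + 1) :: 'k) = 0" by simp
  then have "monom [] 1 + (monom [] 1 + monom [] (1 :: 'k)) = 0" by (simp only: single_add)
  moreover have "monom [] 1 = (1 :: 'k free)" by (metis single_one zero_list_def)
  ultimately show ?thesis by simp
qed

text \<open>
  Adding a constant to \<open>a\<close> or \<open>b\<close> changes the form by multiples of 3. Without constant terms,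
  the cubes of \<open>a + b\<close>, \<open>a - b\<close> and \<open>b\<close> combine to twice the form.
\<close>

lemma engel_form_in_nil_ideal:
  assumes "(3 :: 'k::field) = 0"
  shows "engel_form a b \<in> (nil_ideal :: 'k free set)"
proof -
  have three: "x + x + x = 0" for x :: "'k free" by (rule three_times[OF three_free[OF assms]])
  have base: "engel_form a b \<in> nil_ideal" if "Poly_Mapping.lookup a [] = 0" "Poly_Mapping.lookup b [] = 0" for a b :: "'k free"
  proof -
    have "(a + b) ^ 3 - (a - b) ^ 3 - (b ^ 3 + b ^ 3) \<in> nil_ideal"
      using that by (intro nil_ideal_diff nil_ideal.add nil_ideal.cube) (simp_all add: lookup_add lookup_minus)
    also have "(a + b) ^ 3 - (a - b) ^ 3 - (b ^ 3 + b ^ 3) = engel_form a b + engel_form a b"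
      by (simp add: power3_eq_cube engel_form_def algebra_simps)
    also have "\<dots> = - engel_form a b"
      using three[of "engel_form a b"] by (simp add: eq_neg_iff_add_eq_0)
    finally show ?thesis using nil_ideal_uminus by fastforce
  qed
  obtain a0 c where a: "a = a0 + monom [] c" "Poly_Mapping.lookup a0 [] = 0" by (rule constant_part)
  obtain b0 e where b: "b = b0 + monom [] e" "Poly_Mapping.lookup b0 [] = 0" by (rule constant_part)
  let ?c = "monom [] c" and ?e = "monom [] e"
  have mv: "x * (monom [] c * z) = monom [] c * (x * z)" for x z :: "'k free" and c
    by (simp only: mult.assoc[symmetric] constant_commute[of x])
  have "engel_form (a0 + ?c) b = engel_form a0 b + (let z = ?c * (a0 * b) in z + z + z) +
      (let z = ?c * (b * a0) in z + z + z) + (let z = ?c * (?c * b) in z + z + z)"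
    by (simp add: engel_form_def Let_def algebra_simps constant_commute[of a0] constant_commute[of b] mv[of a0] mv[of b])
  moreover have "engel_form a0 (b0 + ?e) = engel_form a0 b0 + (let z = ?e * (a0 * a0) in z + z + z)"
    by (simp add: engel_form_def Let_def algebra_simps constant_commute[of a0] mv[of a0])
  ultimately have "engel_form a b = engel_form a0 b0" by (simp only: a(1) b(1) Let_def three add_0_right)
  then show ?thesis using base[OF a(2) b(2)] by simp
qed

lemma engel_ring_nil_quot:
  assumes "(3 :: 'k::field) = 0"
  shows "engel_ring TYPE('k nil_quot)"
proof
  have "cls (1 + (1 + 1) :: 'k free) = cls 0" using three_free[OF assms] by simp
  then show "(3 :: 'k nil_quot) = 0" by (simp only: cls_hom) simp
  fix a b :: "'k nil_quot"
  obtain a' b' where "a = cls a'" "b = cls b'" by (metis cls_cases)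
  then have "engel_form a b = cls (engel_form a' b')" by (simp add: engel_form_def cls_hom)
  then show "engel_form a b = 0" using engel_form_in_nil_ideal[OF assms] by (simp add: cls_eq_0_iff)
qed

definition scale_nil :: "'k::field \<Rightarrow> 'k nil_quot \<Rightarrow> 'k nil_quot" where
  "scale_nil c x = cls (monom [] c) * x"

interpretation nil_vs: vector_space scale_nil
proof
  fix a b :: "'a::field" and x y :: "'a nil_quot"
  show "scale_nil a (x + y) = scale_nil a x + scale_nil a y" by (simp add: scale_nil_def distrib_left)
  show "scale_nil (a + b) x = scale_nil a x + scale_nil b x" by (simp add: scale_nil_def single_add cls_hom distrib_right)
  show "scale_nil a (scale_nil b x) = scale_nil (a * b) x"
    by (simp add: scale_nil_def mult.assoc[symmetric] cls_hom[symmetric] monom_mult)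
  have "monom [] 1 = (1 :: 'a free)" by (metis single_one zero_list_def)
  then show "scale_nil 1 x = x" by (simp add: scale_nil_def cls_hom)
qed

definition letter :: "nat \<Rightarrow> 'k::field nil_quot" where
  "letter i = cls (monom [i] 1)"

lemma letter_cube: "letter i * letter i * letter i = (0 :: 'k::field nil_quot)"
proof -
  have "monom [i] 1 ^ 3 \<in> (nil_ideal :: 'k free set)" by (rule nil_ideal.cube) (simp add: lookup_single)
  then have "cls (monom [i] 1 ^ 3) = (0 :: 'k nil_quot)" by (simp only: cls_eq_0_iff)
  then show ?thesis by (simp add: letter_def power3_eq_cube cls_hom)
qed

lemma val_letter: "val letter w = cls (monom w (1 :: 'k::field))"
proof (induction w)
  case Nil
  have "monom [] 1 = (1 :: 'k free)" by (metis single_one zero_list_def)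
  then show ?case by (simp add: cls_hom)
next
  case (Cons i w)
  then show ?case by (simp add: letter_def cls_hom[symmetric] monom_mult)
qed

lemma comm_prod_letter: "comm_prod (map letter S) = (cls (comm_prod (map (\<lambda>i. monom [i] 1) S)) :: 'k::field nil_quot)"
  by (induction S rule: pair_list_induct)
    (simp_all add: comm_prod_Cons_Cons commutator_def letter_def cls_hom)

text \<open>
  The endomorphism that sends the letters outside \<open>{1..d}\<close> to 0.
\<close>

definition restrict_letters :: "nat \<Rightarrow> 'k::field free \<Rightarrow> 'k free" where
  "restrict_letters d x = (\<Sum>w\<in>Poly_Mapping.keys x. if set w \<subseteq> {1..d} then monom w (Poly_Mapping.lookup x w) else 0)"

lemma lookup_restrict_letters:
  "Poly_Mapping.lookup (restrict_letters d x) w = (if set w \<subseteq> {1..d} then Poly_Mapping.lookup x w else 0)"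
proof -
  have "Poly_Mapping.lookup (restrict_letters d x) w =
    (\<Sum>v\<in>Poly_Mapping.keys x. if v = w then if set w \<subseteq> {1..d} then Poly_Mapping.lookup x w else 0 else 0)"
    unfolding restrict_letters_def lookup_sum
    by (rule sum.cong) (auto simp: lookup_single when_def)
  then show ?thesis by (simp add: sum.delta' in_keys_iff)
qed

lemma restrict_letters_add: "restrict_letters d (x + y) = restrict_letters d x + restrict_letters d y"
  by (rule poly_mapping_eqI) (simp add: lookup_restrict_letters lookup_add)

lemma restrict_letters_0: "restrict_letters d 0 = 0"
  by (simp add: restrict_letters_def)

lemma restrict_letters_monom: "restrict_letters d (monom w c) = (if set w \<subseteq> {1..d} then monom w c else 0)"
  by (rule poly_mapping_eqI) (auto simp: lookup_restrict_letters lookup_single when_def)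

lemma restrict_letters_mult: "restrict_letters d (x * y) = restrict_letters d x * restrict_letters d y"
proof (induction x rule: free_induct)
  case (2 u a)
  show ?case
    by (induction y rule: free_induct)
      (auto simp: monom_mult restrict_letters_monom distrib_left restrict_letters_add restrict_letters_0)
qed (simp_all add: distrib_right restrict_letters_add restrict_letters_0)

lemma restrict_letters_id: "(\<forall>w\<in>Poly_Mapping.keys x. set w \<subseteq> {1..d}) \<Longrightarrow> restrict_letters d x = x"
  by (rule poly_mapping_eqI) (auto simp: lookup_restrict_letters in_keys_iff)

lemma keys_restrict_letters: "w \<in> Poly_Mapping.keys (restrict_letters d x) \<Longrightarrow> set w \<subseteq> {1..d} \<and> w \<in> Poly_Mapping.keys x"
  by (auto simp: in_keys_iff lookup_restrict_letters split: if_splits)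

lemma cube_ideal_mult:
  assumes a: "a \<in> cube_ideal d"
  shows "restrict_letters d b * a \<in> cube_ideal d" "a * restrict_letters d b \<in> cube_ideal d"
proof -
  obtain b0 c where b: "b = b0 + monom [] c" "Poly_Mapping.lookup b0 [] = 0" by (rule constant_part)
  have b0: "restrict_letters d b0 \<in> carrier (free_alg d)"
    using b(2) keys_restrict_letters[of _ d b0] by (auto simp: free_alg_def in_keys_iff)
  have c: "monom [] c * a \<in> cube_ideal d"
    using cube_ideal.smult[OF a, of c] by (simp add: free_alg_def)
  show "restrict_letters d b * a \<in> cube_ideal d"
    unfolding b(1) restrict_letters_add restrict_letters_monom
    using cube_ideal.mult_left[OF a b0] c by (simp add: distrib_right cube_ideal.add)
  show "a * restrict_letters d b \<in> cube_ideal d"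
    unfolding b(1) restrict_letters_add restrict_letters_monom
    using cube_ideal.mult_right[OF a b0] c by (simp add: distrib_left constant_commute cube_ideal.add)
qed

lemma restrict_nil_ideal: "x \<in> nil_ideal \<Longrightarrow> restrict_letters d x \<in> cube_ideal d"
proof (induction rule: nil_ideal.induct)
  case (cube a)
  then have "restrict_letters d a \<in> carrier (free_alg d)"
    using keys_restrict_letters[of _ d a] by (auto simp: free_alg_def in_keys_iff)
  from cube_ideal.cube[OF this] show ?case by (simp add: power3_eq_cube restrict_letters_mult)
qed (simp_all add: restrict_letters_add restrict_letters_mult cube_ideal.add cube_ideal_mult)

lemma cube_ideal_subset: "x \<in> cube_ideal d \<Longrightarrow> x \<in> nil_ideal"
proof (induction rule: cube_ideal.induct)
  case (cube a)
  then have "Poly_Mapping.lookup a [] = 0" by (auto simp: free_alg_def in_keys_iff)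
  then show ?case by (rule nil_ideal.cube)
qed (auto simp: free_alg_def intro: nil_ideal_zero nil_ideal.intros)

text \<open>
  An element in the letters \<open>1, \<dots>, d\<close> that lies in the ideal of cubes for all letters is fixed by
  \<open>restrict_letters d\<close>, which maps that ideal into the one for \<open>d\<close> letters.
\<close>

lemma cube_ideal_iff:
  "(\<forall>w\<in>Poly_Mapping.keys x. set w \<subseteq> {1..d}) \<Longrightarrow> x \<in> cube_ideal d \<longleftrightarrow> cls x = 0"
  using cube_ideal_subset[of x d] restrict_nil_ideal[of x d] restrict_letters_id[of x d]
  by (auto simp: cls_eq_0_iff)

section \<open>Letters of degree 2 and of degree at least 4\<close>

context engel_ring
begin

lemma threes_span:
  assumes U: "additive_subgroup (U :: 'a set)"
    and cubes: "\<And>i. 1 \<le> i \<Longrightarrow> i \<le> n \<Longrightarrow> y i * y i * y i = 0"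
    and B: "\<And>v. v \<in> B_threes n m \<Longrightarrow> val y v \<in> U"
    and w: "mset w = mset [1..<n + 1] + mset [1..<n + 1] + mset [1..<n + 1] + mset [n + 1..<n + m + 1]"
  shows "val y w \<in> U"
proof (cases "even n")
  case True
  then obtain r where n: "n = 2 * r" by blast
  show ?thesis
  proof (rule even_span[OF U])
    show "val y v \<in> U" if "v \<in> B_even r m" for v using that by (intro B) (simp add: B_threes_def n)
    show "y i * y i * y i = 0" if "1 \<le> i" "i \<le> 2 * r" for i using that by (intro cubes) (simp_all add: n)
  qed (use w in \<open>simp only: n\<close>)
next
  case False
  then obtain r where n: "n = 2 * r + 1" by (elim oddE)
  show ?thesis
  proof (rule odd_span[OF U])
    show "val y v \<in> U" if "v \<in> B_odd r m" for v using that by (intro B) (simp add: B_threes_def n)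
    show "y i * y i * y i = 0" if "1 \<le> i" "i \<le> 2 * r + 1" for i using that by (intro cubes) (simp_all add: n)
    have "2 * r + 1 + 1 = 2 * r + 2" "2 * r + 1 + m + 1 = 2 * r + m + 2" by simp_all
    with w show "mset w = mset [1..<2 * r + 2] + mset [1..<2 * r + 2] + mset [1..<2 * r + 2] + mset [2 * r + 2..<2 * r + m + 2]"
      by (simp only: n)
  qed
qed

text \<open>
  The words of degree 2 in some letters arise from words of degree 1 by squaring these letters;
  \<open>square_letter\<close> treats one letter after the other.
\<close>

lemma words_span:
  assumes U: "additive_subgroup (U :: 'a set)"
    and cubes: "\<And>i. x i * x i * x i = 0"
    and B: "\<And>v. v \<in> B_words r s l \<Longrightarrow> val x v \<in> U"
  defines "N \<equiv> mset [1..<r + 1]" and "D \<equiv> mset [r + 1..<r + s + 1]" and "E \<equiv> mset [r + s + 1..<r + s + l + 1]"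
  assumes w: "mset w = N + N + N + D + D + E"
  shows "val x w \<in> U"
proof -
  define y where "y k i = (if r + 1 \<le> i \<and> i \<le> r + k then x i * x i else x i)" for k i
  define D' where "D' k = mset [r + k + 1..<r + s + 1]" for k
  have "\<forall>w. mset w = N + N + N + D + D' k + E \<longrightarrow> val (y k) w \<in> U" if "k \<le> s" for k
    using that
  proof (induction rule: inc_induct)
    case base
    show ?case
    proof (intro allI impI)
      fix w assume w: "mset w = N + N + N + D + D' s + E"
      have "[r + 1..<r + (s + l) + 1] = [r + 1..<r + s + 1] @ [r + s + 1..<r + s + l + 1]"
        using upt_add_eq_append[of "r + 1" "r + s + 1" l] by (simp add: add_ac del: upt_Suc)
      then have DE: "D + E = mset [r + 1..<r + (s + l) + 1]" by (simp only: D_def E_def mset_append)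
      show "val (y s) w \<in> U"
      proof (rule threes_span[OF U])
        show "y s i * y s i * y s i = 0" if "1 \<le> i" "i \<le> r" for i
          using that cubes by (simp add: y_def)
        show "val (y s) v \<in> U" if "v \<in> B_threes r (s + l)" for v
        proof -
          have "concat (map (\<lambda>i. if r + 1 \<le> i \<and> i \<le> r + s then [i, i] else [i]) v) \<in> B_words r s l"
            using that by (auto simp: B_words_def)
          moreover have "val x (concat (map (\<lambda>i. if r + 1 \<le> i \<and> i \<le> r + s then [i, i] else [i]) v)) = val (y s) v"
            by (induction v) (auto simp: y_def mult.assoc)
          ultimately show ?thesis using B by metis
        qed
        show "mset w = mset [1..<r + 1] + mset [1..<r + 1] + mset [1..<r + 1] + mset [r + 1..<r + (s + l) + 1]"
          unfolding w DE[symmetric] by (simp add: N_def D'_def del: upt_Suc)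
      qed
    qed
  next
    case (step k)
    define i where "i = r + k + 1"
    have D': "D' k = D' (Suc k) + {#i#}"
      using step.hyps by (simp add: D'_def i_def upt_conv_Cons del: upt_Suc)
    have iD: "i \<in># D" using step.hyps by (simp add: D_def i_def del: upt_Suc)
    have y: "y (Suc k) = (y k)(i := y k i * y k i)"
      by (auto simp: y_def i_def fun_eq_iff)
    define M where "M = N + N + N + (D - {#i#}) + D' (Suc k) + E"
    have cD: "count D i = 1" using iD by (simp add: D_def i_def count_mset_upt del: upt_Suc)
    have iM: "i \<notin># M"
      unfolding not_in_iff M_def using cD by (simp add: N_def D'_def E_def i_def count_mset_upt del: upt_Suc mset_upt) (use step.hyps in simp)
    show ?case
    proof (intro allI impI)
      fix w assume "mset w = N + N + N + D + D' k + E"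
      then have "mset w = M + {#i, i#}" using iD by (simp add: M_def D')
      then show "val (y k) w \<in> U"
      proof (rule square_letter[OF U iM, rotated])
        fix w assume "mset w = M + {#i#}"
        then have "mset w = N + N + N + D + D' (Suc k) + E" using iD by (simp add: M_def)
        then show "val ((y k)(i := y k i * y k i)) w \<in> U" unfolding y[symmetric] using step.IH by blast
      qed
    qed
  qed
  from this[of 0] w have "val (y 0) w \<in> U" by (simp add: D'_def D_def)
  moreover have "y 0 = x" by (auto simp: y_def fun_eq_iff)
  ultimately show ?thesis by simp
qed

lemma high_degree_zero:
  assumes cube: "x i * x i * x i = (0 :: 'a)" and w: "count (mset w) i \<ge> 4"
  shows "val x w = 0"
proof -
  have U: "additive_subgroup {0 :: 'a}" by (simp add: additive_subgroup_def)
  have "val x w \<in> {0}"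
  proof (rule words_from_pbw[OF U _ refl])
    fix u S
    assume uS: "mset u + mset S = mset w" and S: "distinct S"
      and short: "\<And>u' S'. mset u' + mset S' = mset w \<Longrightarrow> length u' < length u \<Longrightarrow> pbw x u' S' \<in> {0}"
    have "count (mset u) i + count (mset S) i = count (mset w) i" using arg_cong[OF uS, of "\<lambda>m. count m i"] by simp
    moreover have "count (mset S) i \<le> 1" using S distinct_count_atmost_1[of S] by simp
    ultimately have "count (mset u) i \<ge> 3" using w by linarith
    from cubed_letter[OF U short uS this cube] show "pbw x u S \<in> {0}" .
  qed
  then show ?thesis by simp
qed

end

lemma card_B_multilinear: "finite (B_multilinear d) \<and> card (B_multilinear d) + d \<le> 2 ^ d"
proof (induction d rule: B_multilinear.induct)
  case (3 n)
  let ?B = "B_multilinear (Suc n)"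
  let ?E = "e_word (Suc (Suc n)) ` {3..Suc (Suc n)}"
  have E: "{e_word (Suc (Suc n)) k | k. 3 \<le> k \<and> k \<le> Suc (Suc n)} = ?E" by auto
  have fin: "finite ?B" using "3.IH" by blast
  have "card (B_multilinear (Suc (Suc n))) \<le> card ?B + card ?B + n"
  proof -
    have "card ?E \<le> n" using card_image_le[of "{3..Suc (Suc n)}" "e_word (Suc (Suc n))"] by simp
    moreover have "card (f ` ?B) \<le> card ?B" for f :: "nat list \<Rightarrow> nat list" by (rule card_image_le[OF fin])
    ultimately show ?thesis unfolding B_multilinear.simps E
      by (intro order.trans[OF card_Un_le] add_mono)
  qed
  moreover have "finite (B_multilinear (Suc (Suc n)))" unfolding B_multilinear.simps E using fin by simp
  moreover have "card ?B + Suc n \<le> 2 ^ Suc n" using "3.IH" by blast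
  moreover have "(2 :: nat) ^ Suc (Suc n) = 2 ^ Suc n + 2 ^ Suc n" by simp
  ultimately show ?case by linarith
qed simp_all

lemma card_B_even: "finite (B_even r s) \<and> card (B_even r s) + (if r = 0 then s else 0) \<le> 2 ^ s"
proof -
  let ?f = "\<lambda>v. u_word r @ map (\<lambda>i. i + 2 * r) v"
  let ?Q = "if r = 0 then {} else q_even r s ` {1..s}"
  have Q: "{q_even r s k | k. 1 \<le> r \<and> 1 \<le> s \<and> 1 \<le> k \<and> k \<le> s} = ?Q" by auto
  note eq = B_even_def[of r s, unfolded Q]
  note ml = card_B_multilinear[of s]
  have "card (?f ` B_multilinear s) \<le> card (B_multilinear s)" using ml by (intro card_image_le) blast
  moreover have "card ?Q \<le> (if r = 0 then 0 else s)" using card_image_le[of "{1..s}" "q_even r s"] by simp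
  ultimately have "card (B_even r s) \<le> card (B_multilinear s) + (if r = 0 then 0 else s)"
    unfolding eq by (intro order.trans[OF card_Un_le] add_mono)
  moreover have "finite (B_even r s)" unfolding eq using ml by simp
  ultimately show ?thesis using ml by (simp split: if_splits)
qed

lemma card_B_odd: "finite (B_odd r s) \<and> card (B_odd r s) + (if r = 0 then 1 else 0) \<le> 2 ^ s"
proof -
  let ?f = "\<lambda>v. u_word r @ [2*r + 1, 2*r + 1, 2*r + 2] @ map (\<lambda>i. if i = 1 then 2*r + 1 else i + 2*r + 1) v"
  let ?F = "if s = 0 then {} else ?f ` B_multilinear s"
  let ?Q = "q_odd r s ` {3..s + 1}"
  let ?R = "if 1 \<le> r then {q_odd_last r s} else {}"
  have Q: "{q_odd r s k | k. 2 \<le> s \<and> 3 \<le> k \<and> k \<le> s + 1} = ?Q" by auto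
  note eq = B_odd_def[of r s, unfolded Q]
  note ml = card_B_multilinear[of s]
  have "card (?f ` B_multilinear s) \<le> card (B_multilinear s)" using ml by (intro card_image_le) blast
  then have F: "card ?F \<le> (if s = 0 then 0 else card (B_multilinear s))" by simp
  have Q: "card ?Q \<le> s - 1" using card_image_le[of "{3..s + 1}" "q_odd r s"] by simp
  have R: "card ?R \<le> (if r = 0 then 0 else 1)" by simp
  have "card (B_odd r s) \<le> (if s = 0 then 0 else card (B_multilinear s)) + (s - 1) + (if r = 0 then 0 else 1)"
    unfolding eq by (intro order.trans[OF card_Un_le] add_mono F Q R)
  moreover have "finite (B_odd r s)" unfolding eq using ml by simp
  ultimately show ?thesis using ml by (cases "s = 0") (simp_all split: if_splits)
qed

text \<open>
  The sets \<open>S\<close> for which \<open>C\<^sub>S\<close> survives in degree \<open>3\<^sup>r2\<^sup>s1\<^sup>l\<close>, where \<open>d = r + s + l\<close>.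
\<close>

definition pbw_index :: "nat \<Rightarrow> nat \<Rightarrow> nat set set" where
  "pbw_index r d = {S. {1..r} \<subseteq> S \<and> S \<subseteq> {1..d} \<and> card S \<noteq> 1}"

text \<open>
  The second summand counts the sets of size 1, which are excluded.
\<close>

lemma card_pbw_index:
  assumes "r \<le> d"
  shows "2 ^ (d - r) = card (pbw_index r d) + (if r = 0 then d else if r = 1 then 1 else 0)"
proof -
  let ?A = "{r + 1..d}"
  define I where "I = {T. T \<subseteq> ?A \<and> r + card T \<noteq> 1}"
  have un: "card ({1..r} \<union> T) = r + card T" if "T \<subseteq> ?A" for T
  proof -
    have "finite T" using that by (rule finite_subset) simp
    moreover have "{1..r} \<inter> T = {}" using that by auto
    ultimately show ?thesis by (simp add: card_Un_disjoint)
  qed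
  have "bij_betw (\<lambda>T. {1..r} \<union> T) I (pbw_index r d)"
  proof (rule bij_betw_byWitness[where f' = "\<lambda>S. S - {1..r}"])
    show "(\<lambda>T. {1..r} \<union> T) ` I \<subseteq> pbw_index r d"
    proof
      fix S assume "S \<in> (\<lambda>T. {1..r} \<union> T) ` I"
      then obtain T where T: "T \<subseteq> ?A" "r + card T \<noteq> 1" "S = {1..r} \<union> T" by (auto simp: I_def)
      then have "card S \<noteq> 1" using un by simp
      then show "S \<in> pbw_index r d" using T assms by (auto simp: pbw_index_def)
    qed
    show "(\<lambda>S. S - {1..r}) ` pbw_index r d \<subseteq> I"
    proof
      fix T assume "T \<in> (\<lambda>S. S - {1..r}) ` pbw_index r d"
      then obtain S where S: "{1..r} \<subseteq> S" "S \<subseteq> {1..d}" "card S \<noteq> 1" "T = S - {1..r}" by (auto simp: pbw_index_def)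
      then have "T \<subseteq> ?A" "S = {1..r} \<union> T" by auto
      then show "T \<in> I" using S(3) un by (auto simp: I_def)
    qed
  qed (auto simp: I_def pbw_index_def)
  then have c: "card (pbw_index r d) = card I" by (simp add: bij_betw_same_card)
  have P: "Pow ?A = I \<union> {T. T \<subseteq> ?A \<and> r + card T = 1}" by (auto simp: I_def)
  have "card (Pow ?A) = card I + card {T. T \<subseteq> ?A \<and> r + card T = 1}"
    unfolding P by (rule card_Un_disjoint) (auto simp: I_def)
  moreover have "card {T. T \<subseteq> ?A \<and> r + card T = 1} = (if r = 0 then d else if r = 1 then 1 else 0)"
  proof -
    consider "r = 0" | "r = 1" | "r \<ge> 2" by linarith
    then show ?thesis
    proof cases
      case 1
      then show ?thesis using n_subsets[of ?A 1] by simp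
    next
      case 2
      have "finite T" if "T \<subseteq> ?A" for T using that by (rule finite_subset) simp
      then have "T \<subseteq> ?A \<and> card T = 0 \<longleftrightarrow> T = {}" for T by (metis card_0_eq empty_subsetI)
      then have "{T. T \<subseteq> ?A \<and> card T = 0} = {{}}" by simp
      then show ?thesis using 2 by simp
    qed auto
  qed
  ultimately show ?thesis using c by (simp add: card_Pow)
qed

lemma card_B_words: "finite (B_words r s l) \<and> card (B_words r s l) \<le> card (pbw_index r (r + s + l))"
proof -
  have B: "finite (B_threes r (s + l)) \<and> card (B_threes r (s + l)) + (if r = 0 then s + l else if r = 1 then 1 else 0) \<le> 2 ^ (s + l)"
  proof (cases "even r")
    case True
    then obtain k where "r = 2 * k" by blast
    then show ?thesis using card_B_even[of k "s + l"] by (simp add: B_threes_def split: if_splits)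
  next
    case False
    then obtain k where "r = 2 * k + 1" by (elim oddE)
    then show ?thesis using card_B_odd[of k "s + l"] by (simp add: B_threes_def split: if_splits)
  qed
  moreover have "card (B_words r s l) \<le> card (B_threes r (s + l))"
    unfolding B_words_def using B by (intro card_image_le) blast
  moreover have "finite (B_words r s l)" unfolding B_words_def using B by blast
  moreover have "2 ^ (s + l) = card (pbw_index r (r + s + l)) + (if r = 0 then s + l else if r = 1 then 1 else 0)"
    using card_pbw_index[of r "r + s + l"] by (cases "r = 0") simp_all
  ultimately show ?thesis by linarith
qed

section \<open>Multidegrees of the words\<close>

lemma mset_upt_split: "a \<le> b \<Longrightarrow> b \<le> c \<Longrightarrow> mset [a..<c] = mset [a..<b] + mset [b..<c]"
  using upt_add_eq_append[of a b "c - b"] by (simp del: upt_Suc mset_upt flip: mset_append)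

lemma mset_B_multilinear: "v \<in> B_multilinear d \<Longrightarrow> mset v = mset [1..<d + 1]"
proof (induction d arbitrary: v rule: B_multilinear.induct)
  case (3 n)
  define D where "D = Suc (Suc n)"
  have D: "[1..<D + 1] = 1 # 2 # [3..<D + 1]"
    by (simp add: upt_conv_Cons D_def numeral_2_eq_2 numeral_3_eq_3)
  have s: "[1..<Suc n + 1] = 1 # [2..<D]" by (simp add: upt_conv_Cons D_def numeral_2_eq_2)
  have sh: "map (\<lambda>i. i + 1) [2..<D] = [3..<D + 1]" unfolding map_shift_upt by simp
  from "3.prems" consider v' where "v' \<in> B_multilinear (Suc n)" "v = 1 # map (\<lambda>i. i + 1) v'"
    | v' where "v' \<in> B_multilinear (Suc n)" "v = 2 # map (\<lambda>i. if i = 1 then 1 else i + 1) v'"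
    | k where "v = e_word D k" "3 \<le> k" "k \<le> D" by (auto simp: D_def)
  then have "mset v = mset [1..<D + 1]"
  proof cases
    case (1 v')
    then have "mset v = add_mset 1 (mset (map (\<lambda>i. i + 1) [1..<Suc n + 1]))"
      using "3.IH" by (simp del: upt_Suc mset_upt)
    then show ?thesis unfolding D s by (simp only: list.map sh) simp
  next
    case (2 v')
    have "mset v = add_mset 2 (mset (map (\<lambda>i. if i = 1 then 1 else i + 1) [1..<Suc n + 1]))"
      using 2 "3.IH" by (simp del: upt_Suc mset_upt)
    moreover have "map (\<lambda>i. if i = 1 then 1 else i + 1) [2..<D] = map (\<lambda>i. i + 1) [2..<D]" by simp
    ultimately show ?thesis unfolding D s by (simp only: list.map sh) simp
  next
    case (3 k)
    then have "mset [3..<D + 1] = mset [3..<k + 1] + mset [k + 1..<D + 1]" by (intro mset_upt_split) auto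
    then show ?thesis unfolding D 3(1) e_word_def by (simp del: upt_Suc mset_upt)
  qed
  then show ?case by (simp only: D_def)
qed simp_all

lemma mset_u_word: "mset (u_word r) = mset [1..<2 * r + 1] + mset [1..<2 * r + 1] + mset [1..<2 * r + 1]"
proof (induction r)
  case (Suc r)
  then show ?case unfolding u_word_simps upt_two_more w_word_def by (simp del: upt_Suc mset_upt)
qed (simp add: u_word_simps)

lemma mset_B_even:
  assumes "v \<in> B_even r s"
  shows "mset v = mset [1..<2 * r + 1] + mset [1..<2 * r + 1] + mset [1..<2 * r + 1] + mset [2 * r + 1..<2 * r + s + 1]"
  using assms unfolding B_even_def
proof (elim UnE)
  assume "v \<in> (\<lambda>v. u_word r @ map (\<lambda>i. i + 2 * r) v) ` B_multilinear s"
  then obtain v' where v': "v' \<in> B_multilinear s" "v = u_word r @ map (\<lambda>i. i + 2 * r) v'" by auto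
  then have "mset v = mset (u_word r) + mset (map (\<lambda>i. i + 2 * r) [1..<s + 1])"
    using mset_B_multilinear by (simp del: upt_Suc mset_upt)
  then show ?thesis unfolding map_shift_upt mset_u_word by (simp add: add_ac del: upt_Suc mset_upt)
next
  assume "v \<in> {q_even r s k | k. 1 \<le> r \<and> 1 \<le> s \<and> 1 \<le> k \<and> k \<le> s}"
  then obtain k where k: "v = q_even r s k" "1 \<le> r" "k \<le> s" by blast
  then obtain r' where r: "r = Suc r'" by (cases r) auto
  have "mset v = mset (u_word r' @ [2*r'+1, 2*r'+2] @ [2*r'+1, 2*r'+2] @ [2*r'+1, 2*r'+2]) + (mset [2*r+1..<2*r+k+1] + mset [2*r+k+1..<2*r+s+1])"
    unfolding k(1) q_even_def by (simp add: r del: upt_Suc mset_upt)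
  also have "mset [2*r+1..<2*r+k+1] + mset [2*r+k+1..<2*r+s+1] = mset [2*r+1..<2*r+s+1]"
    using k(3) by (intro mset_upt_split[symmetric]) auto
  also have "mset (u_word r' @ [2*r'+1, 2*r'+2] @ [2*r'+1, 2*r'+2] @ [2*r'+1, 2*r'+2]) = mset [1..<2 * r + 1] + mset [1..<2 * r + 1] + mset [1..<2 * r + 1]"
    unfolding r upt_two_more mset_append mset_u_word by (simp del: upt_Suc mset_upt)
  finally show ?thesis .
qed

lemma mset_B_odd:
  assumes "v \<in> B_odd r s"
  shows "mset v = mset [1..<2 * r + 2] + mset [1..<2 * r + 2] + mset [1..<2 * r + 2] + mset [2 * r + 2..<2 * r + s + 2]"
proof -
  define a b where ab: "a = 2 * r + 1" "b = 2 * r + 2"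
  have N: "mset [1..<2 * r + 2] = mset [1..<2 * r + 1] + {#a#}" by (simp add: ab)
  have O: "mset [2 * r + 2..<2 * r + s + 2] = add_mset b (mset [2 * r + 3..<2 * r + s + 2])" if "s \<ge> 1"
    using that by (simp add: ab upt_conv_Cons numeral_3_eq_3 del: upt_Suc mset_upt)
  from assms consider v' where "s \<noteq> 0" "v' \<in> B_multilinear s"
      "v = u_word r @ [a, a, b] @ map (\<lambda>i. if i = 1 then a else i + a) v'"
    | k where "2 \<le> s" "3 \<le> k" "k \<le> s + 1" "v = q_odd r s k"
    | "1 \<le> r" "v = q_odd_last r s"
    unfolding B_odd_def ab by (auto split: if_splits simp: add.assoc)
  then show ?thesis
  proof cases
    case (1 v')
    have "[1..<s + 1] = 1 # [2..<s + 1]" using 1 by (simp add: upt_conv_Cons numeral_2_eq_2 del: upt_Suc)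
    then have "map (\<lambda>i. if i = 1 then a else i + a) [1..<s + 1] = a # map (\<lambda>i. i + a) [2..<s + 1]"
      by (simp only: list.map) (auto intro!: map_cong)
    also have "map (\<lambda>i. i + a) [2..<s + 1] = [2 * r + 3..<2 * r + s + 2]"
      unfolding map_shift_upt by (simp add: ab add_ac numeral_3_eq_3 del: upt_Suc)
    finally have f: "map (\<lambda>i. if i = 1 then a else i + a) [1..<s + 1] = a # [2 * r + 3..<2 * r + s + 2]" .
    have "mset v = mset (u_word r) + {#a, a, b#} + mset (map (\<lambda>i. if i = 1 then a else i + a) [1..<s + 1])"
      using 1 mset_B_multilinear by (simp del: upt_Suc mset_upt)
    moreover have "s \<ge> 1" using 1 by simp
    ultimately show ?thesis unfolding f N mset_u_word by (simp only: O) (simp del: upt_Suc mset_upt)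
  next
    case (2 k)
    have "mset v = mset (u_word r) + {#a, a, a, b#} + (mset [2*r+3..<2*r+k+1] + mset [2*r+k+1..<2*r+s+2])"
      unfolding 2(4) q_odd_def by (simp add: ab del: upt_Suc mset_upt)
    also have "mset [2*r+3..<2*r+k+1] + mset [2*r+k+1..<2*r+s+2] = mset [2 * r + 3..<2 * r + s + 2]"
      using 2 by (intro mset_upt_split[symmetric]) auto
    moreover have "s \<ge> 1" using 2 by simp
    ultimately show ?thesis unfolding N mset_u_word by (simp only: O) (simp del: upt_Suc mset_upt)
  next
    case 3
    then obtain r' where r: "r = Suc r'" by (cases r) auto
    have "mset v = mset (u_word r' @ [2*r'+1, 2*r'+2] @ [2*r'+1, 2*r'+2] @ [2*r'+1, 2*r'+2]) + {#a, a, a#} + mset [2*r+2..<2*r+s+2]"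
      unfolding 3(2) q_odd_last_def by (simp add: r ab add_mset_commute del: upt_Suc mset_upt)
    also have "mset (u_word r' @ [2*r'+1, 2*r'+2] @ [2*r'+1, 2*r'+2] @ [2*r'+1, 2*r'+2]) = mset [1..<2 * r + 1] + mset [1..<2 * r + 1] + mset [1..<2 * r + 1]"
      unfolding r upt_two_more mset_append mset_u_word by (simp del: upt_Suc mset_upt)
    finally show ?thesis unfolding N by (simp del: upt_Suc mset_upt)
  qed
qed

lemma mset_B_threes:
  assumes "v \<in> B_threes n m"
  shows "mset v = mset [1..<n + 1] + mset [1..<n + 1] + mset [1..<n + 1] + mset [n + 1..<n + m + 1]"
proof (cases "even n")
  case True
  then obtain r where n: "n = 2 * r" by blast
  show ?thesis using mset_B_even[of v r m] assms by (simp add: n B_threes_def del: upt_Suc mset_upt)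
next
  case False
  then obtain r where n: "n = 2 * r + 1" by (elim oddE)
  have "2 * r + 1 + 1 = 2 * r + 2" "2 * r + 1 + m + 1 = 2 * r + m + 2" by simp_all
  then show ?thesis using mset_B_odd[of v r m] assms unfolding n by (simp only:) (simp add: B_threes_def del: upt_Suc mset_upt)
qed

lemma mset_double: "mset (concat (map (\<lambda>i. if P i then [i, i] else [i]) v)) = mset v + mset (filter P v)"
  by (induction v) auto

lemma mset_B_words:
  assumes "v \<in> B_words r s l"
  defines "N \<equiv> mset [1..<r + 1]" and "D \<equiv> mset [r + 1..<r + s + 1]" and "E \<equiv> mset [r + s + 1..<r + s + l + 1]"
  shows "mset v = N + N + N + D + D + E"
proof -
  let ?P = "\<lambda>i. r + 1 \<le> i \<and> i \<le> r + s"
  from assms(1) obtain v' where v': "v' \<in> B_threes r (s + l)" "v = concat (map (\<lambda>i. if ?P i then [i, i] else [i]) v')"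
    by (auto simp: B_words_def)
  have m: "mset v' = N + N + N + (D + E)"
    unfolding mset_B_threes[OF v'(1)] N_def D_def E_def
    by (subst mset_upt_split[of "r + 1" "r + s + 1"]) (simp_all add: add.assoc del: upt_Suc mset_upt)
  have "filter_mset ?P N = {#}" "filter_mset ?P E = {#}" "filter_mset ?P D = D"
    by (simp_all add: N_def E_def D_def mset_filter[symmetric] filter_empty_conv del: upt_Suc mset_upt)
  then have "mset (filter ?P v') = D" by (simp add: mset_filter m del: mset_upt)
  then show ?thesis unfolding v'(2) mset_double by (simp add: m add_ac)
qed

text \<open>
  The multiset of letters of the words of a given multidegree.
\<close>

definition content :: "nat list \<Rightarrow> nat multiset" where
  "content \<Delta> = (\<Sum>i\<in>{1..length \<Delta>}. replicate_mset (\<Delta> ! (i - 1)) i)"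

lemma count_content: "count (content \<Delta>) i = (if 1 \<le> i \<and> i \<le> length \<Delta> then \<Delta> ! (i - 1) else 0)"
  by (simp add: content_def count_sum if_distrib cong: if_cong)

lemma mset_eq_content_iff:
  "mset w = content \<Delta> \<longleftrightarrow> set w \<subseteq> {1..length \<Delta>} \<and> multideg (length \<Delta>) w = \<Delta>"
proof
  assume w: "mset w = content \<Delta>"
  have c: "count_list w i = count (content \<Delta>) i" for i by (simp add: w[symmetric] count_mset)
  have "set w \<subseteq> {1..length \<Delta>}"
  proof
    fix i assume "i \<in> set w"
    then have "count_list w i \<noteq> 0" by (simp add: count_list_0_iff)
    then show "i \<in> {1..length \<Delta>}" unfolding c count_content by (simp split: if_splits)
  qed
  moreover have "multideg (length \<Delta>) w = \<Delta>"
    by (rule nth_equalityI) (simp_all add: multideg_def c count_content del: upt_Suc)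
  ultimately show "set w \<subseteq> {1..length \<Delta>} \<and> multideg (length \<Delta>) w = \<Delta>" ..
next
  assume w: "set w \<subseteq> {1..length \<Delta>} \<and> multideg (length \<Delta>) w = \<Delta>"
  show "mset w = content \<Delta>"
  proof (rule multiset_eqI)
    fix i
    show "count (mset w) i = count (content \<Delta>) i"
    proof (cases "1 \<le> i \<and> i \<le> length \<Delta>")
      case True
      then have "\<Delta> ! (i - 1) = multideg (length \<Delta>) w ! (i - 1)" using w by simp
      also have "\<dots> = count_list w i" unfolding multideg_def
        by (subst nth_map) (use True in \<open>auto simp del: upt_Suc\<close>)
      finally show ?thesis using True by (simp add: count_content count_mset)
    next
      case False
      then have "i \<notin> set w" using w by auto
      with False show ?thesis by (auto simp: count_content count_eq_zero_iff)
    qed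
  qed
qed

lemma content_321:
  "content (multideg_321 r s l) = mset [1..<r + 1] + mset [1..<r + 1] + mset [1..<r + 1] +
    mset [r + 1..<r + s + 1] + mset [r + 1..<r + s + 1] + mset [r + s + 1..<r + s + l + 1]"
  by (rule multiset_eqI)
    (auto simp: count_content multideg_321_def count_mset_upt nth_append simp del: upt_Suc mset_upt)

section \<open>Bases of the homogeneous components\<close>

text \<open>
  The functional at a set \<open>T\<close> is nonzero on the element of \<open>T\<close> and vanishes on that of \<open>S\<close>
  unless \<open>S\<close> is a subset of \<open>T\<close>; so the coefficients vanish by induction on the size of \<open>T\<close>.
\<close>

lemma pbw_words_independent:
  fixes c :: "nat set \<Rightarrow> 'k::field"
  assumes three: "(3 :: 'k) = 0"
    and M: "\<And>i. count M i \<le> 3" "\<And>i. count M i = 3 \<Longrightarrow> i \<in> R" "set_mset M \<subseteq> {..<n}"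
    and I: "finite I" "\<And>S. S \<in> I \<Longrightarrow> finite S \<and> R \<subseteq> S \<and> card S \<noteq> 1 \<and> mset (sorted_list_of_set S) + mset (w S) = M"
    and zero: "(\<Sum>S\<in>I. scale_nil (c S) (comm_prod (map letter (sorted_list_of_set S)) * val letter (w S))) = 0"
    and T: "T \<in> I"
  shows "c T = 0"
  using T
proof (induction "card T" arbitrary: T rule: less_induct)
  case less
  define x :: "nat set \<Rightarrow> 'k free" where "x S = comm_prod (map (\<lambda>i. monom [i] 1) (sorted_list_of_set S)) * monom (w S) 1" for S
  let ?l = "linear_extension (pbw_functional n M T) :: 'k free \<Rightarrow> 'k"
  have T: "finite T" "R \<subseteq> T" using I(2)[OF less.prems] by auto
  have "cls (\<Sum>S\<in>I. monom [] (c S) * x S) = 0"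
    using zero by (simp add: cls_sum cls_hom x_def comm_prod_letter val_letter scale_nil_def)
  then have "(\<Sum>S\<in>I. monom [] (c S) * x S) \<in> nil_ideal" by (simp only: cls_eq_0_iff)
  then have "?l (\<Sum>S\<in>I. monom [] (c S) * x S) = 0"
    using M T by (intro pbw_functional_vanishes[OF three]) auto
  then have sum: "(\<Sum>S\<in>I. c S * ?l (x S)) = 0" by (simp add: linear_extension_sum linear_extension_scale)
  have tri: "(\<not> S \<subseteq> T \<longrightarrow> ?l (x S) = 0) \<and> (S = T \<longrightarrow> ?l (x S) \<noteq> 0)" if S: "S \<in> I" for S
  proof -
    let ?S = "sorted_list_of_set S"
    have f: "finite S" "card S \<noteq> 1" "mset ?S + mset (w S) = M" using I(2)[OF S] by auto
    have "S \<subseteq> set_mset (mset ?S + mset (w S))" using f(1) by simp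
    then have "set ?S \<subseteq> {..<n}" using f M(3) by auto
    then show ?thesis
      using pbw_functional_triangular[OF three _ _ _ f(3) T(1), of n] f by (auto simp: x_def)
  qed
  have "c S * ?l (x S) = 0" if "S \<in> I - {T}" for S
  proof (cases "S \<subseteq> T")
    case True
    then have "card S < card T" using that T(1) by (intro psubset_card_mono) auto
    then show ?thesis using less.hyps that by simp
  next
    case False
    then show ?thesis using tri that by simp
  qed
  then have "(\<Sum>S\<in>I - {T}. c S * ?l (x S)) = 0" by (intro sum.neutral) blast
  then have "(\<Sum>S\<in>I. c S * ?l (x S)) = c T * ?l (x T)" using less.prems I(1) by (simp add: sum.remove)
  then show ?case using sum tri[OF less.prems] by simp
qed

lemma (in vector_space) independent_family:
  assumes I: "finite I" and indep: "\<And>c. (\<Sum>i\<in>I. c i *s f i) = 0 \<Longrightarrow> \<forall>i\<in>I. c i = 0"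
  shows "inj_on f I \<and> independent (f ` I)"
proof
  show inj: "inj_on f I"
  proof (rule inj_onI, rule ccontr)
    fix i j assume ij: "i \<in> I" "j \<in> I" "f i = f j" "i \<noteq> j"
    let ?c = "\<lambda>k. if k = i then 1 else if k = j then - 1 else (0 :: 'a)"
    have "(\<Sum>k\<in>I. ?c k *s f k) = (\<Sum>k\<in>{i, j}. ?c k *s f k)"
      using I ij by (intro sum.mono_neutral_right) auto
    also have "\<dots> = 0" using ij by simp
    finally have "\<forall>k\<in>I. ?c k = 0" by (rule indep[of ?c])
    with ij(1) show False by force
  qed
  show "independent (f ` I)"
  proof (rule independent_if_scalars_zero)
    fix g x assume "(\<Sum>x\<in>f ` I. g x *s x) = 0" "x \<in> f ` I"
    then show "g x = 0" using indep[of "\<lambda>i. g (f i)"] by (auto simp: sum.reindex[OF inj])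
  qed (use I in simp)
qed

text \<open>
  A spanning family with at most as many members as an independent set has no redundant member.
\<close>

lemma (in vector_space) spanning_family_independent:
  assumes B: "finite B" and F: "independent F" "F \<subseteq> span (g ` B)" "card B \<le> card F"
    and zero: "(\<Sum>b\<in>B. c b *s g b) = 0" and b: "b \<in> B"
  shows "c b = 0"
proof -
  have bound: "card F \<le> card G" if "F \<subseteq> span G" "finite G" for G
    using independent_span_bound[OF that(2) F(1) that(1)] by blast
  have "card (g ` B) = card B"
    using bound[OF F(2)] F(3) card_image_le[OF B, of g] B by (simp add: order_antisym)
  then have inj: "inj_on g B" by (rule eq_card_imp_inj_on[OF B])
  have "independent (g ` B)"
  proof (rule notI)
    assume "dependent (g ` B)"
    then obtain x where x: "x \<in> g ` B" "x \<in> span (g ` B - {x})" unfolding dependent_def by blast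
    then have "span (g ` B - {x}) = span (g ` B)" by (metis insert_Diff span_redundant)
    with F(2) have "card F \<le> card (g ` B - {x})" using B by (intro bound) auto
    moreover have "card (g ` B - {x}) < card (g ` B)" using x(1) B by (intro psubset_card_mono) auto
    ultimately show False using F(3) \<open>card (g ` B) = card B\<close> by linarith
  qed
  moreover have "(\<Sum>x\<in>g ` B. c (inv_into B g x) *s x) = 0"
    using zero by (simp add: sum.reindex[OF inj] inj)
  ultimately have "c (inv_into B g (g b)) = 0"
    using independentD[of "g ` B" "g ` B" "\<lambda>x. c (inv_into B g x)" "g b"] B b by simp
  then show ?thesis using inj b by simp
qed

lemma additive_subgroup_span: "additive_subgroup (nil_vs.span X)"
  by (simp add: additive_subgroup_def nil_vs.span_zero nil_vs.span_diff)

lemma B_words_span: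
  assumes three: "(3 :: 'k::field) = 0" and w: "mset w = content (multideg_321 r s l)"
  shows "val letter w \<in> nil_vs.span (val letter ` B_words r s l :: 'k nil_quot set)"
proof -
  interpret engel_ring "TYPE('k nil_quot)" by (rule engel_ring_nil_quot[OF three])
  show ?thesis
    by (rule words_span[OF additive_subgroup_span letter_cube _ w[unfolded content_321]]) (simp add: nil_vs.span_base)
qed

text \<open>
  The words span a space that contains the independent elements \<open>C\<^sub>S w\<close>, one for each set in
  \<open>pbw_index\<close>, and there are not more words than such sets.
\<close>

lemma B_words_independent:
  fixes c :: "nat list \<Rightarrow> 'k::field"
  assumes three: "(3 :: 'k) = 0"
    and zero: "(\<Sum>w\<in>B_words r s l. scale_nil (c w) (val letter w)) = 0" and b: "b \<in> B_words r s l"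
  shows "c b = 0"
proof -
  interpret engel_ring "TYPE('k nil_quot)" by (rule engel_ring_nil_quot[OF three])
  define d where "d = r + s + l"
  define M where "M = content (multideg_321 r s l)"
  define I where "I = pbw_index r d"
  have len: "length (multideg_321 r s l) = d" by (simp add: multideg_321_def d_def)
  have cM: "count M i = (if 1 \<le> i \<and> i \<le> d then if i \<le> r then 3 else if i \<le> r + s then 2 else 1 else 0)" for i
    unfolding M_def count_content len by (auto simp: multideg_321_def d_def nth_append)
  have I_fin: "finite I" unfolding I_def pbw_index_def by (rule finite_subset[of _ "Pow {1..d}"]) auto
  have "\<exists>w. mset (sorted_list_of_set S) + mset w = M" if S: "S \<in> I" for S
  proof -
    have fS: "finite S" "S \<subseteq> {1..d}" using S finite_subset[of S "{1..d}"] by (auto simp: I_def pbw_index_def)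
    have "mset (sorted_list_of_set S) \<subseteq># M"
    proof (rule mset_subset_eqI)
      fix i show "count (mset (sorted_list_of_set S)) i \<le> count M i"
        using fS distinct_count_atmost_1[of "sorted_list_of_set S"] by (auto simp: cM)
    qed
    then obtain N where "M = mset (sorted_list_of_set S) + N" by (auto simp: subset_mset.le_iff_add)
    then show ?thesis by (metis ex_mset)
  qed
  then obtain w where w: "\<And>S. S \<in> I \<Longrightarrow> mset (sorted_list_of_set S) + mset (w S) = M" by metis
  define f :: "nat set \<Rightarrow> 'k nil_quot" where "f S = comm_prod (map letter (sorted_list_of_set S)) * val letter (w S)" for S
  have f: "inj_on f I \<and> nil_vs.independent (f ` I)"
  proof (rule nil_vs.independent_family[OF I_fin], rule ballI)
    fix c :: "nat set \<Rightarrow> 'k" and S assume c: "(\<Sum>S\<in>I. scale_nil (c S) (f S)) = 0" and S: "S \<in> I"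
    show "c S = 0"
    proof (rule pbw_words_independent[where c = c and I = I and w = w and M = M and R = "{1..r}" and n = "d + 1" and T = S])
      show "count M i \<le> 3" for i by (simp add: cM)
      show "i \<in> {1..r}" if "count M i = 3" for i using that by (auto simp: cM split: if_splits)
      show "set_mset M \<subseteq> {..<d + 1}" by (auto simp: cM set_mset_def split: if_splits)
      show "finite S \<and> {1..r} \<subseteq> S \<and> card S \<noteq> 1 \<and> mset (sorted_list_of_set S) + mset (w S) = M" if "S \<in> I" for S
        using that w finite_subset[of S "{1..d}"] by (auto simp: I_def pbw_index_def)
    qed (use assms(1) I_fin c S in \<open>simp_all add: f_def\<close>)
  qed
  have "f S \<in> nil_vs.span (val letter ` B_words r s l)" if "S \<in> I" for S
    using expand_in[OF additive_subgroup_span, of "[]" "sorted_list_of_set S" "w S" letter "val letter ` B_words r s l"]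
      B_words_span[OF assms(1)] w[OF that] by (simp add: f_def M_def)
  then have "f ` I \<subseteq> nil_vs.span (val letter ` B_words r s l)" by blast
  moreover have "card (B_words r s l) \<le> card (f ` I)"
    using card_B_words[of r s l] f by (simp add: card_image I_def d_def)
  ultimately show ?thesis
    using nil_vs.spanning_family_independent[OF _ _ _ _ zero b] f card_B_words[of r s l] by blast
qed

lemma nil_class_eq_iff: "nil_class d a = nil_class d b \<longleftrightarrow> a - b \<in> cube_ideal d"
proof
  assume "nil_class d a = nil_class d b"
  moreover have "a \<in> nil_class d a" unfolding nil_class_alt using cube_ideal.zero by force
  ultimately have "a \<in> nil_class d b" by simp
  then show "a - b \<in> cube_ideal d" by (auto simp: nil_class_alt)
next
  assume "a - b \<in> cube_ideal d"
  from nil_class_absorb[OF this, of b] show "nil_class d a = nil_class d b" by simp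
qed

definition homogeneous :: "nat list \<Rightarrow> 'k::field free set" where
  "homogeneous \<Delta> = {a. \<forall>w\<in>Poly_Mapping.keys a. mset w = content \<Delta>}"

lemma carrier_nil_component:
  assumes "length \<Delta> = d" "1 \<le> d" "\<forall>\<delta>\<in>set \<Delta>. 1 \<le> \<delta>"
  shows "carrier (nil_component d \<Delta> :: ('k::field, 'k free set) module) = nil_class d ` homogeneous \<Delta>"
proof -
  have "mset w = content \<Delta> \<longleftrightarrow> (w \<noteq> [] \<and> set w \<subseteq> {1..d}) \<and> multideg d w = \<Delta>" for w
  proof -
    have "0 < length \<Delta>" using assms by simp
    then have "\<Delta> ! 0 \<in> set \<Delta>" by (rule nth_mem)
    then have "\<Delta> ! 0 \<ge> 1" using assms(3) by blast
    then have "count (content \<Delta>) 1 \<noteq> 0" using assms(1,2) unfolding count_content by auto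
    then have "mset w = content \<Delta> \<Longrightarrow> w \<noteq> []" by auto
    then show ?thesis using mset_eq_content_iff[of w \<Delta>] assms(1) by auto
  qed
  then have "{a \<in> carrier (free_alg d). \<forall>w\<in>Poly_Mapping.keys a. multideg d w = \<Delta>} = (homogeneous \<Delta> :: 'k free set)"
    by (auto simp: free_alg_def homogeneous_def)
  then show ?thesis by (simp add: nil_component_def)
qed

lemma homogeneous_letters: "a \<in> homogeneous \<Delta> \<Longrightarrow> \<forall>w\<in>Poly_Mapping.keys a. set w \<subseteq> {1..length \<Delta>}"
  using mset_eq_content_iff by (auto simp: homogeneous_def)

lemma homogeneous_cls:
  "a \<in> homogeneous \<Delta> \<Longrightarrow> cls a = (\<Sum>w\<in>Poly_Mapping.keys a. scale_nil (Poly_Mapping.lookup a w) (val letter w))"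
proof -
  have "a = (\<Sum>w\<in>Poly_Mapping.keys a. monom [] (Poly_Mapping.lookup a w) * monom w 1)"
    by (simp add: monom_mult sum_of_monoms)
  then have "cls a = cls (\<Sum>w\<in>Poly_Mapping.keys a. monom [] (Poly_Mapping.lookup a w) * monom w 1)" by simp
  then show ?thesis by (simp add: cls_sum cls_hom scale_nil_def val_letter)
qed

lemma word_sum_homogeneous:
  assumes "\<And>w. w \<in> B \<Longrightarrow> mset w = content \<Delta>"
  shows "(\<Sum>w\<in>B. monom w (c w)) \<in> homogeneous \<Delta>"
proof -
  have "Poly_Mapping.keys (\<Sum>w\<in>B. monom w (c w)) \<subseteq> B"
    using keys_sum[of "\<lambda>w. monom w (c w)" B] by (fastforce split: if_splits)
  with assms show ?thesis by (auto simp: homogeneous_def)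
qed

lemma homogeneous_diff: "a \<in> homogeneous \<Delta> \<Longrightarrow> b \<in> homogeneous \<Delta> \<Longrightarrow> a - b \<in> homogeneous \<Delta>"
  using keys_diff[of a b] by (auto simp: homogeneous_def)

lemma nil_class_eq_iff_cls:
  assumes "a \<in> homogeneous \<Delta>" "b \<in> homogeneous \<Delta>" "length \<Delta> = d"
  shows "nil_class d a = nil_class d b \<longleftrightarrow> cls a = cls b"
  using cube_ideal_iff[OF homogeneous_letters[OF homogeneous_diff[OF assms(1,2)]]] assms(3)
  by (simp add: nil_class_eq_iff cls_hom)

lemma cls_word_sum: "cls (\<Sum>w\<in>B. monom w (c w)) = (\<Sum>w\<in>B. scale_nil (c w) (val letter w))"
  by (simp add: cls_sum scale_nil_def val_letter cls_hom[symmetric] monom_mult)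

lemma nil_component_lincomb:
  fixes a :: "'k::field free set \<Rightarrow> 'k"
  assumes \<Delta>: "length \<Delta> = d" "1 \<le> d" "\<forall>\<delta>\<in>set \<Delta>. 1 \<le> \<delta>"
    and B: "finite B" "\<And>w. w \<in> B \<Longrightarrow> mset w = content \<Delta>" "inj_on (nil_word d :: nat list \<Rightarrow> 'k free set) B"
  shows "module.lincomb (nil_component d \<Delta>) a (nil_word d ` B) = nil_class d (\<Sum>w\<in>B. monom w (a (nil_word d w)))"
proof -
  let ?V = "nil_component d \<Delta> :: ('k, 'k free set) module"
  interpret V: vectorspace class_ring ?V by (rule vectorspace_nil_component)
  have carr: "nil_word d w \<in> carrier ?V" if "mset w = content \<Delta>" for w
    unfolding carrier_nil_component[OF \<Delta>] nil_word_def word_poly_def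
    using that by (intro imageI) (simp add: homogeneous_def)
  have ops: "add ?V = add (nil_alg d)" "\<zero>\<^bsub>?V\<^esub> = nil_class d 0" "module.smult ?V = module.smult (nil_alg d)"
    by (simp_all add: nil_component_def nil_alg_def nil_class_zero)
  show ?thesis
    using B
  proof (induction B)
    case empty
    show ?case by (simp add: V.lincomb_def ops)
  next
    case (insert w B)
    have "V.lincomb a (nil_word d ` B \<union> {nil_word d w}) =
      a (nil_word d w) \<odot>\<^bsub>?V\<^esub> nil_word d w \<oplus>\<^bsub>?V\<^esub> V.lincomb a (nil_word d ` B)"
      using insert.hyps insert.prems carr by (intro V.lincomb_insert) (auto simp: class_ring_simps)
    also have "V.lincomb a (nil_word d ` B) = nil_class d (\<Sum>w\<in>B. monom w (a (nil_word d w)))"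
      using insert by (auto simp: inj_on_def)
    also have "a (nil_word d w) \<odot>\<^bsub>?V\<^esub> nil_word d w = nil_class d (monom w (a (nil_word d w)))"
      by (simp add: ops nil_word_def nil_alg_smult word_poly_def monom_mult)
    finally show ?case using insert.hyps by (simp add: ops nil_alg_add)
  qed
qed

lemma sorted_321:
  assumes "sorted_wrt (\<ge>) \<Delta>" "\<forall>\<delta>\<in>set \<Delta>. 1 \<le> \<delta> \<and> \<delta> \<le> 3"
  shows "\<exists>r s l. \<Delta> = multideg_321 r s l"
  using assms
proof (induction \<Delta>)
  case Nil
  show ?case by (rule exI[of _ 0])+ (simp add: multideg_321_def)
next
  case (Cons x \<Delta>)
  then obtain r s l where \<Delta>: "\<Delta> = multideg_321 r s l" by auto
  from Cons.prems consider "x = 3" | "x = 2" | "x = 1" by fastforce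
  then show ?case
  proof cases
    case 1
    then show ?thesis using \<Delta> by (intro exI[of _ "Suc r"] exI[of _ s] exI[of _ l]) (simp add: multideg_321_def)
  next
    case 2
    have "r = 0"
    proof (rule ccontr)
      assume "r \<noteq> 0"
      then have "3 \<in> set \<Delta>" by (simp add: \<Delta> multideg_321_def)
      with Cons.prems(1) 2 show False by auto
    qed
    then show ?thesis using \<Delta> 2 by (intro exI[of _ 0] exI[of _ "Suc s"] exI[of _ l]) (simp add: multideg_321_def)
  next
    case 3
    have "r = 0 \<and> s = 0"
    proof (rule ccontr)
      assume "\<not> (r = 0 \<and> s = 0)"
      then have "3 \<in> set \<Delta> \<or> 2 \<in> set \<Delta>" by (auto simp: \<Delta> multideg_321_def)
      with Cons.prems(1) 3 show False by auto
    qed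
    then show ?thesis using \<Delta> 3 by (intro exI[of _ 0] exI[of _ 0] exI[of _ "Suc l"]) (simp add: multideg_321_def)
  qed
qed

lemma B_words_basis:
  assumes char3: "(3 :: 'k::field) = 0" and d: "d = r + s + l" "1 \<le> d"
  shows "inj_on (nil_word d :: nat list \<Rightarrow> 'k free set) (B_words r s l)"
    "vectorspace.basis class_ring (nil_component d (multideg_321 r s l) :: ('k, 'k free set) module)
      (nil_word d ` B_words r s l)"
proof -
  define \<Delta> where "\<Delta> = multideg_321 r s l"
  define B where "B = B_words r s l"
  let ?V = "nil_component d \<Delta> :: ('k, 'k free set) module"
  have \<Delta>: "length \<Delta> = d" "1 \<le> d" "\<forall>\<delta>\<in>set \<Delta>. 1 \<le> \<delta>"
    using d by (auto simp: \<Delta>_def multideg_321_def)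
  have fin: "finite B" using card_B_words by (simp add: B_def)
  have B: "mset w = content \<Delta>" if "w \<in> B" for w
    using mset_B_words[of w r s l] that by (simp only: B_def \<Delta>_def content_321)
  have indep: "\<forall>w\<in>B. c w = 0" if "(\<Sum>w\<in>B. scale_nil (c w) (val letter w)) = 0" for c :: "nat list \<Rightarrow> 'k"
    using B_words_independent[OF char3] that unfolding B_def by blast
  have inj_val: "inj_on (val letter :: nat list \<Rightarrow> 'k nil_quot) B"
    using nil_vs.independent_family[OF fin indep] by blast
  have hom: "word_poly w \<in> (homogeneous \<Delta> :: 'k free set)" if "mset w = content \<Delta>" for w
    using that by (simp add: homogeneous_def word_poly_def)
  have inj: "inj_on (nil_word d :: nat list \<Rightarrow> 'k free set) B"
  proof (rule inj_onI)
    fix v w assume vw: "v \<in> B" "w \<in> B" "nil_word d v = (nil_word d w :: 'k free set)"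
    then have "cls (word_poly v :: 'k free) = cls (word_poly w)"
      using nil_class_eq_iff_cls[OF hom[OF B[OF vw(1)]] hom[OF B[OF vw(2)]] \<Delta>(1)] by (simp only: nil_word_def)
    then have "val letter v = (val letter w :: 'k nil_quot)" by (simp add: val_letter word_poly_def)
    from inj_onD[OF inj_val this vw(1,2)] show "v = w" .
  qed
  then show "inj_on (nil_word d :: nat list \<Rightarrow> 'k free set) (B_words r s l)" by (simp add: B_def)
  interpret V: vectorspace class_ring ?V by (rule vectorspace_nil_component)
  have carrier: "carrier ?V = nil_class d ` homogeneous \<Delta>" by (rule carrier_nil_component[OF \<Delta>])
  have sub: "nil_word d ` B \<subseteq> carrier ?V"
    unfolding carrier nil_word_def by (intro image_subsetI imageI hom B)
  have zero: "\<zero>\<^bsub>?V\<^esub> = nil_class d 0" by (simp add: nil_component_def nil_alg_def nil_class_zero)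
  have lincomb: "V.lincomb a (nil_word d ` B) = nil_class d (\<Sum>w\<in>B. monom w (a (nil_word d w)))" for a
    by (rule nil_component_lincomb[OF \<Delta> fin _ inj]) (rule B)
  have zero_hom: "(0 :: 'k free) \<in> homogeneous \<Delta>" by (simp add: homogeneous_def)
  have word_sum: "(\<Sum>w\<in>B. monom w (c w)) \<in> homogeneous \<Delta>" for c :: "nat list \<Rightarrow> 'k"
    by (rule word_sum_homogeneous) (rule B)
  have "V.lin_indpt (nil_word d ` B)"
  proof (rule V.finite_lin_indpt2)
    fix a assume "V.lincomb a (nil_word d ` B) = \<zero>\<^bsub>?V\<^esub>"
    then have "nil_class d (\<Sum>w\<in>B. monom w (a (nil_word d w))) = nil_class d 0" by (simp only: lincomb zero)
    then have "cls (\<Sum>w\<in>B. monom w (a (nil_word d w))) = cls 0"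
      by (rule nil_class_eq_iff_cls[OF word_sum zero_hom \<Delta>(1), THEN iffD1])
    then have "(\<Sum>w\<in>B. scale_nil (a (nil_word d w)) (val letter w)) = 0" by (simp only: cls_word_sum cls_hom)
    then have "\<forall>w\<in>B. a (nil_word d w) = 0" by (rule indep)
    then have "\<forall>v\<in>nil_word d ` B. a v = 0" by blast
    then show "\<forall>v\<in>nil_word d ` B. a v = \<zero>\<^bsub>class_ring\<^esub>" by (simp only: class_ring_simps)
  qed (simp_all only: finite_imageI[OF fin] sub)
  moreover have "V.gen_set (nil_word d ` B)"
  proof (rule antisym)
    show "V.span (nil_word d ` B) \<subseteq> carrier ?V" using sub by (rule V.span_is_subset2)
    show "carrier ?V \<subseteq> V.span (nil_word d ` B)"
    proof
      fix X assume "X \<in> carrier ?V"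
      then obtain a where a: "a \<in> homogeneous \<Delta>" "X = nil_class d a" unfolding carrier by blast
      have "cls a \<in> nil_vs.span (val letter ` B)"
        unfolding homogeneous_cls[OF a(1)] B_def
        by (intro nil_vs.span_sum nil_vs.span_scale B_words_span[OF char3])
          (use a(1) in \<open>auto simp: homogeneous_def \<Delta>_def\<close>)
      then obtain u where "cls a = (\<Sum>v\<in>val letter ` B. scale_nil (u v) v)"
        unfolding nil_vs.span_finite[OF finite_imageI[OF fin]] by blast
      then have u: "cls a = (\<Sum>w\<in>B. scale_nil (u (val letter w)) (val letter w))"
        by (simp only: sum.reindex[OF inj_val] o_def)
      define c where "c = (\<lambda>Y :: 'k free set. u (val letter (inv_into B (nil_word d) Y)) :: 'k)"
      have c: "c (nil_word d w) = u (val letter w)" if "w \<in> B" for w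
        using that inj by (simp add: c_def)
      have "cls a = cls (\<Sum>w\<in>B. monom w (c (nil_word d w)))"
        unfolding cls_word_sum u by (simp add: c)
      then have "X = V.lincomb c (nil_word d ` B)"
        unfolding lincomb a(2) by (intro nil_class_eq_iff_cls[OF a(1) word_sum \<Delta>(1), THEN iffD2])
      then show "X \<in> V.span (nil_word d ` B)"
        unfolding V.span_def mem_Collect_eq
        by (intro exI[of _ c] exI[of _ "nil_word d ` B"] conjI) (simp_all add: fin class_ring_simps)
    qed
  qed
  ultimately show "vectorspace.basis class_ring (nil_component d (multideg_321 r s l) :: ('k, 'k free set) module)
      (nil_word d ` B_words r s l)"
    unfolding V.basis_def B_def[symmetric] \<Delta>_def[symmetric] by (intro conjI sub) blast+
qed

text \<open>
  Some letter has degree at least 4, so it occurs three times in the word \<open>u\<close> of every \<open>u C\<^sub>S\<close>.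
\<close>

lemma nil_component_trivial:
  assumes char3: "(3 :: 'k::field) = 0" and \<Delta>: "length \<Delta> = d" "1 \<le> d" "\<forall>\<delta>\<in>set \<Delta>. 1 \<le> \<delta>" "\<exists>\<delta>\<in>set \<Delta>. \<delta> \<ge> 4"
  shows "carrier (nil_component d \<Delta> :: ('k, 'k free set) module) = {\<zero>\<^bsub>nil_alg d\<^esub>}"
proof -
  interpret engel_ring "TYPE('k nil_quot)" by (rule engel_ring_nil_quot[OF char3])
  have zero_hom: "(0 :: 'k free) \<in> homogeneous \<Delta>" by (simp add: homogeneous_def)
  obtain i where i: "i < length \<Delta>" "\<Delta> ! i \<ge> 4" using \<Delta>(4) by (auto simp: in_set_conv_nth)
  have word_zero: "val letter w = (0 :: 'k nil_quot)" if w: "mset w = content \<Delta>" for w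
  proof (rule high_degree_zero[OF letter_cube])
    show "4 \<le> count (mset w) (Suc i)" unfolding w count_content using i by simp
  qed
  have cls_zero: "cls a = cls 0" if a: "a \<in> homogeneous \<Delta>" for a :: "'k free"
    unfolding homogeneous_cls[OF a] cls_hom
  proof (rule sum.neutral, rule ballI)
    fix w assume "w \<in> Poly_Mapping.keys a"
    then have "mset w = content \<Delta>" using a by (simp add: homogeneous_def)
    then show "scale_nil (Poly_Mapping.lookup a w) (val letter w) = 0"
      by (simp only: word_zero nil_vs.scale_zero_right)
  qed
  have "nil_class d a = nil_class d 0" if "a \<in> homogeneous \<Delta>" for a :: "'k free"
    by (rule nil_class_eq_iff_cls[OF that zero_hom \<Delta>(1), THEN iffD2, OF cls_zero[OF that]])
  then have "nil_class d ` homogeneous \<Delta> = {nil_class d (0 :: 'k free)}" using zero_hom by blast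
  then show ?thesis
    unfolding carrier_nil_component[OF \<Delta>(1-3)] by (simp add: nil_alg_def nil_class_zero)
qed

theorem theorem3:
  assumes "infinite (UNIV :: 'k::field set)"
    and "CHAR('k) = 3"
  shows "(\<forall>r s l d. d = r + s + l \<and> 1 \<le> d \<longrightarrow>
            inj_on (nil_word d :: nat list \<Rightarrow> 'k free set) (B_words r s l) \<and>
            vectorspace.basis class_ring
              (nil_component d (multideg_321 r s l) :: ('k, 'k free set) module)
              (nil_word d ` B_words r s l)) \<and>
         (\<forall>d \<Delta>. 1 \<le> d \<and> length \<Delta> = d \<and> sorted_wrt (\<ge>) \<Delta> \<and> (\<forall>\<delta>\<in>set \<Delta>. 1 \<le> \<delta>) \<and>
            (\<nexists>r s l. \<Delta> = multideg_321 r s l) \<longrightarrow>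
            carrier (nil_component d \<Delta> :: ('k, 'k free set) module) = {\<zero>\<^bsub>nil_alg d\<^esub>})"
proof -
  have char3: "(3 :: 'k) = 0" using of_nat_CHAR[where 'a = 'k] assms(2) by simp
  show ?thesis
  proof (intro conjI allI impI)
    fix r s l d :: nat assume d: "d = r + s + l \<and> 1 \<le> d"
    show "inj_on (nil_word d :: nat list \<Rightarrow> 'k free set) (B_words r s l)"
      by (rule B_words_basis(1)[OF char3 conjunct1[OF d] conjunct2[OF d]])
    show "vectorspace.basis class_ring (nil_component d (multideg_321 r s l) :: ('k, 'k free set) module)
      (nil_word d ` B_words r s l)"
      by (rule B_words_basis(2)[OF char3 conjunct1[OF d] conjunct2[OF d]])
  next
    fix d \<Delta>
    assume "1 \<le> d \<and> length \<Delta> = d \<and> sorted_wrt (\<ge>) \<Delta> \<and> (\<forall>\<delta>\<in>set \<Delta>. 1 \<le> \<delta>) \<and>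
      (\<nexists>r s l. \<Delta> = multideg_321 r s l)"
    then have \<Delta>: "length \<Delta> = d" "1 \<le> d" "\<forall>\<delta>\<in>set \<Delta>. 1 \<le> \<delta>"
      and sorted: "sorted_wrt (\<ge>) \<Delta>" and other: "\<nexists>r s l. \<Delta> = multideg_321 r s l"
      by simp_all
    have "\<exists>\<delta>\<in>set \<Delta>. \<delta> \<ge> 4"
    proof (rule ccontr)
      assume "\<not> (\<exists>\<delta>\<in>set \<Delta>. \<delta> \<ge> 4)"
      then have "\<forall>\<delta>\<in>set \<Delta>. 1 \<le> \<delta> \<and> \<delta> \<le> 3" using \<Delta>(3) by (force simp: not_le)
      from sorted_321[OF sorted this] other show False by (rule notE[rotated])
    qed
    then show "carrier (nil_component d \<Delta> :: ('k, 'k free set) module) = {\<zero>\<^bsub>nil_alg d\<^esub>}"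
      by (rule nil_component_trivial[OF char3 \<Delta>])
  qed
qed

end
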